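(* Let $J$ be a non-infinitesimal interval of ${}^\bullet\mathbb{R}$ and let $f,g:J\to{}^\bullet\mathbb{R}$ be smooth functions. Let $a,b\in J$ with $a<b$. If $g(x)\le f(x)$ for all $x\in[a,b]$, then $\int_a^b g\le\int_a^b f$.
   Context: Fermat reals: let $\mathbb{R}_o[t]$ be the set of maps $x:\mathbb{R}_{\ge0}\to\mathbb{R}$, $t\mapsto x_t$, of the form $x_t=r+\sum_{i=1}^k\alpha_i t^{a_i}+o(t)$ as $t\to0^+$, with $k\in\mathbb{N}$, $r,\alpha_i\in\mathbb{R}$, $a_i\in\mathbb{R}_{\ge0}$. Write $x\sim y$ iff $x_t=y_t+o(t)$ as $t\to0^+$. The ring of Fermat reals is ${}^\bullet\mathbb{R}:=\mathbb{R}_o[t]/\sim$ with pointwise operations; $\mathbb{R}\subseteq{}^\bullet\mathbb{R}$ via constants. The standard part of $x=[x_t]$ is ${}^\circ x:=x_0$. ${}^\bullet\mathbb{R}$ is totally ordered by: $x\le y$ iff for representatives there is $z\in\mathbb{R}_o[t]$ with $z\sim0$ and $x_t\le y_t+z_t$ for all small $t\ge0$; $[a,b]:=\{x\in{}^\bullet\mathbb{R}:a\le x\le b\}$. $\overline{{}^\bullet\mathbb{R}}:={}^\bullet\mathbb{R}\cup\{\pm\infty\}$, ${}^\circ(\pm\infty):=\pm\infty$. An interval is a set $[a,b],(a,b),[a,b),(a,b]$ of points of ${}^\bullet\mathbb{R}$ with $a\le b$ in $\overline{{}^\bullet\mathbb{R}}$; non-infinitesimal if ${}^\circ a<{}^\circ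 b$. The Fermat topology on ${}^\bullet\mathbb{R}^n$ has open sets ${}^\bullet V:=\{x:{}^\circ x\in V\}$, $V\subseteq\mathbb{R}^n$ open. For $\alpha\in C^\infty(W,\mathbb{R}^m)$, $W\subseteq\mathbb{R}^d$ open, ${}^\bullet\alpha([x_t]):=[\alpha(x_t)]$. A map $f:S\to{}^\bullet\mathbb{R}^m$, $S\subseteq{}^\bullet\mathbb{R}^n$, is smooth if for every $x\in S$ there exist open $V\subseteq\mathbb{R}^n$ with $x\in{}^\bullet V$, open $P\subseteq\mathbb{R}^{\mathsf p}$, $p\in{}^\bullet P$, $\alpha\in C^\infty(P\times V,\mathbb{R}^m)$ with $f(y)={}^\bullet\alpha(p,y)$ for $y\in{}^\bullet V\cap S$. For $g$ smooth on a non-infinitesimal interval $J$ and $x\in J$, $g'(x):={}^\bullet(\partial_2\alpha)(p,x)$ for any local representation of $g$ around $x$ (independent of it). Integral: for a non-infinitesimal interval $J$, smooth $f:J\to{}^\bullet\mathbb{R}$ and $u\in J$, $\int_u^{(-)}f$ is the unique smooth $I:J\to{}^\bullet\mathbb{R}$ with $I(u)=0$ and $I'(x)=f(x)$ for all $x\in J$, and $\int_u^v f:=I(v)$ for $v\in J$. *)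

theory Defs
  imports "HOL-Analysis.Analysis"
begin

text \<open>Maps R_{\<ge>0} \<rightarrow> R are represented by functions real \<Rightarrow> real; only the values
  at t \<ge> 0 are ever inspected.\<close>

text \<open>h = o(t) as t \<rightarrow> 0+ (we also require h 0 = 0, so that the defining equations
  hold at t = 0 as well, making the standard part x_0 well defined).\<close>
definition is_o :: "(real \<Rightarrow> real) \<Rightarrow> bool" where
  "is_o h \<longleftrightarrow> h 0 = 0 \<and> ((\<lambda>t. h t / t) \<longlongrightarrow> 0) (at_right 0)"

definition pw :: "real \<Rightarrow> real \<Rightarrow> real" where
  "pw t a = (if t = 0 then (if a = 0 then 1 else 0) else t powr a)"

definition Ro :: "(real \<Rightarrow> real) set" where
  "Ro = {x. \<exists>(r::real) (k::nat) (\<alpha>::nat \<Rightarrow> real) (a::nat \<Rightarrow> real) h.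
            (\<forall>i<k. 0 \<le> a i) \<and> is_o h \<and>
            (\<forall>t\<ge>0. x t = r + (\<Sum>i<k. \<alpha> i * pw t (a i)) + h t)}"

definition sim :: "(real \<Rightarrow> real) \<Rightarrow> (real \<Rightarrow> real) \<Rightarrow> bool" where
  "sim x y \<longleftrightarrow> is_o (\<lambda>t. x t - y t)"

definition cls :: "(real \<Rightarrow> real) \<Rightarrow> (real \<Rightarrow> real) set" where
  "cls x = {y \<in> Ro. sim x y}"

typedef fermat = "{C. \<exists>x\<in>Ro. C = cls x}"
proof -
  have "(\<lambda>_. 0) \<in> Ro"
    unfolding Ro_def is_o_def by (rule CollectI, rule exI[of _ 0], rule exI[of _ 0]) auto
  then show ?thesis by blast
qed

definition frac :: "(real \<Rightarrow> real) \<Rightarrow> fermat" where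
  "frac x = Abs_fermat (cls x)"

definition rep :: "fermat \<Rightarrow> (real \<Rightarrow> real)" where
  "rep X = (SOME x. x \<in> Rep_fermat X)"

definition fzero :: fermat where
  "fzero = frac (\<lambda>_. 0)"

definition std :: "fermat \<Rightarrow> real" where
  "std X = rep X 0"

definition fle :: "fermat \<Rightarrow> fermat \<Rightarrow> bool" where
  "fle X Y \<longleftrightarrow> (\<exists>x y z. x \<in> Rep_fermat X \<and> y \<in> Rep_fermat Y \<and> z \<in> Ro \<and> sim z (\<lambda>_. 0) \<and>
      (\<exists>\<delta>>0. \<forall>t. 0 \<le> t \<and> t < \<delta> \<longrightarrow> x t \<le> y t + z t))"

definition flt :: "fermat \<Rightarrow> fermat \<Rightarrow> bool" where
  "flt X Y \<longleftrightarrow> fle X Y \<and> X \<noteq> Y"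

datatype efermat = MInf | Fin fermat | PInf

fun ele :: "efermat \<Rightarrow> efermat \<Rightarrow> bool" where
  "ele MInf _ = True"
| "ele _ PInf = True"
| "ele (Fin x) (Fin y) = fle x y"
| "ele _ _ = False"

definition elt :: "efermat \<Rightarrow> efermat \<Rightarrow> bool" where
  "elt a b \<longleftrightarrow> ele a b \<and> a \<noteq> b"

fun estd :: "efermat \<Rightarrow> ereal" where
  "estd MInf = -\<infinity>"
| "estd (Fin x) = ereal (std x)"
| "estd PInf = \<infinity>"

definition noninf_interval :: "fermat set \<Rightarrow> bool" where
  "noninf_interval J \<longleftrightarrow> (\<exists>a b. ele a b \<and> estd a < estd b \<and>
     (J = {x. ele a (Fin x) \<and> ele (Fin x) b} \<or>
      J = {x. elt a (Fin x) \<and> elt (Fin x) b} \<or>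
      J = {x. ele a (Fin x) \<and> elt (Fin x) b} \<or>
      J = {x. elt a (Fin x) \<and> ele (Fin x) b}))"

text \<open>Points of R^N are functions nat \<Rightarrow> real vanishing at indices \<ge> N.\<close>
definition RN :: "nat \<Rightarrow> (nat \<Rightarrow> real) set" where
  "RN N = {x. \<forall>i\<ge>N. x i = 0}"

definition distN :: "nat \<Rightarrow> (nat \<Rightarrow> real) \<Rightarrow> (nat \<Rightarrow> real) \<Rightarrow> real" where
  "distN N x y = sqrt (\<Sum>i<N. (x i - y i)\<^sup>2)"

definition openN :: "nat \<Rightarrow> (nat \<Rightarrow> real) set \<Rightarrow> bool" where
  "openN N U \<longleftrightarrow> U \<subseteq> RN N \<and> (\<forall>x\<in>U. \<exists>e>0. \<forall>y\<in>RN N. distN N x y < e \<longrightarrow> y \<in> U)"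

definition contN :: "nat \<Rightarrow> (nat \<Rightarrow> real) set \<Rightarrow> ((nat \<Rightarrow> real) \<Rightarrow> real) \<Rightarrow> bool" where
  "contN N U g \<longleftrightarrow> (\<forall>x\<in>U. \<forall>e>0. \<exists>d>0. \<forall>y\<in>U. distN N x y < d \<longrightarrow> \<bar>g y - g x\<bar> < e)"

definition fpartial :: "nat \<Rightarrow> ((nat \<Rightarrow> real) \<Rightarrow> real) \<Rightarrow> (nat \<Rightarrow> real) \<Rightarrow> real" where
  "fpartial i g x = deriv (\<lambda>s. g (x(i := s))) (x i)"

coinductive CinfN :: "nat \<Rightarrow> (nat \<Rightarrow> real) set \<Rightarrow> ((nat \<Rightarrow> real) \<Rightarrow> real) \<Rightarrow> bool"
  for N U where
  "contN N U g \<Longrightarrow>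
   (\<forall>i<N. \<forall>x\<in>U. (\<lambda>s. g (x(i := s))) differentiable (at (x i))) \<Longrightarrow>
   (\<forall>i<N. CinfN N U (fpartial i g)) \<Longrightarrow> CinfN N U g"

text \<open>P \<times> V \<subseteq> R^N \<times> R encoded in R^(N+1): coordinate 0 is the R-variable y,
  coordinates 1..N the parameters.\<close>
definition prodU :: "nat \<Rightarrow> (nat \<Rightarrow> real) set \<Rightarrow> real set \<Rightarrow> (nat \<Rightarrow> real) set" where
  "prodU N P V = {z \<in> RN (Suc N). z 0 \<in> V \<and> (\<lambda>i. z (Suc i)) \<in> P}"

definition uncur :: "((nat \<Rightarrow> real) \<Rightarrow> real \<Rightarrow> real) \<Rightarrow> (nat \<Rightarrow> real) \<Rightarrow> real" where
  "uncur \<alpha> z = \<alpha> (\<lambda>i. z (Suc i)) (z 0)"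

definition stdv :: "nat \<Rightarrow> (nat \<Rightarrow> fermat) \<Rightarrow> (nat \<Rightarrow> real)" where
  "stdv N p = (\<lambda>i. if i < N then std (p i) else 0)"

definition ext :: "((nat \<Rightarrow> real) \<Rightarrow> real \<Rightarrow> real) \<Rightarrow> nat \<Rightarrow> (nat \<Rightarrow> fermat) \<Rightarrow> fermat \<Rightarrow> fermat" where
  "ext \<alpha> N p y = frac (\<lambda>t. \<alpha> (\<lambda>i. if i < N then rep (p i) t else 0) (rep y t))"

definition local_rep :: "fermat set \<Rightarrow> (fermat \<Rightarrow> fermat) \<Rightarrow> fermat \<Rightarrow> real set \<Rightarrow> nat \<Rightarrow>
    (nat \<Rightarrow> real) set \<Rightarrow> (nat \<Rightarrow> fermat) \<Rightarrow> ((nat \<Rightarrow> real) \<Rightarrow> real \<Rightarrow> real) \<Rightarrow> bool" where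
  "local_rep S f x V N P p \<alpha> \<longleftrightarrow>
     open V \<and> std x \<in> V \<and> openN N P \<and> stdv N p \<in> P \<and>
     CinfN (Suc N) (prodU N P V) (uncur \<alpha>) \<and>
     (\<forall>y\<in>S. std y \<in> V \<longrightarrow> f y = ext \<alpha> N p y)"

definition smoothF :: "fermat set \<Rightarrow> (fermat \<Rightarrow> fermat) \<Rightarrow> bool" where
  "smoothF S f \<longleftrightarrow> (\<forall>x\<in>S. \<exists>V N P p \<alpha>. local_rep S f x V N P p \<alpha>)"

text \<open>Derivative g'(x) = bullet-(\<partial>_2 \<alpha>)(p,x) for a local representation (independent of the choice).\<close>
definition derivF :: "fermat set \<Rightarrow> (fermat \<Rightarrow> fermat) \<Rightarrow> fermat \<Rightarrow> fermat" where
  "derivF S g x = (SOME d. \<exists>V N P p \<alpha>. local_rep S g x V N P p \<alpha> \<and>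
                         d = ext (\<lambda>q s. deriv (\<alpha> q) s) N p x)"

text \<open>Integral: I is the unique smooth I on J with I(u) = 0 and I' = f on J
  (normalised to 0 outside J so that it is unique as a HOL function).\<close>
definition fint :: "fermat set \<Rightarrow> (fermat \<Rightarrow> fermat) \<Rightarrow> fermat \<Rightarrow> fermat \<Rightarrow> fermat" where
  "fint J f u v = (THE I. smoothF J I \<and> I u = fzero \<and> (\<forall>x\<in>J. derivF J I x = f x) \<and>
                          (\<forall>x. x \<notin> J \<longrightarrow> I x = fzero)) v"

end

theory Submission
  imports Defs "HOL-Computational_Algebra.Polynomial"
begin

text \<open>
  Expanding the parameters of a local representation in powers of \<open>t\<close> (Taylor's formula in one
  parameter after the other) puts every smooth \<open>f\<close> into the form
  \<open>f y = \<Sum>\<^sub>b A\<^sub>b(y\<^sub>t) t\<^sup>b + o(t)\<close> with finitely many exponents \<open>b \<in> [0,1]\<close> and smooth real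
  coefficients \<open>A\<^sub>b\<close>, unique over the interior of the interval and hence, up to a flat error, also
  at its ends. Integrals are then taken coefficientwise: \<open>\<integral>\<^sub>u\<^sup>v f = \<Sum>\<^sub>b (F\<^sub>b(v\<^sub>t) - F\<^sub>b(u\<^sub>t)) t\<^sup>b\<close> with
  \<open>F\<^sub>b' = A\<^sub>b\<close>.

  The sign of an expansion is that of its leading coefficient. If \<open>f - g \<ge> 0\<close> and \<open>a\<close>, \<open>b\<close> have
  different standard parts, the first coefficient of \<open>f - g\<close> that does not vanish identically between
  them is nonnegative, so its integral is positive and dominates. If the standard parts agree, Taylor
  expansion along \<open>y = a + s (b - a)\<close> yields coefficients that are polynomials in \<open>s\<close>, and the same
  argument applies on \<open>0 \<le> s \<le> 1\<close>.
\<close>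

text \<open>The hypothesis compares \<open>g x\<close> and \<open>f x\<close> for each Fermat real
  \<open>x\<close> separately, with an error \<open>o(t)\<close> and a range of small
  \<open>t\<close> that depend on \<open>x\<close>. So the inequality cannot be integrated between
  representatives at fixed \<open>t\<close>: no common bound on the errors is given. Expansions get
  around this, because an inequality modulo \<open>o(t)\<close> becomes a lexicographic condition on
  real coefficients, and such conditions survive integration over a real variable. Two features
  complicate the bookkeeping. On an unbounded interval the exponents are only locally finite, so a
  common finite set is obtained by compactness between two standard parts. At an end of the interval
  a representative may run outside the real interval, where the coefficients are not determined by
  \<open>f\<close>; there one only knows that all derivatives of a difference vanish at the end,
  which is enough since infinitesimals are nilpotent modulo \<open>o(t)\<close>.\<close>

subsection \<open>Germs at 0 and generalised polynomials\<close>

text \<open>The filter contains the point 0 itself because \<open>is_o\<close> also prescribes the value there.\<close>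

definition at0 :: "real filter" where
  "at0 = inf (nhds 0) (principal {0..})"

lemma eventually_at0: "eventually P at0 \<longleftrightarrow> (\<exists>d>0. \<forall>t. 0 \<le> t \<and> t < d \<longrightarrow> P t)"
proof
  assume "eventually P at0"
  then obtain d where "d > 0" "\<And>t. dist t 0 < d \<Longrightarrow> t \<in> {0..} \<Longrightarrow> P t"
    unfolding at0_def eventually_inf_principal eventually_nhds_metric by blast
  then show "\<exists>d>0. \<forall>t. 0 \<le> t \<and> t < d \<longrightarrow> P t"
    by (intro exI[of _ d]) (auto simp: dist_real_def)
next
  assume "\<exists>d>0. \<forall>t. 0 \<le> t \<and> t < d \<longrightarrow> P t"
  then obtain d where "d > 0" "\<And>t. 0 \<le> t \<Longrightarrow> t < d \<Longrightarrow> P t" by blast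
  then show "eventually P at0"
    unfolding at0_def eventually_inf_principal eventually_nhds_metric
    by (intro exI[of _ d]) (auto simp: dist_real_def)
qed

lemma eventually_at0_at_right: "eventually P at0 \<longleftrightarrow> P 0 \<and> eventually P (at_right 0)"
proof
  assume "eventually P at0"
  then show "P 0 \<and> eventually P (at_right 0)"
    unfolding eventually_at0 eventually_at_right_field by force
next
  assume "P 0 \<and> eventually P (at_right 0)"
  then obtain d where "P 0" "d > 0" "\<And>t. 0 < t \<Longrightarrow> t < d \<Longrightarrow> P t"
    unfolding eventually_at_right_field by blast
  then show "eventually P at0"
    unfolding eventually_at0 by (metis order_le_less)
qed

lemma eventually_at0_nonneg: "eventually (\<lambda>t. 0 \<le> t) at0"
  unfolding eventually_at0 by (auto intro: exI[of _ 1])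

lemma eventually_at0_less: "d > 0 \<Longrightarrow> eventually (\<lambda>t. 0 \<le> t \<and> t < d) at0"
  unfolding eventually_at0 by auto

text \<open>At \<open>t = 0\<close> the bound reads \<open>\<bar>h 0\<bar> \<le> 0\<close>, so one
  estimate along \<open>at0\<close> carries both the limit and the prescribed value at 0. This is
  the form suited to domination arguments.\<close>

lemma is_o_iff: "is_o h \<longleftrightarrow> (\<forall>c>0. eventually (\<lambda>t. \<bar>h t\<bar> \<le> c * t) at0)"
proof
  assume h: "is_o h"
  show "\<forall>c>0. eventually (\<lambda>t. \<bar>h t\<bar> \<le> c * t) at0"
  proof (intro allI impI)
    fix c :: real assume "c > 0"
    with h have "eventually (\<lambda>t. \<bar>h t / t\<bar> < c) (at_right 0)"
      unfolding is_o_def tendsto_iff dist_real_def by simp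
    moreover have "eventually (\<lambda>t::real. t > 0) (at_right 0)"
      by (simp add: eventually_at_right_less)
    ultimately have "eventually (\<lambda>t. \<bar>h t\<bar> \<le> c * t) (at_right 0)"
      by eventually_elim (simp add: abs_divide divide_simps)
    then show "eventually (\<lambda>t. \<bar>h t\<bar> \<le> c * t) at0"
      using h by (simp add: eventually_at0_at_right is_o_def)
  qed
next
  assume h: "\<forall>c>0. eventually (\<lambda>t. \<bar>h t\<bar> \<le> c * t) at0"
  have "h 0 = 0"
    using h[rule_format, of 1] by (simp add: eventually_at0_at_right)
  moreover have "((\<lambda>t. h t / t) \<longlongrightarrow> 0) (at_right 0)"
    unfolding tendsto_iff dist_real_def
  proof (intro allI impI)
    fix e :: real assume "e > 0"
    \<comment> \<open>Half of \<open>e\<close> is used because the limit asks for a strict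
      inequality.\<close>
    then have "eventually (\<lambda>t. \<bar>h t\<bar> \<le> (e/2) * t) (at_right 0)"
      using h[rule_format, of "e/2"] by (simp only: eventually_at0_at_right)
    moreover have "eventually (\<lambda>t::real. t > 0) (at_right 0)"
      by (simp add: eventually_at_right_less)
    ultimately show "eventually (\<lambda>t. \<bar>h t / t - 0\<bar> < e) (at_right 0)"
    proof eventually_elim
      case (elim t)
      then have "\<bar>h t\<bar> / t \<le> e / 2" by (simp add: divide_simps mult.commute)
      then have "\<bar>h t\<bar> / t < e" using \<open>e > 0\<close> by linarith
      with elim show ?case by (simp add: abs_divide)
    qed
  qed
  ultimately show "is_o h" by (simp add: is_o_def)
qed

lemma is_oD: "is_o h \<Longrightarrow> c > 0 \<Longrightarrow> eventually (\<lambda>t. \<bar>h t\<bar> \<le> c * t) at0"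
  by (simp add: is_o_iff)

lemma is_o_mono:
  assumes "is_o h" "eventually (\<lambda>t. \<bar>g t\<bar> \<le> C * \<bar>h t\<bar>) at0"
  shows "is_o g"
  unfolding is_o_iff
proof (intro allI impI)
  fix c :: real assume "c > 0"
  \<comment> \<open>\<open>C\<close> may be zero or negative; this replacement is a positive divisor
    that still dominates.\<close>
  let ?D = "\<bar>C\<bar> + 1"
  have "eventually (\<lambda>t. \<bar>h t\<bar> \<le> (c / ?D) * t) at0"
    using \<open>c > 0\<close> by (intro is_oD assms(1)) (simp add: add_nonneg_pos)
  with assms(2) show "eventually (\<lambda>t. \<bar>g t\<bar> \<le> c * t) at0"
  proof eventually_elim
    case (elim t)
    have "\<bar>g t\<bar> \<le> ?D * \<bar>h t\<bar>"
      using elim(1) by (smt (verit) mult_right_mono abs_ge_zero)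
    also have "\<dots> \<le> ?D * ((c / ?D) * t)"
      using elim(2) by (intro mult_left_mono) auto
    also have "\<dots> = c * t" by (simp add: add_nonneg_pos field_simps)
    finally show ?case .
  qed
qed

lemma is_o_cong: "eventually (\<lambda>t. g t = h t) at0 \<Longrightarrow> is_o g \<longleftrightarrow> is_o h"
proof -
  assume ev: "eventually (\<lambda>t. g t = h t) at0"
  have "eventually (\<lambda>t. \<bar>g t\<bar> \<le> 1 * \<bar>h t\<bar>) at0" "eventually (\<lambda>t. \<bar>h t\<bar> \<le> 1 * \<bar>g t\<bar>) at0"
    by (rule eventually_mono[OF ev], simp)+
  then show ?thesis
    using is_o_mono[of h g 1] is_o_mono[of g h 1] by blast
qed

lemma is_o_add: "is_o g \<Longrightarrow> is_o h \<Longrightarrow> is_o (\<lambda>t. g t + h t)"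
  unfolding is_o_def using tendsto_add_zero[of "\<lambda>t. g t / t" "at_right 0" "\<lambda>t. h t / t"]
  by (simp add: add_divide_distrib)

lemma is_o_0 [simp]: "is_o (\<lambda>t. 0)"
  by (simp add: is_o_def)

lemma is_o_mult_bounded:
  assumes "is_o h" "eventually (\<lambda>t. \<bar>w t\<bar> \<le> C) at0"
  shows "is_o (\<lambda>t. w t * h t)"
  using assms(1)
proof (rule is_o_mono)
  show "eventually (\<lambda>t. \<bar>w t * h t\<bar> \<le> C * \<bar>h t\<bar>) at0"
    using assms(2) by eventually_elim (simp add: abs_mult mult_right_mono)
qed

lemma is_o_cmult: "is_o h \<Longrightarrow> is_o (\<lambda>t. c * h t)"
  by (rule is_o_mult_bounded[where C = "\<bar>c\<bar>"]) auto

lemma is_o_uminus: "is_o h \<Longrightarrow> is_o (\<lambda>t. - h t)"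
  using is_o_cmult[of h "-1"] by simp

lemma is_o_diff: "is_o g \<Longrightarrow> is_o h \<Longrightarrow> is_o (\<lambda>t. g t - h t)"
  using is_o_add[of g "\<lambda>t. - h t"] is_o_uminus[of h] by simp

lemma is_o_sum: "(\<And>i. i \<in> I \<Longrightarrow> is_o (h i)) \<Longrightarrow> is_o (\<lambda>t. \<Sum>i\<in>I. h i t)"
  by (induction I rule: infinite_finite_induct) (auto intro: is_o_add)

lemma is_o_tendsto: "is_o h \<Longrightarrow> (h \<longlongrightarrow> 0) at0"
proof (rule tendstoI)
  fix e :: real assume h: "is_o h" "e > 0"
  have "eventually (\<lambda>t. \<bar>h t\<bar> \<le> 1 * t) at0"
    by (rule is_oD[OF h(1)]) simp
  with eventually_at0_less[OF h(2)] show "eventually (\<lambda>t. dist (h t) 0 < e) at0"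
    by eventually_elim auto
qed

section \<open>Powers of \<open>t\<close>, with their value at 0\<close>

lemma pw_nonneg: "0 \<le> t \<Longrightarrow> 0 \<le> pw t a"
  by (simp add: pw_def)

lemma pw_pos: "0 < t \<Longrightarrow> 0 < pw t a"
  by (simp add: pw_def)

lemma pw_0_right [simp]: "pw t 0 = 1"
  by (simp add: pw_def powr_def)

text \<open>Nonnegativity of the exponents matters at \<open>t = 0\<close> only: opposite nonzero
  exponents would give 1 on the left and 0 on the right.\<close>

lemma pw_add: "0 \<le> a \<Longrightarrow> 0 \<le> b \<Longrightarrow> pw t (a + b) = pw t a * pw t b"
  by (auto simp: pw_def powr_add)

lemma pw_le_1: "0 \<le> t \<Longrightarrow> t \<le> 1 \<Longrightarrow> 0 \<le> a \<Longrightarrow> pw t a \<le> 1"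
  by (auto simp: pw_def powr_le_one_le powr_le1)

lemma pw_antimono: "0 \<le> t \<Longrightarrow> t \<le> 1 \<Longrightarrow> 0 \<le> a \<Longrightarrow> a \<le> b \<Longrightarrow> pw t b \<le> pw t a"
  using pw_add[of a "b - a" t] pw_le_1[of t "b - a"] pw_nonneg[of t a]
  by (simp add: mult_left_le)

lemma pw_tendsto: "0 \<le> a \<Longrightarrow> ((\<lambda>t. pw t a) \<longlongrightarrow> pw 0 a) at0"
proof (cases "a = 0")
  case False
  assume "0 \<le> a"
  with False have a: "0 < a" by simp
  have "((\<lambda>t::real. t powr a) \<longlongrightarrow> 0 powr a) at0"
    unfolding at0_def
  proof (rule tendsto_powr2)
    show "((\<lambda>t::real. t) \<longlongrightarrow> 0) (inf (nhds 0) (principal {0..}))"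
      by (metis filterlim_ident filterlim_mono inf_le1 order_refl)
    show "\<forall>\<^sub>F t::real in inf (nhds 0) (principal {0..}). 0 \<le> t"
      using eventually_at0_nonneg by (simp add: at0_def)
  qed (use a in auto)
  moreover have "pw t a = t powr a" for t using False by (simp add: pw_def)
  ultimately show ?thesis by simp
qed simp

lemma pw_tendsto_at_right: "0 < a \<Longrightarrow> ((\<lambda>t. pw t a) \<longlongrightarrow> 0) (at_right 0)"
  using pw_tendsto[of a] eventually_at0_at_right
  by (force simp: tendsto_def pw_def[of 0])

lemma is_o_pw: "1 < a \<Longrightarrow> is_o (\<lambda>t. pw t a)"
  unfolding is_o_def
proof
  assume a: "1 < a"
  show "pw 0 a = 0" using a by (simp add: pw_def)
  have "((\<lambda>t. pw t (a - 1)) \<longlongrightarrow> 0) (at_right 0)"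
    using a by (intro pw_tendsto_at_right) simp
  then show "((\<lambda>t. pw t a / t) \<longlongrightarrow> 0) (at_right 0)"
  proof (rule Lim_transform_eventually)
    have "eventually (\<lambda>t::real. t > 0) (at_right 0)"
      by (simp add: eventually_at_right_less)
    then show "eventually (\<lambda>t. pw t (a - 1) = pw t a / t) (at_right 0)"
      by eventually_elim (simp add: pw_def powr_diff)
  qed
qed

text \<open>Exponents above 1 are absorbed by the remainder, while 1 itself must stay because
  \<open>t\<close> is not \<open>o(t)\<close>. Values of \<open>c\<close> outside \<open>B\<close>
  are left arbitrary.\<close>

definition expan :: "real set \<Rightarrow> (real \<Rightarrow> real) \<Rightarrow> (real \<Rightarrow> real) \<Rightarrow> bool" where
  "expan B c x \<longleftrightarrow> finite B \<and> B \<subseteq> {0..1} \<and> is_o (\<lambda>t. x t - (\<Sum>b\<in>B. c b * pw t b))"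

text \<open>After division by \<open>pw t b0\<close>, exponents above \<open>b0\<close> keep a
  positive power and tend to 0, while those below contribute nothing by hypothesis. The coefficients
  may vary with \<open>t\<close>, because increments of smooth functions along germs will take their
  place.\<close>

lemma pw_sum_lead:
  assumes "finite B" and u: "\<And>b. b \<in> B \<Longrightarrow> (u b \<longlongrightarrow> c b) at0" and "b0 \<in> B"
    and z: "\<And>b t. b \<in> B \<Longrightarrow> b < b0 \<Longrightarrow> u b t = 0" and "\<And>b. b \<in> B \<Longrightarrow> 0 \<le> b"
  shows "((\<lambda>t. (\<Sum>b\<in>B. u b t * pw t b) / pw t b0) \<longlongrightarrow> c b0) (at_right 0)"
proof -
  have u': "(u b \<longlongrightarrow> c b) (at_right 0)" if "b \<in> B" for b
    using u[OF that] by (auto simp: tendsto_def eventually_at0_at_right)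
  have "((\<lambda>t. u b t * pw t b / pw t b0) \<longlongrightarrow> (if b = b0 then c b else 0)) (at_right 0)" if b: "b \<in> B" for b
  proof -
    have pos: "eventually (\<lambda>t::real. t > 0) (at_right 0)"
      by (simp add: eventually_at_right_less)
    consider "b < b0" | "b = b0" | "b > b0" by linarith
    then show ?thesis
    proof cases
      case 1
      then show ?thesis using z[OF b] by simp
    next
      case 2
      from u'[OF b] have "((\<lambda>t. u b t * pw t b / pw t b0) \<longlongrightarrow> c b) (at_right 0)"
      proof (rule Lim_transform_eventually)
        show "eventually (\<lambda>t. u b t = u b t * pw t b / pw t b0) (at_right 0)"
          using pos
        proof eventually_elim
          case (elim t)
          then show ?case using pw_pos[of t b0] 2 by simp
        qed
      qed
      then show ?thesis using 2 by simp
    next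
      case 3
      have "((\<lambda>t. u b t * pw t (b - b0)) \<longlongrightarrow> c b * 0) (at_right 0)"
        using 3 by (intro tendsto_mult u' b pw_tendsto_at_right) simp
      then have "((\<lambda>t. u b t * pw t b / pw t b0) \<longlongrightarrow> c b * 0) (at_right 0)"
      proof (rule Lim_transform_eventually)
        show "eventually (\<lambda>t. u b t * pw t (b - b0) = u b t * pw t b / pw t b0) (at_right 0)"
          using pos
        proof eventually_elim
          case (elim t)
          then show ?case
            using pw_pos[of t b0] pw_add[of b0 "b - b0" t] 3 assms(5)[OF assms(3)] by (simp add: field_simps)
        qed
      qed
      then show ?thesis using 3 by simp
    qed
  qed
  then have "((\<lambda>t. \<Sum>b\<in>B. u b t * pw t b / pw t b0) \<longlongrightarrow> (\<Sum>b\<in>B. if b = b0 then c b else 0)) (at_right 0)"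
    by (intro tendsto_sum)
  then show ?thesis
    using assms by (simp add: sum_divide_distrib sum.delta')
qed

text \<open>The order of Fermat reals on the level of germs. The negative part is a canonical choice
  for the auxiliary germ \<open>z\<close> in the definition of \<open>fle\<close>, which removes an
  existential quantifier.\<close>

definition nonneg_o :: "(real \<Rightarrow> real) \<Rightarrow> bool" where
  "nonneg_o x \<longleftrightarrow> is_o (\<lambda>t. max 0 (- x t))"

text \<open>For finite \<open>B\<close> this says that the first nonzero coefficient in the order of
  exponents, if there is one, is positive.\<close>

definition lex_nonneg :: "real set \<Rightarrow> (real \<Rightarrow> real) \<Rightarrow> bool" where
  "lex_nonneg B c \<longleftrightarrow> (\<forall>b\<in>B. (\<forall>b'\<in>B. b' < b \<longrightarrow> c b' = 0) \<longrightarrow> 0 \<le> c b)"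

text \<open>A negative leading coefficient at an exponent \<open>b \<le> 1\<close> would push the
  sum below a negative multiple of \<open>t\<close>, since \<open>t \<le> pw t b\<close> for small
  \<open>t\<close>; a negative part of that size is not \<open>o(t)\<close>.\<close>

lemma nonneg_o_psum_imp_lex_nonneg:
  assumes "finite B" "B \<subseteq> {0..1}" "nonneg_o (\<lambda>t. \<Sum>b\<in>B. c b * pw t b)"
  shows "lex_nonneg B c"
  unfolding lex_nonneg_def
proof (intro ballI impI)
  fix b assume b: "b \<in> B" and z: "\<forall>b'\<in>B. b' < b \<longrightarrow> c b' = 0"
  show "0 \<le> c b"
  proof (rule ccontr)
    assume "\<not> 0 \<le> c b"
    then have c: "c b < 0" by simp
    let ?S = "\<lambda>t. \<Sum>b\<in>B. c b * pw t b"
    have "((\<lambda>t. ?S t / pw t b) \<longlongrightarrow> c b) (at_right 0)"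
      by (rule pw_sum_lead) (use assms b z in auto)
    then have "eventually (\<lambda>t. ?S t / pw t b < c b / 2) (at_right 0)"
      using c by (intro order_tendstoD(2)) auto
    \<comment> \<open>The negative part will exceed \<open>- c b / 2\<close> times \<open>t\<close>,
      so any smaller positive constant produces the contradiction; a quarter is one choice.\<close>
    moreover have "eventually (\<lambda>t. \<bar>max 0 (- ?S t)\<bar> \<le> (- c b / 4) * t) (at_right 0)"
      using is_oD[OF assms(3)[unfolded nonneg_o_def], of "- c b / 4"] c
      by (simp only: eventually_at0_at_right)
    moreover have "eventually (\<lambda>t::real. 0 < t \<and> t < 1) (at_right 0)"
      by (auto simp: eventually_at_right_field intro: exI[of _ 1])
    ultimately have "eventually (\<lambda>t::real. False) (at_right 0)"
    proof eventually_elim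
      case (elim t)
      have p: "0 < pw t b" "t \<le> pw t b"
        using elim pw_pos pw_antimono[of t b 1] assms(2) b by (auto simp: pw_def)
      have "?S t < c b / 2 * pw t b" using elim(1) p by (simp add: divide_simps)
      then have "- ?S t > (- c b / 2) * pw t b" by simp
      moreover have "(- c b / 2) * pw t b \<ge> (- c b / 2) * t"
        using p c by (intro mult_left_mono) auto
      moreover have "(- c b / 2) * t > (- c b / 4) * t" using c elim by simp
      ultimately show False using elim(2) by linarith
    qed
    then show False by simp
  qed
qed

lemma is_o_imp_nonneg_o: "is_o x \<Longrightarrow> nonneg_o x"
  unfolding nonneg_o_def by (rule is_o_mono[where C = 1 and h = x]) (auto intro!: always_eventually)

lemma nonneg_o_add: "nonneg_o x \<Longrightarrow> nonneg_o y \<Longrightarrow> nonneg_o (\<lambda>t. x t + y t)"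
  unfolding nonneg_o_def
  by (rule is_o_mono[where C = 1, OF is_o_add[of "\<lambda>t. max 0 (- x t)" "\<lambda>t. max 0 (- y t)"]])
    (auto intro!: always_eventually)

lemma nonneg_o_cong_o: "is_o (\<lambda>t. x t - y t) \<Longrightarrow> nonneg_o x \<Longrightarrow> nonneg_o y"
  using nonneg_o_add[of x "\<lambda>t. - (x t - y t)"] is_o_imp_nonneg_o[OF is_o_uminus[of "\<lambda>t. x t - y t"]] by simp

lemma fnnI_eventually: "eventually (\<lambda>t. 0 \<le> x t) at0 \<Longrightarrow> nonneg_o x"
  unfolding nonneg_o_def by (rule is_o_mono[OF is_o_0, of _ 1]) (erule eventually_mono, simp)

text \<open>An \<open>o(t)\<close> sum is nonnegative together with its negative, so the first
  nonzero coefficient would have both signs. The uniqueness of coefficients rests on this.\<close>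

lemma psum_is_o_imp_0:
  assumes "finite B" "B \<subseteq> {0..1}" "is_o (\<lambda>t. \<Sum>b\<in>B. c b * pw t b)" "b \<in> B"
  shows "c b = 0"
proof -
  have l1: "lex_nonneg B c"
    using assms by (intro nonneg_o_psum_imp_lex_nonneg is_o_imp_nonneg_o)
  have l2: "lex_nonneg B (\<lambda>b. - c b)"
    using assms by (intro nonneg_o_psum_imp_lex_nonneg is_o_imp_nonneg_o) (auto simp: sum_negf intro: is_o_uminus)
  have "\<forall>b'\<in>B. b' \<le> b \<longrightarrow> c b' = 0" for b
  proof (rule ccontr)
    assume *: "\<not> ?thesis"
    define b1 where "b1 = Min {b\<in>B. c b \<noteq> 0}"
    have fin: "finite {b\<in>B. c b \<noteq> 0}" using assms by simp
    have "b1 \<in> {b\<in>B. c b \<noteq> 0}"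
      unfolding b1_def by (rule Min_in[OF fin]) (use * in auto)
    moreover have "c b' = 0" if "b' \<in> B" "b' < b1" for b'
      using that Min_le[OF fin, of b'] unfolding b1_def by force
    ultimately show False
      using l1 l2 unfolding lex_nonneg_def by force
  qed
  then show ?thesis using assms(4) by blast
qed

section \<open>The ring of germs with finite expansions\<close>

lemma expan_o: "is_o x \<Longrightarrow> expan {} c x"
  by (simp add: expan_def)

lemma expan_pw: "0 \<le> a \<Longrightarrow> \<exists>B d. expan B d (\<lambda>t. c * pw t a)"
proof (cases "a \<le> 1")
  case True
  assume "0 \<le> a"
  with True show ?thesis
    by (intro exI[of _ "{a}"] exI[of _ "\<lambda>_. c"]) (simp add: expan_def)
next
  case False
  then show ?thesis
    by (intro exI[of _ "{}"] exI[of _ "\<lambda>_. c"] expan_o is_o_cmult is_o_pw) simp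
qed

lemma expan_superset:
  assumes "expan B c x" "B \<subseteq> B'" "finite B'" "B' \<subseteq> {0..1}"
  shows "expan B' (\<lambda>b. if b \<in> B then c b else 0) x"
proof -
  have "(\<Sum>b\<in>B'. (if b \<in> B then c b else 0) * pw t b) = (\<Sum>b\<in>B. c b * pw t b)" for t
    using assms(2,3) by (intro sum.mono_neutral_cong_right) auto
  with assms show ?thesis by (simp add: expan_def)
qed

lemma expan_add:
  assumes "expan B c x" "expan B' c' y"
  shows "expan (B \<union> B') (\<lambda>b. (if b \<in> B then c b else 0) + (if b \<in> B' then c' b else 0)) (\<lambda>t. x t + y t)"
proof -
  have U: "finite (B \<union> B')" "B \<union> B' \<subseteq> {0..1}" using assms by (auto simp: expan_def)
  have "is_o (\<lambda>t. (x t - (\<Sum>b\<in>B \<union> B'. (if b \<in> B then c b else 0) * pw t b))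
      + (y t - (\<Sum>b\<in>B \<union> B'. (if b \<in> B' then c' b else 0) * pw t b)))"
    using expan_superset[OF assms(1) _ U] expan_superset[OF assms(2) _ U]
    by (intro is_o_add) (auto simp: expan_def)
  then show ?thesis using U by (simp add: expan_def algebra_simps sum.distrib)
qed

lemma ex_expan_sum:
  "(\<And>i. i \<in> I \<Longrightarrow> \<exists>B c. expan B c (x i)) \<Longrightarrow> \<exists>B c. expan B c (\<lambda>t. \<Sum>i\<in>I. x i t)"
proof (induction I rule: infinite_finite_induct)
  case (insert i I)
  then have "\<exists>B c. expan B c (x i)" "\<exists>B c. expan B c (\<lambda>t. \<Sum>i\<in>I. x i t)" by blast+
  then obtain B c B' c' where "expan B c (x i)" "expan B' c' (\<lambda>t. \<Sum>i\<in>I. x i t)" by blast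
  from expan_add[OF this] show ?case using insert.hyps by auto
qed (simp_all, (blast intro: expan_o[OF is_o_0])+)

lemma expan_cong_o: "is_o (\<lambda>t. y t - x t) \<Longrightarrow> expan B c x \<Longrightarrow> expan B c y"
  using is_o_add[of "\<lambda>t. y t - x t" "\<lambda>t. x t - (\<Sum>b\<in>B. c b * pw t b)"] by (simp add: expan_def)

text \<open>The definition of \<open>Ro\<close> allows repeated exponents, exponents above 1 and a
  separate constant; collecting terms, with the constant as exponent 0, leaves one coefficient per
  exponent in \<open>{0..1}\<close>. Conversely an enumeration of \<open>B\<close> gives back an
  indexed sum.\<close>

lemma Ro_iff: "x \<in> Ro \<longleftrightarrow> (\<exists>B c. expan B c x)"
proof
  assume "x \<in> Ro"
  then obtain r and k :: nat and \<alpha> a h where a: "\<forall>i<k. 0 \<le> a i" and h: "is_o h"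
    and x: "\<forall>t\<ge>0. x t = r + (\<Sum>i<k. \<alpha> i * pw t (a i)) + h t"
    unfolding Ro_def mem_Collect_eq by blast
  obtain B c where "expan B c (\<lambda>t. r * pw t 0)" using expan_pw[of 0] by blast
  moreover obtain B' c' where "expan B' c' (\<lambda>t. \<Sum>i<k. \<alpha> i * pw t (a i))"
    using ex_expan_sum[of "{..<k}" "\<lambda>i t. \<alpha> i * pw t (a i)"] expan_pw a by auto
  ultimately obtain B c where Bc: "expan B c (\<lambda>t. r * pw t 0 + (\<Sum>i<k. \<alpha> i * pw t (a i)))"
    using expan_add by blast
  have "is_o (\<lambda>t. x t - (r * pw t 0 + (\<Sum>i<k. \<alpha> i * pw t (a i))))"
    using h by (subst is_o_cong[where h = h]) (auto intro: eventually_mono[OF eventually_at0_nonneg] simp: x)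
  from expan_cong_o[OF this Bc] show "\<exists>B c. expan B c x" by blast
next
  assume "\<exists>B c. expan B c x"
  then obtain B c where B: "expan B c x" by blast
  then have "finite B" by (simp add: expan_def)
  then obtain e where e: "bij_betw e {0..<card B} B"
    using ex_bij_betw_nat_finite by blast
  show "x \<in> Ro"
    unfolding Ro_def
  proof (intro CollectI exI conjI)
    show "\<forall>i<card B. 0 \<le> e i"
      using B bij_betwE[OF e] by (force simp: expan_def)
    show "is_o (\<lambda>t. x t - (\<Sum>b\<in>B. c b * pw t b))" using B by (simp add: expan_def)
    have "(\<Sum>i<card B. c (e i) * pw t (e i)) = (\<Sum>b\<in>B. c b * pw t b)" for t
      using sum.reindex_bij_betw[OF e, of "\<lambda>b. c b * pw t b"] by (simp add: atLeast0LessThan)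
    then show "\<forall>t\<ge>0. x t = 0 + (\<Sum>i<card B. (c \<circ> e) i * pw t (e i)) + (x t - (\<Sum>b\<in>B. c b * pw t b))"
      by simp
  qed
qed

lemma is_o_Ro: "is_o x \<Longrightarrow> x \<in> Ro"
  using Ro_iff expan_o by blast

lemma Ro_pw: "0 \<le> a \<Longrightarrow> (\<lambda>t. c * pw t a) \<in> Ro"
  using Ro_iff expan_pw by blast

lemma Ro_const [simp]: "(\<lambda>t. c) \<in> Ro"
  using Ro_pw[of 0 c] by simp

lemma Ro_add: "x \<in> Ro \<Longrightarrow> y \<in> Ro \<Longrightarrow> (\<lambda>t. x t + y t) \<in> Ro"
  unfolding Ro_iff using expan_add by blast

lemma Ro_sum: "(\<And>i. i \<in> I \<Longrightarrow> x i \<in> Ro) \<Longrightarrow> (\<lambda>t. \<Sum>i\<in>I. x i t) \<in> Ro"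
  by (induction I rule: infinite_finite_induct) (auto intro: Ro_add)

text \<open>Reduces a property stable under addition to remainders and single monomials; products,
  Hoelder bounds and multiplication of expansions by germs are all handled this way.\<close>

lemma Ro_induct [consumes 1, case_names o pw add]:
  assumes "x \<in> Ro" and o: "\<And>h. is_o h \<Longrightarrow> P h"
    and pw: "\<And>c a. 0 \<le> a \<Longrightarrow> P (\<lambda>t. c * pw t a)"
    and add: "\<And>x y. P x \<Longrightarrow> P y \<Longrightarrow> P (\<lambda>t. x t + y t)"
  shows "P x"
proof -
  obtain B c where B: "expan B c x" using assms(1) Ro_iff by blast
  have "P (\<lambda>t. \<Sum>b\<in>C. c b * pw t b)" if "C \<subseteq> B" for C
    using finite_subset[OF that] B that
  proof (induction C rule: infinite_finite_induct)
    case (insert b C)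
    then have "P (\<lambda>t. c b * pw t b + (\<Sum>b\<in>C. c b * pw t b))"
      by (intro add pw) (auto simp: expan_def)
    then show ?case using insert by simp
  qed (auto simp: o expan_def)
  then have "P (\<lambda>t. (\<Sum>b\<in>B. c b * pw t b) + (x t - (\<Sum>b\<in>B. c b * pw t b)))"
    using B \<open>\<And>C. C \<subseteq> B \<Longrightarrow> _\<close>[of B] by (intro add) (auto simp: expan_def intro: o)
  then show "P x" by simp
qed

lemma Ro_tendsto: "x \<in> Ro \<Longrightarrow> (x \<longlongrightarrow> x 0) at0"
proof (induction rule: Ro_induct)
  case (o h)
  then have "h 0 = 0" by (simp add: is_o_def)
  with is_o_tendsto[OF o] show ?case by simp
next
  case (pw c a)
  then show ?case by (intro tendsto_intros pw_tendsto)
qed (intro tendsto_intros)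

lemma tendsto_at0_bounded: "(x \<longlongrightarrow> l) at0 \<Longrightarrow> \<exists>C. eventually (\<lambda>t. \<bar>x t :: real\<bar> \<le> C) at0"
proof -
  assume "(x \<longlongrightarrow> l) at0"
  then have "eventually (\<lambda>t. dist (x t) l < 1) at0"
    by (rule tendstoD) simp
  then have "eventually (\<lambda>t. \<bar>x t\<bar> \<le> \<bar>l\<bar> + 1) at0"
    by eventually_elim (simp add: dist_real_def)
  then show ?thesis by blast
qed

lemma Ro_bounded: "x \<in> Ro \<Longrightarrow> \<exists>C. eventually (\<lambda>t. \<bar>x t\<bar> \<le> C) at0"
  using tendsto_at0_bounded Ro_tendsto by blast

lemma is_o_mult_Ro: "is_o h \<Longrightarrow> x \<in> Ro \<Longrightarrow> is_o (\<lambda>t. x t * h t)"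
  using Ro_bounded is_o_mult_bounded by blast

lemma Ro_mult: "x \<in> Ro \<Longrightarrow> y \<in> Ro \<Longrightarrow> (\<lambda>t. x t * y t) \<in> Ro"
proof (induction x rule: Ro_induct)
  case (o h)
  then show ?case using is_o_Ro is_o_mult_Ro[of h y] by (simp add: mult.commute)
next
  case (pw c a)
  from pw(2,1) show ?case
  proof (induction y rule: Ro_induct)
    case (o h)
    have "(\<lambda>t. c * pw t a) \<in> Ro" using \<open>0 \<le> a\<close> by (rule Ro_pw)
    from is_o_mult_Ro[OF \<open>is_o h\<close> this] show ?case by (rule is_o_Ro)
  next
    case (pw d b)
    then show ?case using Ro_pw[of "a + b" "c * d"] by (simp add: pw_add algebra_simps)
  qed (auto simp: distrib_left intro: Ro_add)
qed (auto simp: distrib_right intro: Ro_add)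

lemma Ro_cmult: "x \<in> Ro \<Longrightarrow> (\<lambda>t. c * x t) \<in> Ro"
  using Ro_mult[of "\<lambda>t. c" x] by simp

lemma Ro_uminus: "x \<in> Ro \<Longrightarrow> (\<lambda>t. - x t) \<in> Ro"
  using Ro_cmult[of x "-1"] by simp

lemma Ro_diff: "x \<in> Ro \<Longrightarrow> y \<in> Ro \<Longrightarrow> (\<lambda>t. x t - y t) \<in> Ro"
  using Ro_add[of x "\<lambda>t. - y t"] Ro_uminus by simp

lemma Ro_power: "x \<in> Ro \<Longrightarrow> (\<lambda>t. x t ^ n) \<in> Ro"
  by (induction n) (auto intro: Ro_mult)

lemma Ro_cong_o: "is_o (\<lambda>t. x t - y t) \<Longrightarrow> y \<in> Ro \<Longrightarrow> x \<in> Ro"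
  using Ro_add[of "\<lambda>t. x t - y t" y] is_o_Ro by simp

text \<open>A nonconstant monomial is bounded by its own power, a constant contributes nothing, and
  the remainder is bounded by \<open>t\<close>; for a sum the smaller exponent works on
  \<open>t < 1\<close>.\<close>

lemma Ro_Hoelder:
  assumes "x \<in> Ro"
  shows "\<exists>\<beta>>0. \<exists>C\<ge>0. eventually (\<lambda>t. \<bar>x t - x 0\<bar> \<le> C * pw t \<beta>) at0"
  using assms
proof (induction rule: Ro_induct)
  case (o h)
  have "eventually (\<lambda>t. \<bar>h t\<bar> \<le> 1 * t) at0" by (rule is_oD[OF o]) simp
  then have "eventually (\<lambda>t. \<bar>h t - h 0\<bar> \<le> 1 * pw t 1) at0"
    using eventually_at0_nonneg
    by eventually_elim (use o in \<open>auto simp: pw_def is_o_def\<close>)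
  then show ?case by (intro exI[of _ 1] conjI) auto
next
  case (pw c a)
  show ?case
  proof (cases "a = 0")
    case True
    then show ?thesis by (intro exI[of _ 1] conjI exI[of _ 0]) auto
  next
    case False
    have "\<bar>c * pw t a - c * pw 0 a\<bar> \<le> \<bar>c\<bar> * pw t a" if "0 \<le> t" for t
      using False pw_nonneg[OF that, of a] by (simp add: pw_def[of 0] abs_mult)
    then show ?thesis
      using False pw by (intro exI[of _ a] conjI exI[of _ "\<bar>c\<bar>"])
        (auto intro: eventually_mono[OF eventually_at0_nonneg])
  qed
next
  case (add x y)
  then obtain \<beta> C \<gamma> D where *: "\<beta> > 0" "\<gamma> > 0" "C \<ge> 0" "D \<ge> 0"
    "eventually (\<lambda>t. \<bar>x t - x 0\<bar> \<le> C * pw t \<beta>) at0" "eventually (\<lambda>t. \<bar>y t - y 0\<bar> \<le> D * pw t \<gamma>) at0"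
    by blast
  have "eventually (\<lambda>t. \<bar>x t + y t - (x 0 + y 0)\<bar> \<le> (C + D) * pw t (min \<beta> \<gamma>)) at0"
    using *(5,6) eventually_at0_less[OF zero_less_one]
  proof eventually_elim
    case (elim t)
    have "C * pw t \<beta> \<le> C * pw t (min \<beta> \<gamma>)" "D * pw t \<gamma> \<le> D * pw t (min \<beta> \<gamma>)"
      using * elim by (auto intro!: mult_left_mono pw_antimono)
    then show ?case using elim by (simp add: distrib_right)
  qed
  then show ?case using * by (intro exI[of _ "min \<beta> \<gamma>"] conjI exI[of _ "C + D"]) auto
qed

lemma pw_power: "0 \<le> a \<Longrightarrow> pw t a ^ n = pw t (real n * a)"
  by (induction n) (auto simp: pw_add algebra_simps)

text \<open>Infinitesimals are nilpotent modulo \<open>o(t)\<close>: a Hoelder exponent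
  \<open>\<beta>\<close> bounds the power \<open>n\<close> by a multiple of
  \<open>pw t (n * \<beta>)\<close>, and \<open>n * \<beta> > 1\<close> suffices. This is why finite
  Taylor polynomials represent Fermat reals exactly.\<close>

lemma Ro_power_is_o:
  assumes "x \<in> Ro" "x 0 = 0"
  shows "\<exists>N>0. \<forall>n\<ge>N. is_o (\<lambda>t. x t ^ n)"
proof -
  obtain \<beta> C where bC: "\<beta> > 0" "C \<ge> 0" "eventually (\<lambda>t. \<bar>x t\<bar> \<le> C * pw t \<beta>) at0"
    using Ro_Hoelder[OF assms(1)] assms(2) by auto
  obtain N :: nat where N: "1 < real N * \<beta>" using reals_Archimedean3[OF bC(1)] by blast
  have "is_o (\<lambda>t. x t ^ n)" if "n \<ge> N" for n
  proof (rule is_o_mono[where C = "C ^ n"])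
    have "real N * \<beta> \<le> real n * \<beta>" using that bC by (intro mult_right_mono) auto
    then show "is_o (\<lambda>t. pw t (real n * \<beta>))" using N by (intro is_o_pw) linarith
    show "eventually (\<lambda>t. \<bar>x t ^ n\<bar> \<le> C ^ n * \<bar>pw t (real n * \<beta>)\<bar>) at0"
      using bC(3) eventually_at0_nonneg
    proof eventually_elim
      case (elim t)
      have "\<bar>x t ^ n\<bar> \<le> (C * pw t \<beta>) ^ n"
        using elim by (simp add: power_abs power_mono)
      then show ?case
        using bC pw_nonneg[OF elim(2)] by (simp add: power_mult_distrib pw_power)
    qed
  qed
  moreover have "N > 0" using N by (cases N) auto
  ultimately show ?thesis by blast
qed

subsection \<open>Smooth functions of one real variable\<close>

text \<open>The derivatives are two-sided and taken at the points of \<open>S\<close>, so the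
  property is a pointwise one: it passes to subsets and can be glued without further work.\<close>

definition smooth :: "real set \<Rightarrow> (real \<Rightarrow> real) \<Rightarrow> bool" where
  "smooth S f \<longleftrightarrow> (\<forall>n. \<forall>x\<in>S. ((deriv ^^ n) f has_real_derivative (deriv ^^ Suc n) f x) (at x))"

text \<open>Iterates of \<open>deriv\<close> are awkward to compute directly; any chain
  \<open>D n\<close> of successive derivatives on an open set has to agree with them there.\<close>

lemma smooth_witness:
  assumes "open S" "\<And>x. x \<in> S \<Longrightarrow> D 0 x = f x"
    and D: "\<And>n x. x \<in> S \<Longrightarrow> (D n has_real_derivative D (Suc n) x) (at x)"
  shows "smooth S f" and "x \<in> S \<Longrightarrow> (deriv ^^ n) f x = D n x"
proof -
  have eq: "\<forall>x\<in>S. (deriv ^^ n) f x = D n x" for n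
  proof (induction n)
    case (Suc n)
    show ?case
    proof
      fix x assume x: "x \<in> S"
      have "((deriv ^^ n) f has_real_derivative D (Suc n) x) (at x)"
        by (rule has_field_derivative_transform_within_open[OF D[OF x] assms(1) x]) (use Suc in auto)
      then show "(deriv ^^ Suc n) f x = D (Suc n) x" by (simp add: DERIV_imp_deriv)
    qed
  qed (use assms(2) in auto)
  then show "x \<in> S \<Longrightarrow> (deriv ^^ n) f x = D n x" by blast
  show "smooth S f"
    unfolding smooth_def
  proof (intro allI ballI)
    fix n x assume x: "x \<in> S"
    show "((deriv ^^ n) f has_real_derivative (deriv ^^ Suc n) f x) (at x)"
      by (rule has_field_derivative_transform_within_open[OF _ assms(1) x, of "D n"])
        (use D[OF x, of n] eq[of n] eq[of "Suc n"] x in auto)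
  qed
qed

lemma smoothD: "smooth S f \<Longrightarrow> x \<in> S \<Longrightarrow> ((deriv ^^ n) f has_real_derivative (deriv ^^ Suc n) f x) (at x)"
  by (simp add: smooth_def)

lemma smooth_has_deriv: "smooth S f \<Longrightarrow> x \<in> S \<Longrightarrow> (f has_real_derivative deriv f x) (at x)"
  using smoothD[of S f x 0] by simp

lemma smooth_isCont: "smooth S f \<Longrightarrow> x \<in> S \<Longrightarrow> isCont f x"
  using smooth_has_deriv DERIV_isCont by blast

lemma smooth_subset: "smooth S f \<Longrightarrow> T \<subseteq> S \<Longrightarrow> smooth T f"
  by (auto simp: smooth_def)

lemma smooth_local: "(\<And>x. x \<in> S \<Longrightarrow> \<exists>T. x \<in> T \<and> smooth T f) \<Longrightarrow> smooth S f"
  unfolding smooth_def by blast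

lemma smooth_deriv: "smooth S f \<Longrightarrow> smooth S (deriv f)"
  unfolding smooth_def by (metis comp_apply funpow_Suc_right)

lemma smooth_cong: "open S \<Longrightarrow> smooth S f \<Longrightarrow> (\<And>x. x \<in> S \<Longrightarrow> f x = g x) \<Longrightarrow> smooth S g"
  by (rule smooth_witness[where D = "\<lambda>n. (deriv ^^ n) f"]) (auto simp del: funpow.simps(2) intro: smoothD)

lemma smooth_const [simp]: "smooth S (\<lambda>_. c)"
proof -
  have "smooth UNIV (\<lambda>_. c)"
  proof (rule smooth_witness)
    show "((if n = 0 then (\<lambda>_. c) else (\<lambda>_. 0)) has_real_derivative (if Suc n = 0 then (\<lambda>_. c) else (\<lambda>_. 0)) x) (at x)"
      for n x by auto
  qed auto
  then show ?thesis by (rule smooth_subset) auto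
qed

lemma smooth_add: "open S \<Longrightarrow> smooth S f \<Longrightarrow> smooth S g \<Longrightarrow> smooth S (\<lambda>x. f x + g x)"
  by (rule smooth_witness[where D = "\<lambda>n x. (deriv ^^ n) f x + (deriv ^^ n) g x"])
    (auto simp del: funpow.simps(2) intro!: DERIV_add smoothD)

lemma smooth_cmult: "open S \<Longrightarrow> smooth S f \<Longrightarrow> smooth S (\<lambda>x. c * f x)"
  by (rule smooth_witness[where D = "\<lambda>n x. c * (deriv ^^ n) f x"])
    (auto simp del: funpow.simps(2) intro!: DERIV_cmult smoothD)

lemma smooth_diff: "open S \<Longrightarrow> smooth S f \<Longrightarrow> smooth S g \<Longrightarrow> smooth S (\<lambda>x. f x - g x)"
  using smooth_add[of S f "\<lambda>x. (-1) * g x"] smooth_cmult[of S g "-1"] by simp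

lemma smooth_antideriv:
  assumes "open S" "smooth S f" "\<And>x. x \<in> S \<Longrightarrow> (F has_real_derivative f x) (at x)"
  shows "smooth S F"
proof (rule smooth_witness[where D = "\<lambda>n. case n of 0 \<Rightarrow> F | Suc n \<Rightarrow> (deriv ^^ n) f"])
  show "((case n of 0 \<Rightarrow> F | Suc n \<Rightarrow> (deriv ^^ n) f) has_real_derivative
      (case Suc n of 0 \<Rightarrow> F | Suc n \<Rightarrow> (deriv ^^ n) f) x) (at x)" if "x \<in> S" for n x
    using assms that smoothD[of S f x "n - 1"] by (cases n) (auto simp del: funpow.simps(2))
qed (use assms in auto)

text \<open>Lagrange's remainder with \<open>1 / fact n\<close> estimated by 1. The chain
  \<open>D\<close> is abstract because it will also consist of iterated partial derivatives along a
  coordinate line.\<close>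

lemma taylor_bound:
  fixes D :: "nat \<Rightarrow> real \<Rightarrow> real"
  assumes "n > 0" and D: "\<And>m t. m < n \<Longrightarrow> \<bar>t - c\<bar> \<le> r \<Longrightarrow> (D m has_real_derivative D (Suc m) t) (at t)"
    and C: "\<And>t. \<bar>t - c\<bar> \<le> r \<Longrightarrow> \<bar>D n t\<bar> \<le> C" and x: "\<bar>x - c\<bar> \<le> r"
  shows "\<bar>D 0 x - (\<Sum>m<n. D m c / fact m * (x - c) ^ m)\<bar> \<le> C * \<bar>x - c\<bar> ^ n"
proof (cases "x = c")
  case True
  have "(\<Sum>m<n. D m c / fact m * (x - c) ^ m) = (\<Sum>m<n. if m = 0 then D 0 c else 0)"
    using True by (intro sum.cong) auto
  then show ?thesis using True assms(1) by (simp add: power_0_left)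
next
  case False
  have "\<exists>t. (if x < c then x < t \<and> t < c else c < t \<and> t < x) \<and>
    D 0 x = (\<Sum>m<n. (D m c / fact m) * (x - c)^m) + (D n t / fact n) * (x - c)^n"
    by (rule Taylor[where a = "c - r" and b = "c + r"]) (use assms False in \<open>auto simp: abs_le_iff\<close>)
  then obtain t where t: "if x < c then x < t \<and> t < c else c < t \<and> t < x"
    "D 0 x = (\<Sum>m<n. (D m c / fact m) * (x - c)^m) + (D n t / fact n) * (x - c)^n" by blast
  have "\<bar>t - c\<bar> \<le> r" using t(1) x by (auto split: if_splits)
  from C[OF this] have "\<bar>D n t / fact n\<bar> \<le> C"
    using frac_le[of "\<bar>D n t\<bar>" "\<bar>D n t\<bar>" 1 "fact n"] by (simp add: abs_divide)
  then have "\<bar>D n t / fact n\<bar> * \<bar>x - c\<bar> ^ n \<le> C * \<bar>x - c\<bar> ^ n"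
    by (rule mult_right_mono) simp
  then show ?thesis using t(2) by (simp add: abs_mult power_abs)
qed

text \<open>The remainder is bounded by a multiple of the \<open>n\<close>-th power of an
  infinitesimal, so once this power is \<open>o(t)\<close> the Taylor polynomial represents the same
  Fermat real. The bound on the \<open>n\<close>-th derivative comes from compactness of a closed
  ball inside \<open>S\<close>.\<close>

lemma taylor_Ro_power:
  assumes "open S" "smooth S f" "y \<in> Ro" "y 0 \<in> S" and n: "n > 0" "is_o (\<lambda>t. (y t - y 0) ^ n)"
  shows "is_o (\<lambda>t. f (y t) - (\<Sum>m<n. (deriv ^^ m) f (y 0) / fact m * (y t - y 0) ^ m))"
proof -
  obtain r where r: "r > 0" "cball (y 0) r \<subseteq> S"
    using assms(1,4) open_contains_cball by blast
    have "continuous_on (cball (y 0) r) ((deriv ^^ n) f)"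
      using r assms(2) by (intro continuous_at_imp_continuous_on) (auto intro!: DERIV_isCont smoothD[of S])
    then have "bounded ((deriv ^^ n) f ` cball (y 0) r)"
      using compact_continuous_image compact_imp_bounded compact_cball by blast
    then obtain C where C: "\<And>x. x \<in> cball (y 0) r \<Longrightarrow> \<bar>(deriv ^^ n) f x\<bar> \<le> C"
      unfolding bounded_iff real_norm_def by blast
    have bd: "\<bar>f x - (\<Sum>m<n. (deriv ^^ m) f (y 0) / fact m * (x - y 0) ^ m)\<bar> \<le> C * \<bar>x - y 0\<bar> ^ n"
      if "\<bar>x - y 0\<bar> \<le> r" for x
    proof -
      have "\<bar>(deriv ^^ 0) f x - (\<Sum>m<n. (deriv ^^ m) f (y 0) / fact m * (x - y 0) ^ m)\<bar> \<le> C * \<bar>x - y 0\<bar> ^ n"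
      proof (rule taylor_bound[OF _ _ _ that])
        show "((deriv ^^ m) f has_real_derivative (deriv ^^ Suc m) f t) (at t)" if "\<bar>t - y 0\<bar> \<le> r" for m t
          using that r by (intro smoothD[OF assms(2)]) (auto simp: dist_real_def abs_minus_commute)
        show "\<bar>(deriv ^^ n) f t\<bar> \<le> C" if "\<bar>t - y 0\<bar> \<le> r" for t
          using that by (intro C) (auto simp: dist_real_def abs_minus_commute)
      qed (use n in auto)
      then show ?thesis by simp
    qed
    show ?thesis
    proof (rule is_o_mono[OF n(2), where C = C])
      have "eventually (\<lambda>t. dist (y t) (y 0) < r) at0"
        using Ro_tendsto[OF assms(3)] r(1) by (rule tendstoD)
      then show "eventually (\<lambda>t. \<bar>f (y t) - (\<Sum>m<n. (deriv ^^ m) f (y 0) / fact m * (y t - y 0) ^ m)\<bar>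
          \<le> C * \<bar>(y t - y 0) ^ n\<bar>) at0"
        by eventually_elim (use bd in \<open>simp add: dist_real_def power_abs\<close>)
    qed
qed

lemma taylor_Ro:
  assumes "open S" "smooth S f" "y \<in> Ro" "y 0 \<in> S"
  shows "\<exists>n. is_o (\<lambda>t. f (y t) - (\<Sum>m<n. (deriv ^^ m) f (y 0) / fact m * (y t - y 0) ^ m))"
proof -
  obtain n where "n > 0" "is_o (\<lambda>t. (y t - y 0) ^ n)"
    using Ro_power_is_o[of "\<lambda>t. y t - y 0"] assms(3) Ro_diff by auto
  then show ?thesis using taylor_Ro_power[OF assms] by blast
qed

lemma smooth_comp_Ro:
  assumes "open S" "smooth S f" "y \<in> Ro" "y 0 \<in> S"
  shows "(\<lambda>t. f (y t)) \<in> Ro"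
proof -
  obtain n where "is_o (\<lambda>t. f (y t) - (\<Sum>m<n. (deriv ^^ m) f (y 0) / fact m * (y t - y 0) ^ m))"
    using taylor_Ro[OF assms] by blast
  then show ?thesis
    by (rule Ro_cong_o) (intro Ro_sum Ro_cmult Ro_power Ro_diff assms Ro_const)
qed

lemma flat_is_o:
  assumes "open S" "smooth S f" "y \<in> Ro" "y 0 \<in> S" and z: "\<And>m. (deriv ^^ m) f (y 0) = 0"
  shows "is_o (\<lambda>t. f (y t))"
  using taylor_Ro[OF assms(1-4)] by (auto simp: z)

lemma vanish_derivs:
  assumes "open T" "\<And>x. x \<in> T \<Longrightarrow> f x = (0::real)" "x \<in> T"
  shows "(deriv ^^ m) f x = 0"
proof -
  have "\<forall>x\<in>T. (deriv ^^ m) f x = 0"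
  proof (induction m)
    case (Suc m)
    have "((deriv ^^ m) f has_real_derivative 0) (at x)" if "x \<in> T" for x
      by (rule has_field_derivative_transform_within_open[OF _ assms(1) that, of "\<lambda>_. 0"]) (use Suc in auto)
    then show ?case by (auto intro: DERIV_imp_deriv)
  qed (use assms in auto)
  then show ?thesis using assms(3) by blast
qed

text \<open>By continuity all derivatives of \<open>f\<close> vanish at the limit point
  \<open>y 0\<close>, so its Taylor polynomials there are zero. This gives control at the boundary
  of \<open>T\<close>, where \<open>y t\<close> may lie outside \<open>T\<close> for every
  \<open>t > 0\<close>.\<close>

lemma vanish_is_o:
  assumes "open S" "smooth S f" "y \<in> Ro" "y 0 \<in> S"
    and T: "open T" "\<And>x. x \<in> T \<Longrightarrow> f x = 0" and cl: "y 0 \<in> closure (T \<inter> S)"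
  shows "is_o (\<lambda>t. f (y t))"
proof (rule flat_is_o[OF assms(1-4)])
  fix m
  have "isCont ((deriv ^^ m) f) (y 0)"
    using smoothD[OF assms(2,4)] DERIV_isCont by blast
  moreover obtain u where u: "\<And>n. u n \<in> T \<inter> S" "u \<longlonglongrightarrow> y 0"
    using cl unfolding closure_sequential by blast
  ultimately have "(\<lambda>n. (deriv ^^ m) f (u n)) \<longlonglongrightarrow> (deriv ^^ m) f (y 0)"
    using isCont_tendsto_compose by blast
  moreover have "(deriv ^^ m) f (u n) = 0" for n
    by (rule vanish_derivs[OF T]) (use u in auto)
  ultimately show "(deriv ^^ m) f (y 0) = 0"
    using LIMSEQ_unique[of "\<lambda>n. (deriv ^^ m) f (u n)" "(deriv ^^ m) f (y 0)" 0] by simp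
qed

subsection \<open>The ordered set of Fermat reals\<close>

lemma sim_cls: "sim x y \<Longrightarrow> cls x = cls y"
proof -
  assume xy: "sim x y"
  have "sim y z" if "sim x z" for z
    using is_o_diff[of "\<lambda>t. x t - z t" "\<lambda>t. x t - y t"] xy that by (simp add: sim_def)
  moreover have "sim x z" if "sim y z" for z
    using is_o_add[of "\<lambda>t. y t - z t" "\<lambda>t. x t - y t"] xy that by (simp add: sim_def)
  ultimately show ?thesis unfolding cls_def by blast
qed

lemma sim_refl [simp]: "sim x x"
  by (simp add: sim_def)

lemma frac_cong: "sim x y \<Longrightarrow> frac x = frac y"
  by (simp add: frac_def sim_cls)

lemma Rep_frac: "x \<in> Ro \<Longrightarrow> Rep_fermat (frac x) = cls x"
  unfolding frac_def by (subst Abs_fermat_inverse) auto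

lemma frac_eqD: "x \<in> Ro \<Longrightarrow> y \<in> Ro \<Longrightarrow> frac x = frac y \<Longrightarrow> sim x y"
proof -
  assume "x \<in> Ro" "y \<in> Ro" "frac x = frac y"
  then have "cls x = cls y" using Rep_frac[of x] Rep_frac[of y] by simp
  moreover have "y \<in> cls y" using \<open>y \<in> Ro\<close> by (simp add: cls_def)
  ultimately have "y \<in> cls x" by simp
  then show "sim x y" by (simp add: cls_def)
qed

lemma Rep_fermat_rep: "rep X \<in> Rep_fermat X"
proof -
  obtain x where "x \<in> Ro" "Rep_fermat X = cls x" using Rep_fermat[of X] by blast
  then have "x \<in> Rep_fermat X" by (simp add: cls_def)
  then show ?thesis unfolding rep_def by (rule someI[where P = "\<lambda>x. x \<in> Rep_fermat X"])
qed

lemma rep_Ro [simp]: "rep X \<in> Ro"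
proof -
  obtain x where "x \<in> Ro" "Rep_fermat X = cls x" using Rep_fermat[of X] by blast
  then show ?thesis using Rep_fermat_rep[of X] by (simp add: cls_def)
qed

lemma Rep_fermat_cls: "Rep_fermat X = cls (rep X)"
proof -
  obtain x where "x \<in> Ro" "Rep_fermat X = cls x" using Rep_fermat[of X] by blast
  then show ?thesis using Rep_fermat_rep[of X] sim_cls by (auto simp: cls_def)
qed

lemma frac_rep [simp]: "frac (rep X) = X"
  unfolding frac_def by (metis Rep_fermat_cls Rep_fermat_inverse)

lemma rep_frac: "x \<in> Ro \<Longrightarrow> sim (rep (frac x)) x"
  by (rule frac_eqD) auto

lemma sim_0: "sim x y \<Longrightarrow> x 0 = y 0"
  by (simp add: sim_def is_o_def)

lemma std_frac: "x \<in> Ro \<Longrightarrow> std (frac x) = x 0"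
  unfolding std_def by (intro sim_0 rep_frac)

text \<open>A change of representatives alters the difference by \<open>o(t)\<close>, which
  \<open>nonneg_o\<close> does not notice. Conversely the negative part of the difference itself
  serves as the null germ \<open>z\<close>.\<close>

lemma fle_iff: "fle X Y \<longleftrightarrow> nonneg_o (\<lambda>t. rep Y t - rep X t)"
proof
  assume "fle X Y"
  then obtain x y z \<delta> where *: "sim (rep X) x" "sim (rep Y) y" "is_o z" "\<delta> > 0"
    "\<And>t. 0 \<le> t \<Longrightarrow> t < \<delta> \<Longrightarrow> x t \<le> y t + z t"
    unfolding fle_def Rep_fermat_cls cls_def by (auto simp: sim_def)
  have "nonneg_o (\<lambda>t. y t + z t - x t)"
    by (rule fnnI_eventually) (use * in \<open>auto intro!: eventually_mono[OF eventually_at0_less[OF *(4)]]\<close>)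
  moreover have "is_o (\<lambda>t. (y t + z t - x t) - (rep Y t - rep X t))"
  proof -
    have "is_o (\<lambda>t. (rep X t - x t) - (rep Y t - y t) + z t)"
      using *(1-3) unfolding sim_def by (rule is_o_add[OF is_o_diff])
    then show ?thesis by (simp add: algebra_simps)
  qed
  ultimately show "nonneg_o (\<lambda>t. rep Y t - rep X t)" by (rule nonneg_o_cong_o[rotated])
next
  assume a: "nonneg_o (\<lambda>t. rep Y t - rep X t)"
  show "fle X Y"
    unfolding fle_def
  proof (intro exI conjI)
    show "rep X \<in> Rep_fermat X" "rep Y \<in> Rep_fermat Y" by (rule Rep_fermat_rep)+
    let ?z = "\<lambda>t. max 0 (- (rep Y t - rep X t))"
    show "?z \<in> Ro" "sim ?z (\<lambda>_. 0)" using a by (auto simp: nonneg_o_def is_o_Ro sim_def)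
    show "\<forall>t. 0 \<le> t \<and> t < 1 \<longrightarrow> rep X t \<le> rep Y t + ?z t" by auto
  qed simp
qed

lemma fle_frac: "x \<in> Ro \<Longrightarrow> y \<in> Ro \<Longrightarrow> fle (frac x) (frac y) \<longleftrightarrow> nonneg_o (\<lambda>t. y t - x t)"
proof -
  assume "x \<in> Ro" "y \<in> Ro"
  then have s: "sim (rep (frac x)) x" "sim (rep (frac y)) y" by (auto intro: rep_frac)
  then have o: "is_o (\<lambda>t. (rep (frac y) t - y t) - (rep (frac x) t - x t))"
    unfolding sim_def by - (rule is_o_diff)
  have o1: "is_o (\<lambda>t. (rep (frac y) t - rep (frac x) t) - (y t - x t))"
    using o by (simp add: algebra_simps)
  from is_o_uminus[OF this] have o2: "is_o (\<lambda>t. (y t - x t) - (rep (frac y) t - rep (frac x) t))"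
    by simp
  show ?thesis unfolding fle_iff using nonneg_o_cong_o[OF o1] nonneg_o_cong_o[OF o2] by blast
qed

lemma nonneg_o_0: "nonneg_o x \<Longrightarrow> 0 \<le> x 0"
  by (simp add: nonneg_o_def is_o_def max_def split: if_splits)

lemma fle_std: "fle X Y \<Longrightarrow> std X \<le> std Y"
  unfolding fle_iff std_def using nonneg_o_0 by fastforce

lemma fle_refl [simp]: "fle X X"
  by (simp add: fle_iff is_o_imp_nonneg_o)

lemma fle_trans: "fle X Y \<Longrightarrow> fle Y Z \<Longrightarrow> fle X Z"
  unfolding fle_iff using nonneg_o_add[of "\<lambda>t. rep Y t - rep X t" "\<lambda>t. rep Z t - rep Y t"] by simp

lemma fle_antisym:
  assumes "fle X Y" "fle Y X"
  shows "X = Y"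
proof -
  have "is_o (\<lambda>t. max 0 (- (rep X t - rep Y t)) - max 0 (- (rep Y t - rep X t)))"
    using assms by (intro is_o_diff) (auto simp: fle_iff nonneg_o_def)
  \<comment> \<open>Positive part minus negative part recovers the difference, so two
    \<open>o(t)\<close> parts make an \<open>o(t)\<close> difference.\<close>
  moreover have "max 0 (- (rep X t - rep Y t)) - max 0 (- (rep Y t - rep X t)) = rep Y t - rep X t" for t
    by auto
  ultimately have "sim (rep Y) (rep X)" by (simp add: sim_def)
  from frac_cong[OF this] show ?thesis by simp
qed

lemma std_less_imp_fle: "std X < std Y \<Longrightarrow> fle X Y"
proof -
  assume "std X < std Y"
  moreover have "((\<lambda>t. rep Y t - rep X t) \<longlongrightarrow> std Y - std X) at0"
    unfolding std_def by (intro tendsto_diff Ro_tendsto rep_Ro)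
  ultimately have "eventually (\<lambda>t. 0 < rep Y t - rep X t) at0"
    by (intro order_tendstoD(1)) auto
  then show ?thesis unfolding fle_iff by (intro fnnI_eventually) (erule eventually_mono, auto)
qed

subsection \<open>Expansions with smooth coefficients\<close>

text \<open>Uniformity in the real argument is what later permits substituting a moving point
  \<open>y t\<close>; a pointwise \<open>o(t)\<close> would not.\<close>

definition unif_o :: "real set \<Rightarrow> (real \<Rightarrow> real \<Rightarrow> real) \<Rightarrow> bool" where
  "unif_o S R \<longleftrightarrow> (\<forall>c>0. eventually (\<lambda>t. \<forall>y\<in>S. \<bar>R t y\<bar> \<le> c * t) at0)"

lemma unif_o_is_o: "is_o h \<Longrightarrow> unif_o S (\<lambda>t y. h t)"
  unfolding unif_o_def
proof (intro allI impI)
  fix c :: real assume "is_o h" "c > 0"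
  from is_oD[OF this] show "eventually (\<lambda>t. \<forall>y\<in>S. \<bar>h t\<bar> \<le> c * t) at0"
    by (rule eventually_mono) simp
qed

lemma unif_oD: "unif_o S R \<Longrightarrow> c > 0 \<Longrightarrow> eventually (\<lambda>t. \<forall>y\<in>S. \<bar>R t y\<bar> \<le> c * t) at0"
  by (simp add: unif_o_def)

lemma unif_o_at: "unif_o S R \<Longrightarrow> y \<in> S \<Longrightarrow> is_o (\<lambda>t. R t y)"
  unfolding is_o_iff by (intro allI impI, drule (1) unif_oD, erule eventually_mono) blast

lemma unif_o_subset: "unif_o S R \<Longrightarrow> T \<subseteq> S \<Longrightarrow> unif_o T R"
  unfolding unif_o_def[of T] by (intro allI impI, drule (1) unif_oD, erule eventually_mono) blast

lemma unif_o_mono: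
  assumes "unif_o S R" "eventually (\<lambda>t. \<forall>y\<in>S. \<bar>Q t y\<bar> \<le> C * \<bar>R t y\<bar>) at0"
  shows "unif_o S Q"
  unfolding unif_o_def
proof (intro allI impI)
  fix c :: real assume c: "c > 0"
  let ?D = "\<bar>C\<bar> + 1"
  have "c / ?D > 0" using c by (simp add: add_nonneg_pos)
  with assms(1) have "eventually (\<lambda>t. \<forall>y\<in>S. \<bar>R t y\<bar> \<le> (c / ?D) * t) at0"
    using unif_oD[OF assms(1)] by blast
  with assms(2) show "eventually (\<lambda>t. \<forall>y\<in>S. \<bar>Q t y\<bar> \<le> c * t) at0"
  proof eventually_elim
    case (elim t)
    show ?case
    proof
      fix y assume y: "y \<in> S"
      have "\<bar>Q t y\<bar> \<le> ?D * \<bar>R t y\<bar>"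
        using bspec[OF elim(1) y] by (smt (verit) mult_right_mono abs_ge_zero)
      also have "\<dots> \<le> ?D * ((c / ?D) * t)"
        using elim(2) y by (intro mult_left_mono) auto
      also have "\<dots> = c * t" by (simp add: add_nonneg_pos field_simps)
      finally show "\<bar>Q t y\<bar> \<le> c * t" .
    qed
  qed
qed

lemma unif_o_add: "unif_o S Q \<Longrightarrow> unif_o S R \<Longrightarrow> unif_o S (\<lambda>t y. Q t y + R t y)"
  unfolding unif_o_def
proof (intro allI impI)
  fix c :: real assume a: "\<forall>c>0. eventually (\<lambda>t. \<forall>y\<in>S. \<bar>Q t y\<bar> \<le> c * t) at0"
    "\<forall>c>0. eventually (\<lambda>t. \<forall>y\<in>S. \<bar>R t y\<bar> \<le> c * t) at0" "c > 0"
  from a(3) have "c / 2 > 0" by simp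
  with a have "eventually (\<lambda>t. \<forall>y\<in>S. \<bar>Q t y\<bar> \<le> (c/2) * t) at0" "eventually (\<lambda>t. \<forall>y\<in>S. \<bar>R t y\<bar> \<le> (c/2) * t) at0"
    by blast+
  then show "eventually (\<lambda>t. \<forall>y\<in>S. \<bar>Q t y + R t y\<bar> \<le> c * t) at0"
  proof eventually_elim
    case (elim t)
    show ?case
    proof
      fix y assume "y \<in> S"
      with elim have "\<bar>Q t y\<bar> \<le> (c/2) * t" "\<bar>R t y\<bar> \<le> (c/2) * t" by auto
      then show "\<bar>Q t y + R t y\<bar> \<le> c * t" by linarith
    qed
  qed
qed

lemma unif_o_0 [simp]: "unif_o S (\<lambda>t y. 0)"
  by (rule unif_o_is_o) simp

text \<open>The coefficients are zero functions outside \<open>B\<close>, so that the exponent set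
  can be enlarged without touching \<open>A\<close>.\<close>

definition expansion_on :: "real set \<Rightarrow> real set \<Rightarrow> (real \<Rightarrow> real \<Rightarrow> real) \<Rightarrow> (real \<Rightarrow> real \<Rightarrow> real) \<Rightarrow> bool" where
  "expansion_on S B A G \<longleftrightarrow> finite B \<and> B \<subseteq> {0..1} \<and> (\<forall>b. smooth S (A b)) \<and> (\<forall>b. b \<notin> B \<longrightarrow> A b = (\<lambda>_. 0)) \<and>
     unif_o S (\<lambda>t y. G t y - (\<Sum>b\<in>B. A b y * pw t b))"

definition expandable :: "real \<Rightarrow> (real \<Rightarrow> real \<Rightarrow> real) \<Rightarrow> bool" where
  "expandable x G \<longleftrightarrow> (\<exists>e>0. \<exists>B A. expansion_on (ball x e) B A G)"

lemma expansion_on_subset: "expansion_on S B A G \<Longrightarrow> T \<subseteq> S \<Longrightarrow> expansion_on T B A G"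
  unfolding expansion_on_def using smooth_subset unif_o_subset by blast

lemma expansion_on_superset:
  assumes "expansion_on S B A G" "B \<subseteq> B'" "finite B'" "B' \<subseteq> {0..1}"
  shows "expansion_on S B' A G"
proof -
  have "(\<Sum>b\<in>B'. A b y * pw t b) = (\<Sum>b\<in>B. A b y * pw t b)" for t y
    using assms by (intro sum.mono_neutral_right) (auto simp: expansion_on_def)
  then show ?thesis using assms by (auto simp: expansion_on_def)
qed

lemma expansion_on_at:
  assumes "expansion_on S B A G" "y \<in> S"
  shows "is_o (\<lambda>t. G t y - (\<Sum>b\<in>B. A b y * pw t b))"
  using assms unif_o_at[of S _ y] by (fastforce simp: expansion_on_def)

lemma expansion_on_subst:
  assumes "expansion_on S B A G" "open S" "y \<in> Ro" "y 0 \<in> S"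
  shows "is_o (\<lambda>t. G t (y t) - (\<Sum>b\<in>B. A b (y t) * pw t b))"
  unfolding is_o_iff
proof (intro allI impI)
  fix c :: real assume "c > 0"
  with assms(1) have "eventually (\<lambda>t. \<forall>y\<in>S. \<bar>G t y - (\<Sum>b\<in>B. A b y * pw t b)\<bar> \<le> c * t) at0"
    unfolding expansion_on_def unif_o_def by blast
  moreover have "eventually (\<lambda>t. y t \<in> S) at0"
    using Ro_tendsto[OF assms(3)] assms(2,4) by (rule topological_tendstoD)
  ultimately show "eventually (\<lambda>t. \<bar>G t (y t) - (\<Sum>b\<in>B. A b (y t) * pw t b)\<bar> \<le> c * t) at0"
    by eventually_elim blast
qed

lemma expansion_on_unif_o: "unif_o S R \<Longrightarrow> expansion_on S {} (\<lambda>_ _. 0) R"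
  by (simp add: expansion_on_def)

lemma expansion_on_add:
  assumes "expansion_on S B A G" "expansion_on S B' A' G'" "open S"
  shows "expansion_on S (B \<union> B') (\<lambda>b y. A b y + A' b y) (\<lambda>t y. G t y + G' t y)"
proof -
  have U: "finite (B \<union> B')" "B \<union> B' \<subseteq> {0..1}" using assms by (auto simp: expansion_on_def)
  have "unif_o S (\<lambda>t y. (G t y - (\<Sum>b\<in>B \<union> B'. A b y * pw t b)) + (G' t y - (\<Sum>b\<in>B \<union> B'. A' b y * pw t b)))"
    using expansion_on_superset[OF assms(1) _ U] expansion_on_superset[OF assms(2) _ U]
    by (intro unif_o_add) (auto simp: expansion_on_def)
  then show ?thesis
    using U assms by (auto simp: expansion_on_def algebra_simps sum.distrib intro!: smooth_add)
qed

lemma expandable_add: "expandable x G \<Longrightarrow> expandable x G' \<Longrightarrow> expandable x (\<lambda>t y. G t y + G' t y)"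
proof -
  assume "expandable x G" "expandable x G'"
  then obtain e B A e' B' A' where "e > 0" "e' > 0" "expansion_on (ball x e) B A G" "expansion_on (ball x e') B' A' G'"
    unfolding expandable_def by blast
  then have "expansion_on (ball x (min e e')) B A G" "expansion_on (ball x (min e e')) B' A' G'"
    by (auto elim!: expansion_on_subset)
  from expansion_on_add[OF this] show ?thesis
    unfolding expandable_def using \<open>e > 0\<close> \<open>e' > 0\<close> by (intro exI[of _ "min e e'"]) auto
qed

lemma expandable_unif_o: "e > 0 \<Longrightarrow> unif_o (ball x e) R \<Longrightarrow> expandable x R"
  unfolding expandable_def using expansion_on_unif_o by blast

lemma expandable_sum: "(\<And>i. i \<in> I \<Longrightarrow> expandable x (G i)) \<Longrightarrow> expandable x (\<lambda>t y. \<Sum>i\<in>I. G i t y)"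
  by (induction I rule: infinite_finite_induct) (auto intro: expandable_add expandable_unif_o[of 1])

lemma smooth_bounded:
  assumes "smooth (ball x e) f" "e > 0"
  shows "\<exists>C. \<forall>y\<in>ball x (e/2). \<bar>f y\<bar> \<le> C"
proof -
  have sub: "cball x (e/2) \<subseteq> ball x e" using assms(2) by auto
  have "continuous_on (cball x (e/2)) f"
    using sub assms(1) by (intro continuous_at_imp_continuous_on) (auto intro: smooth_isCont)
  then have "bounded (f ` cball x (e/2))"
    using compact_continuous_image compact_imp_bounded compact_cball by blast
  then obtain C where "\<forall>y\<in>cball x (e/2). \<bar>f y\<bar> \<le> C"
    unfolding bounded_iff real_norm_def by blast
  then show ?thesis by (intro exI[of _ C]) auto
qed

text \<open>An exponent above 1 turns the term into part of the remainder; uniformity then needs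
  \<open>f\<close> bounded, hence the passage to half the radius.\<close>

lemma expandable_term:
  assumes "smooth (ball x e) f" "e > 0" "0 \<le> a"
  shows "expandable x (\<lambda>t y. f y * pw t a)"
proof (cases "a \<le> 1")
  case True
  then have "expansion_on (ball x e) {a} (\<lambda>b. if b = a then f else (\<lambda>_. 0)) (\<lambda>t y. f y * pw t a)"
    using assms by (auto simp: expansion_on_def)
  then show ?thesis unfolding expandable_def using assms(2) by blast
next
  case False
  obtain C where C: "\<forall>y\<in>ball x (e/2). \<bar>f y\<bar> \<le> C" using smooth_bounded[OF assms(1,2)] by blast
  have "unif_o (ball x (e/2)) (\<lambda>t y. pw t a)"
    using False by (intro unif_o_is_o is_o_pw) simp
  then have "unif_o (ball x (e/2)) (\<lambda>t y. f y * pw t a)"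
    by (rule unif_o_mono[where C = C]) (use C in \<open>auto intro!: always_eventually mult_right_mono simp: abs_mult\<close>)
  then show ?thesis using assms(2) by (intro expandable_unif_o[of "e/2"]) auto
qed

lemma expandable_bounded:
  assumes "expandable x G"
  shows "\<exists>e>0. \<exists>C. eventually (\<lambda>t. \<forall>y\<in>ball x e. \<bar>G t y\<bar> \<le> C) at0"
proof -
  obtain e B A where e: "e > 0" and G: "expansion_on (ball x e) B A G"
    using assms unfolding expandable_def by blast
  have "\<exists>C. \<forall>y\<in>ball x (e/2). \<bar>A b y\<bar> \<le> C" for b
    using G e by (intro smooth_bounded) (auto simp: expansion_on_def)
  then obtain C where C: "\<And>b y. y \<in> ball x (e/2) \<Longrightarrow> \<bar>A b y\<bar> \<le> C b" by metis
  have "eventually (\<lambda>t. \<forall>y\<in>ball x e. \<bar>G t y - (\<Sum>b\<in>B. A b y * pw t b)\<bar> \<le> 1 * t) at0"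
    using G zero_less_one unfolding expansion_on_def unif_o_def by blast
  then have "eventually (\<lambda>t. \<forall>y\<in>ball x (e/2). \<bar>G t y\<bar> \<le> 1 + (\<Sum>b\<in>B. C b)) at0"
    using eventually_at0_less[OF zero_less_one]
  proof eventually_elim
    case (elim t)
    show ?case
    proof
      fix y assume y: "y \<in> ball x (e/2)"
      have "\<bar>\<Sum>b\<in>B. A b y * pw t b\<bar> \<le> (\<Sum>b\<in>B. C b)"
      proof (rule order_trans[OF sum_abs], rule sum_mono)
        fix b assume "b \<in> B"
        then have "0 \<le> pw t b" "pw t b \<le> 1"
          using G elim by (auto intro!: pw_nonneg pw_le_1 simp: expansion_on_def)
        then show "\<bar>A b y * pw t b\<bar> \<le> C b"
          using C[OF y, of b] mult_mono[of "\<bar>A b y\<bar>" "C b" "pw t b" 1] by (simp add: abs_mult)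
      qed
      moreover have "\<bar>G t y - (\<Sum>b\<in>B. A b y * pw t b)\<bar> \<le> 1 * t" using elim y e by auto
      ultimately show "\<bar>G t y\<bar> \<le> 1 + (\<Sum>b\<in>B. C b)" using elim by linarith
    qed
  qed
  then show ?thesis using e by (intro exI[of _ "e/2"]) auto
qed

text \<open>A monomial factor shifts exponents, and those that pass 1 drop out through
  \<open>expandable_term\<close>; an \<open>o(t)\<close> factor is harmless because \<open>G\<close>
  is bounded near \<open>x\<close>, uniformly for small \<open>t\<close>.\<close>

lemma expandable_mult_Ro:
  assumes "w \<in> Ro" "expandable x G"
  shows "expandable x (\<lambda>t y. w t * G t y)"
  using assms(1)
proof (induction rule: Ro_induct)
  case (o h)
  obtain e C where e: "e > 0" and C: "eventually (\<lambda>t. \<forall>y\<in>ball x e. \<bar>G t y\<bar> \<le> C) at0"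
    using expandable_bounded[OF assms(2)] by blast
  have "eventually (\<lambda>t. \<forall>y\<in>ball x e. \<bar>h t * G t y\<bar> \<le> C * \<bar>h t\<bar>) at0"
    using C
  proof eventually_elim
    case (elim t)
    show ?case
    proof
      fix y assume "y \<in> ball x e"
      with elim have "\<bar>G t y\<bar> \<le> C" by blast
      then have "\<bar>G t y\<bar> * \<bar>h t\<bar> \<le> C * \<bar>h t\<bar>" by (rule mult_right_mono) simp
      then show "\<bar>h t * G t y\<bar> \<le> C * \<bar>h t\<bar>" by (simp add: abs_mult mult.commute)
    qed
  qed
  from unif_o_mono[OF unif_o_is_o[OF o] this] e show ?case by (rule expandable_unif_o[rotated])
next
  case (pw c a)
  obtain e B A where e: "e > 0" and G: "expansion_on (ball x e) B A G"
    using assms(2) unfolding expandable_def by blast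
  let ?R = "\<lambda>t y. G t y - (\<Sum>b\<in>B. A b y * pw t b)"
  have "expandable x (\<lambda>t y. \<Sum>b\<in>B. (c * A b y) * pw t (a + b))"
    by (intro expandable_sum expandable_term[OF _ e] smooth_cmult)
      (use G pw in \<open>auto simp: expansion_on_def\<close>)
  moreover have "unif_o (ball x e) (\<lambda>t y. c * pw t a * ?R t y)"
  proof (rule unif_o_mono[where C = "\<bar>c\<bar>"])
    show "unif_o (ball x e) ?R" using G by (simp add: expansion_on_def)
    show "eventually (\<lambda>t. \<forall>y\<in>ball x e. \<bar>c * pw t a * ?R t y\<bar> \<le> \<bar>c\<bar> * \<bar>?R t y\<bar>) at0"
      using eventually_at0_less[OF zero_less_one]
    proof eventually_elim
      case (elim t)
      then have "\<bar>pw t a\<bar> \<le> 1" using pw_nonneg[of t a] pw_le_1[of t a] pw by auto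
      then have "\<bar>c * pw t a\<bar> \<le> \<bar>c\<bar>" by (simp add: abs_mult mult_left_le)
      then show ?case by (auto simp: abs_mult[of "c * pw t a"] intro: mult_right_mono)
    qed
  qed
  then have "expandable x (\<lambda>t y. c * pw t a * ?R t y)" by (rule expandable_unif_o[OF e])
  ultimately have "expandable x (\<lambda>t y. (\<Sum>b\<in>B. (c * A b y) * pw t (a + b)) + c * pw t a * ?R t y)"
    by (rule expandable_add)
  moreover have "(\<Sum>b\<in>B. (c * A b y) * pw t (a + b)) + c * pw t a * ?R t y = c * pw t a * G t y" for t y
  proof -
    have "(\<Sum>b\<in>B. (c * A b y) * pw t (a + b)) = c * pw t a * (\<Sum>b\<in>B. A b y * pw t b)"
      unfolding sum_distrib_left
      by (intro sum.cong) (use G pw in \<open>auto simp: expansion_on_def pw_add\<close>)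
    then show ?thesis by (simp add: algebra_simps)
  qed
  ultimately show ?case by simp
next
  case (add w v)
  from expandable_add[OF this] show ?case by (simp add: distrib_right)
qed

subsection \<open>Freezing the parameters\<close>

text \<open>Inverse to the encoding used by \<open>uncur\<close>: the real variable occupies
  coordinate 0 and the parameters are shifted by one.\<close>

definition cons_point :: "(nat \<Rightarrow> real) \<Rightarrow> real \<Rightarrow> nat \<Rightarrow> real" where
  "cons_point q y = (\<lambda>i. case i of 0 \<Rightarrow> y | Suc j \<Rightarrow> q j)"

lemma uncur_cons_point [simp]: "uncur \<alpha> (cons_point q y) = \<alpha> q y"
  by (simp add: uncur_def cons_point_def)

lemma cons_point_prodU: "cons_point q y \<in> prodU N P V \<longleftrightarrow> q \<in> RN N \<and> y \<in> V \<and> q \<in> P"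
proof -
  have "cons_point q y \<in> RN (Suc N) \<longleftrightarrow> q \<in> RN N"
    by (force simp: cons_point_def RN_def split: nat.split)
  then show ?thesis by (auto simp: prodU_def cons_point_def)
qed

lemma cons_point_upd_0: "(cons_point q y)(0 := s) = cons_point q s"
  by (auto simp: cons_point_def fun_eq_iff split: nat.split)

lemma cons_point_upd_Suc: "(cons_point q y)(Suc i := s) = cons_point (q(i := s)) y"
  by (auto simp: cons_point_def fun_eq_iff split: nat.split)

lemma distN_le: "distN N x y \<le> (\<Sum>i<N. \<bar>x i - y i\<bar>)"
  using L2_set_le_sum_abs[of "\<lambda>i. x i - y i" "{..<N}"] by (simp add: distN_def L2_set_def)

lemma CinfN_iter: "CinfN M U g \<Longrightarrow> i < M \<Longrightarrow> CinfN M U ((fpartial i ^^ k) g)"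
proof (induction k)
  case (Suc k)
  then have "CinfN M U ((fpartial i ^^ k) g)" by simp
  then show ?case using Suc.prems(2) by (auto elim: CinfN.cases)
qed simp

lemma CinfN_has_deriv:
  assumes "CinfN M U g" "i < M" "x(i := s) \<in> U"
  shows "((\<lambda>s. g (x(i := s))) has_real_derivative fpartial i g (x(i := s))) (at s)"
proof -
  from assms(1) have "\<forall>x\<in>U. (\<lambda>s. g (x(i := s))) differentiable (at (x i))"
    using assms(2) by (auto elim: CinfN.cases)
  from bspec[OF this assms(3)] have "(\<lambda>s. g (x(i := s))) differentiable (at s)" by simp
  then have "((\<lambda>s. g (x(i := s))) has_real_derivative deriv (\<lambda>s. g (x(i := s))) s) (at s)"
    by (simp add: DERIV_deriv_iff_real_differentiable)
  then show ?thesis by (simp add: fpartial_def)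
qed

lemma openN_box:
  assumes "openN N P" "q0 \<in> P"
  shows "\<exists>e>0. \<forall>q\<in>RN N. (\<forall>i<N. \<bar>q i - q0 i\<bar> \<le> e) \<longrightarrow> q \<in> P"
proof -
  obtain e where e: "e > 0" "\<And>q. q \<in> RN N \<Longrightarrow> distN N q0 q < e \<Longrightarrow> q \<in> P"
    using assms unfolding openN_def by blast
  \<comment> \<open>The sum of \<open>N\<close> coordinate errors is then strictly below
    \<open>e\<close>, and the quotient also makes sense for \<open>N = 0\<close>.\<close>
  let ?d = "e / (real N + 1)"
  have "q \<in> P" if q: "q \<in> RN N" "\<forall>i<N. \<bar>q i - q0 i\<bar> \<le> ?d" for q
  proof (rule e(2)[OF q(1)])
    have "distN N q0 q \<le> (\<Sum>i<N. \<bar>q0 i - q i\<bar>)" by (rule distN_le)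
    also have "\<dots> \<le> (\<Sum>i<N. ?d)" using q(2) by (intro sum_mono) (auto simp: abs_minus_commute)
    also have "\<dots> = real N * ?d" by simp
    also have "\<dots> < e" using e(1) by (simp add: field_simps)
    finally show "distN N q0 q < e" .
  qed
  moreover have "?d > 0" using e(1) by simp
  ultimately show ?thesis by blast
qed

text \<open>Continuity at one point yields a bound on a cube around it, which is all that a Taylor
  remainder needs. A cube is more convenient than a Euclidean ball because the coordinates will be
  moved one at a time.\<close>

lemma CinfN_box_bound:
  assumes "openN N P" "open V" "q0 \<in> P" "x0 \<in> V" and g: "CinfN (Suc N) (prodU N P V) g"
  shows "\<exists>e>0. \<exists>C. \<forall>q\<in>RN N. \<forall>y. (\<forall>i<N. \<bar>q i - q0 i\<bar> \<le> e) \<longrightarrow> \<bar>y - x0\<bar> \<le> e \<longrightarrow>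
           cons_point q y \<in> prodU N P V \<and> \<bar>g (cons_point q y)\<bar> \<le> C"
proof -
  obtain e1 where e1: "e1 > 0" "\<And>q. q \<in> RN N \<Longrightarrow> \<forall>i<N. \<bar>q i - q0 i\<bar> \<le> e1 \<Longrightarrow> q \<in> P"
    using openN_box[OF assms(1,3)] by blast
  obtain e2 where e2: "e2 > 0" "cball x0 e2 \<subseteq> V"
    using assms(2,4) open_contains_cball by blast
  have q0: "q0 \<in> RN N" using assms(1,3) by (auto simp: openN_def)
  have "contN (Suc N) (prodU N P V) g" using g by (auto elim: CinfN.cases)
  moreover have "cons_point q0 x0 \<in> prodU N P V" using assms q0 by (simp add: cons_point_prodU)
  ultimately obtain d where d: "d > 0"
    "\<And>z. z \<in> prodU N P V \<Longrightarrow> distN (Suc N) (cons_point q0 x0) z < d \<Longrightarrow> \<bar>g z - g (cons_point q0 x0)\<bar> < 1"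
    unfolding contN_def using zero_less_one by blast
  \<comment> \<open>There are \<open>N + 1\<close> coordinates including the real variable; one more
    in the denominator makes the distance strictly less than \<open>d\<close>.\<close>
  define e where "e = min (min e1 e2) (d / (real N + 2))"
  have e: "e > 0" "e \<le> e1" "e \<le> e2" "e \<le> d / (real N + 2)" using e1 e2 d by (auto simp: e_def)
  have "cons_point q y \<in> prodU N P V \<and> \<bar>g (cons_point q y)\<bar> \<le> \<bar>g (cons_point q0 x0)\<bar> + 1"
    if q: "q \<in> RN N" "\<forall>i<N. \<bar>q i - q0 i\<bar> \<le> e" and y: "\<bar>y - x0\<bar> \<le> e" for q y
  proof -
    have "q \<in> P" using q e by (intro e1(2)) force+
    moreover have "y \<in> V" using y e e2(2) by (auto simp: dist_real_def abs_minus_commute)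
    ultimately have z: "cons_point q y \<in> prodU N P V" using q by (simp add: cons_point_prodU)
    have "distN (Suc N) (cons_point q0 x0) (cons_point q y) \<le> (\<Sum>i<Suc N. \<bar>cons_point q0 x0 i - cons_point q y i\<bar>)" by (rule distN_le)
    also have "\<dots> \<le> (\<Sum>i<Suc N. e)"
    proof (rule sum_mono)
      fix i assume "i \<in> {..<Suc N}"
      then show "\<bar>cons_point q0 x0 i - cons_point q y i\<bar> \<le> e"
        using q y by (cases i) (auto simp: cons_point_def abs_minus_commute)
    qed
    also have "\<dots> = (real N + 1) * e" by simp
    also have "\<dots> \<le> (real N + 1) * (d / (real N + 2))" using e by (intro mult_left_mono) auto
    also have "\<dots> < d" using d(1) by (simp add: field_simps)
    finally have "\<bar>g (cons_point q y) - g (cons_point q0 x0)\<bar> < 1" by (intro d(2) z)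
    then show ?thesis using z by linarith
  qed
  then show ?thesis using e(1) by blast
qed

text \<open>The path \<open>q\<close> stands for representatives of the Fermat parameters of a local
  representation. Its start \<open>q 0\<close> is their standard part, and \<open>x0\<close> is the
  real point near which the remaining variable moves.\<close>

locale param_path =
  fixes N :: nat and P :: "(nat \<Rightarrow> real) set" and V :: "real set" and p :: "nat \<Rightarrow> real \<Rightarrow> real" and x0 :: real
    and q :: "real \<Rightarrow> nat \<Rightarrow> real"
  defines "q \<equiv> \<lambda>t i. if i < N then p i t else 0"
  assumes P: "openN N P" and V: "open V" and p: "\<And>i. i < N \<Longrightarrow> p i \<in> Ro"
    and q0: "q 0 \<in> P" and x0: "x0 \<in> V"
begin

abbreviation "U \<equiv> prodU N P V"

lemma q_RN: "q t \<in> RN N"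
  by (simp add: q_def RN_def)

lemma q_near: "e > 0 \<Longrightarrow> eventually (\<lambda>t. \<forall>i<N. \<bar>q t i - q 0 i\<bar> \<le> e) at0"
proof -
  assume e: "e > 0"
  have "eventually (\<lambda>t. \<bar>q t i - q 0 i\<bar> \<le> e) at0" if "i < N" for i
  proof -
    have "eventually (\<lambda>t. dist (p i t) (p i 0) < e) at0"
      using Ro_tendsto[OF p[OF that]] e by (rule tendstoD)
    then show ?thesis by (rule eventually_mono) (use that in \<open>simp add: q_def dist_real_def\<close>)
  qed
  then have "eventually (\<lambda>t. \<forall>i\<in>{..<N}. \<bar>q t i - q 0 i\<bar> \<le> e) at0"
    by (intro eventually_ball_finite) auto
  then show ?thesis by (rule eventually_mono) simp
qed

text \<open>Interpolates between the moving parameter point (\<open>m = 0\<close>) and its standard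
  part (\<open>m = N\<close>).\<close>

definition freeze :: "nat \<Rightarrow> real \<Rightarrow> nat \<Rightarrow> real" where
  "freeze m t = (\<lambda>i. if i < m then q 0 i else q t i)"

lemma freeze_RN: "freeze m t \<in> RN N"
  by (simp add: freeze_def RN_def q_def)

lemma smooth_frozen:
  assumes g: "CinfN (Suc N) U g"
  shows "\<exists>e>0. smooth (ball x0 e) (\<lambda>y. g (cons_point (q 0) y))"
proof -
  obtain e where e: "e > 0" "ball x0 e \<subseteq> V" using V x0 open_contains_ball by blast
  have "smooth (ball x0 e) (\<lambda>y. g (cons_point (q 0) y))"
  proof (rule smooth_witness[where D = "\<lambda>n y. ((fpartial 0 ^^ n) g) (cons_point (q 0) y)"])
    fix n y assume "y \<in> ball x0 e"
    then have "(cons_point (q 0) y)(0 := y) \<in> U" using e q_RN q0 by (auto simp: cons_point_prodU cons_point_upd_0)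
    from CinfN_has_deriv[OF CinfN_iter[OF g, of 0 n] _ this]
    show "((\<lambda>y. ((fpartial 0 ^^ n) g) (cons_point (q 0) y)) has_real_derivative
            ((fpartial 0 ^^ Suc n) g) (cons_point (q 0) y)) (at y)"
      by (simp add: cons_point_upd_0)
  qed auto
  then show ?thesis using e by blast
qed

text \<open>Downward induction on \<open>m\<close>. With all parameters frozen, \<open>g\<close> is
  a smooth function of \<open>y\<close> alone, a single term with exponent 0. Releasing parameter
  \<open>m\<close> is a Taylor expansion at \<open>q 0 m\<close>, whose coefficients are partial
  derivatives of \<open>g\<close> with parameter \<open>m\<close> still frozen; this is why the
  induction runs over all \<open>g\<close>.\<close>

lemma expandable_freeze:
  assumes "m \<le> N" "CinfN (Suc N) U g"
  shows "expandable x0 (\<lambda>t y. g (cons_point (freeze m t) y))"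
  using assms
proof (induction arbitrary: g rule: inc_induct)
  case base
  have "freeze N t = q 0" for t by (auto simp: freeze_def q_def)
  moreover obtain e where "e > 0" "smooth (ball x0 e) (\<lambda>y. g (cons_point (q 0) y))"
    using smooth_frozen[OF base] by blast
  ultimately show ?case using expandable_term[of x0 e "\<lambda>y. g (cons_point (q 0) y)" 0] by simp
next
  case (step m)
  let ?g = "\<lambda>k. (fpartial (Suc m) ^^ k) g"
  have Cg: "CinfN (Suc N) U (?g k)" for k using step by (intro CinfN_iter) auto
  define w where "w t = q t m - q 0 m" for t
  have w: "w \<in> Ro"
    using p[of m] step.hyps by (auto simp: w_def[abs_def] q_def intro!: Ro_diff)
  \<comment> \<open>The increment of the parameter is infinitesimal, hence nilpotent modulo
    \<open>o(t)\<close>, and a nilpotency index is the length of the Taylor polynomial.\<close>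
  then obtain n where n: "n > 0" "is_o (\<lambda>t. w t ^ n)"
    using Ro_power_is_o[of w] by (auto simp: w_def)
  have "expandable x0 (\<lambda>t y. \<Sum>k<n. (1 / fact k * w t ^ k) * ?g k (cons_point (freeze (Suc m) t) y))"
    by (intro expandable_sum expandable_mult_Ro step.IH Cg Ro_cmult Ro_power w)
  moreover have "expandable x0 (\<lambda>t y. g (cons_point (freeze m t) y) -
      (\<Sum>k<n. (1 / fact k * w t ^ k) * ?g k (cons_point (freeze (Suc m) t) y)))"
  proof -
    obtain e C where e: "e > 0" and C: "\<And>q' y. q' \<in> RN N \<Longrightarrow> (\<And>i. i < N \<Longrightarrow> \<bar>q' i - q 0 i\<bar> \<le> e) \<Longrightarrow>
      \<bar>y - x0\<bar> \<le> e \<Longrightarrow> cons_point q' y \<in> U \<and> \<bar>?g n (cons_point q' y)\<bar> \<le> C"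
      using CinfN_box_bound[OF P V q0 x0 Cg[of n]] by metis
    have "unif_o (ball x0 e) (\<lambda>t y. g (cons_point (freeze m t) y) -
      (\<Sum>k<n. (1 / fact k * w t ^ k) * ?g k (cons_point (freeze (Suc m) t) y)))"
    proof (rule unif_o_mono[OF unif_o_is_o[OF n(2)], where C = C])
      show "eventually (\<lambda>t. \<forall>y\<in>ball x0 e. \<bar>g (cons_point (freeze m t) y) -
        (\<Sum>k<n. (1 / fact k * w t ^ k) * ?g k (cons_point (freeze (Suc m) t) y))\<bar> \<le> C * \<bar>w t ^ n\<bar>) at0"
        using q_near[OF e]
      proof eventually_elim
        case (elim t)
        show ?case
        proof
          fix y assume y: "y \<in> ball x0 e"
          define D where "D k s = ?g k (cons_point ((freeze m t)(m := s)) y)" for k s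
          \<comment> \<open>Between \<open>q 0 m\<close> and \<open>q t m\<close> the point stays in
            the cube, so a single bound \<open>C\<close> on the \<open>n\<close>-th partial
            derivative serves all \<open>y\<close> and all small \<open>t\<close>.\<close>
          have near: "cons_point ((freeze m t)(m := s)) y \<in> U \<and> \<bar>D n s\<bar> \<le> C" if "\<bar>s - q 0 m\<bar> \<le> \<bar>w t\<bar>" for s
            unfolding D_def
          proof (rule C)
            show "(freeze m t)(m := s) \<in> RN N" using freeze_RN[of m t] step.hyps by (auto simp: RN_def)
            show "\<bar>((freeze m t)(m := s)) i - q 0 i\<bar> \<le> e" if "i < N" for i
            proof (cases "i = m")
              case True
              then show ?thesis using \<open>\<bar>s - q 0 m\<bar> \<le> \<bar>w t\<bar>\<close> elim that by (force simp: w_def)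
            next
              case False
              then show ?thesis using elim that e by (simp add: freeze_def)
            qed
            show "\<bar>y - x0\<bar> \<le> e" using y by (simp add: dist_real_def abs_minus_commute)
          qed
          have "\<bar>D 0 (q t m) - (\<Sum>k<n. D k (q 0 m) / fact k * (q t m - q 0 m) ^ k)\<bar> \<le> C * \<bar>q t m - q 0 m\<bar> ^ n"
          proof (rule taylor_bound[where r = "\<bar>w t\<bar>"])
            fix k s assume "\<bar>s - q 0 m\<bar> \<le> \<bar>w t\<bar>"
            from near[OF this] have "(cons_point (freeze m t) y)(Suc m := s) \<in> U" by (simp add: cons_point_upd_Suc)
            from CinfN_has_deriv[OF Cg[of k] _ this] step.hyps
            show "(D k has_real_derivative D (Suc k) s) (at s)"
              by (simp add: cons_point_upd_Suc D_def[abs_def])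
          qed (use n near in \<open>auto simp: w_def\<close>)
          moreover have "(freeze m t)(m := q t m) = freeze m t" by (auto simp: freeze_def)
          moreover have "(freeze m t)(m := q 0 m) = freeze (Suc m) t" by (auto simp: freeze_def less_Suc_eq)
          ultimately show "\<bar>g (cons_point (freeze m t) y) - (\<Sum>k<n. (1 / fact k * w t ^ k) * ?g k (cons_point (freeze (Suc m) t) y))\<bar>
              \<le> C * \<bar>w t ^ n\<bar>"
            by (simp add: D_def w_def power_abs mult.commute)
        qed
      qed
    qed
    then show ?thesis by (rule expandable_unif_o[OF e])
  qed
  ultimately have "expandable x0 (\<lambda>t y. (\<Sum>k<n. (1 / fact k * w t ^ k) * ?g k (cons_point (freeze (Suc m) t) y)) +
    (g (cons_point (freeze m t) y) - (\<Sum>k<n. (1 / fact k * w t ^ k) * ?g k (cons_point (freeze (Suc m) t) y))))"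
    by (rule expandable_add)
  then show ?case by simp
qed

lemma expandable_path: "CinfN (Suc N) U g \<Longrightarrow> expandable x0 (\<lambda>t y. g (cons_point (q t) y))"
  using expandable_freeze[of 0 g] by (simp add: freeze_def)

lemma has_deriv_near:
  assumes "CinfN (Suc N) U (uncur \<alpha>)"
  shows "\<exists>e>0. eventually (\<lambda>t. \<forall>y\<in>ball x0 e. (\<alpha> (q t) has_real_derivative deriv (\<alpha> (q t)) y) (at y)) at0"
proof -
  obtain e C where e: "e > 0" and C: "\<And>q' y. q' \<in> RN N \<Longrightarrow> (\<And>i. i < N \<Longrightarrow> \<bar>q' i - q 0 i\<bar> \<le> e) \<Longrightarrow>
      \<bar>y - x0\<bar> \<le> e \<Longrightarrow> cons_point q' y \<in> U \<and> \<bar>uncur \<alpha> (cons_point q' y)\<bar> \<le> C"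
    using CinfN_box_bound[OF P V q0 x0 assms] by metis
  have "eventually (\<lambda>t. \<forall>y\<in>ball x0 e. (\<alpha> (q t) has_real_derivative deriv (\<alpha> (q t)) y) (at y)) at0"
    using q_near[OF e]
  proof eventually_elim
    case (elim t)
    show ?case
    proof
      fix y assume "y \<in> ball x0 e"
      then have "cons_point (q t) y \<in> U" using elim q_RN
        by (intro conjunct1[OF C]) (auto simp: dist_real_def abs_minus_commute)
      then have "(cons_point (q t) y)(0 := y) \<in> U" by (simp add: cons_point_upd_0)
      from CinfN_has_deriv[OF assms _ this]
      show "(\<alpha> (q t) has_real_derivative deriv (\<alpha> (q t)) y) (at y)"
        by (simp add: cons_point_upd_0 DERIV_imp_deriv)
    qed
  qed
  with e show ?thesis by blast
qed

end

lemma fpartial_uncur: "fpartial 0 (uncur \<alpha>) (cons_point q y) = deriv (\<alpha> q) y"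
  by (simp add: fpartial_def cons_point_upd_0) (simp add: cons_point_def)

section \<open>Antiderivatives and differentiated expansions\<close>

lemma antiderivative_exists:
  fixes a b :: ereal
  assumes "a < b" "\<And>x. a < ereal x \<Longrightarrow> ereal x < b \<Longrightarrow> isCont f x"
  shows "\<exists>F. F x0 = c \<and> (\<forall>x. a < ereal x \<longrightarrow> ereal x < b \<longrightarrow> (F has_real_derivative f x) (at x))"
proof -
  obtain F where F: "\<And>y. a < ereal y \<Longrightarrow> ereal y < b \<Longrightarrow> (F has_vector_derivative f y) (at y)"
    using einterval_antiderivative[OF assms] by blast
  have "((\<lambda>y. F y - F x0 + c) has_real_derivative f y) (at y)" if "a < ereal y" "ereal y < b" for y
  proof -
    have "(F has_real_derivative f y) (at y)"
      using F[OF that] by (simp add: has_real_derivative_iff_has_vector_derivative)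
    from DERIV_add[OF DERIV_diff[OF this DERIV_const] DERIV_const] show ?thesis by simp
  qed
  then show ?thesis by (intro exI[of _ "\<lambda>y. F y - F x0 + c"]) auto
qed

lemma antiderivative_on_ball:
  assumes "smooth (ball x e) f" "e > 0"
  shows "\<exists>F. F x = c \<and> (\<forall>y\<in>ball x e. (F has_real_derivative f y) (at y))"
proof -
  have mem: "ereal (x - e) < ereal y \<Longrightarrow> ereal y < ereal (x + e) \<Longrightarrow> y \<in> ball x e" for y
    by (auto simp: dist_real_def)
  have "\<exists>F. F x = c \<and> (\<forall>y. ereal (x - e) < ereal y \<longrightarrow> ereal y < ereal (x + e) \<longrightarrow>
      (F has_real_derivative f y) (at y))"
    by (rule antiderivative_exists) (use assms mem in \<open>auto intro!: smooth_isCont[of "ball x e"]\<close>)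
  then show ?thesis by (auto simp: dist_real_def abs_less_iff)
qed

context param_path begin

text \<open>The coefficients of the derivative are identified through the mean value theorem,
  which avoids commuting mixed partial derivatives.\<close>

lemma expansion_on_deriv:
  assumes \<alpha>: "CinfN (Suc N) U (uncur \<alpha>)"
  shows "\<exists>e>0. \<exists>B A. expansion_on (ball x0 e) B A (\<lambda>t y. \<alpha> (q t) y) \<and>
           expansion_on (ball x0 e) B (\<lambda>b. deriv (A b)) (\<lambda>t y. deriv (\<alpha> (q t)) y)"
proof -
  obtain e1 B1 A where e1: "e1 > 0" and A: "expansion_on (ball x0 e1) B1 A (\<lambda>t y. \<alpha> (q t) y)"
    using expandable_path[OF \<alpha>] unfolding expandable_def by auto
  have "CinfN (Suc N) U (fpartial 0 (uncur \<alpha>))" using CinfN_iter[OF \<alpha>, of 0 1] by simp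
  from expandable_path[OF this] obtain e2 B2 A' where e2: "e2 > 0"
    and A': "expansion_on (ball x0 e2) B2 A' (\<lambda>t y. deriv (\<alpha> (q t)) y)"
    unfolding expandable_def by (auto simp: fpartial_uncur)
  obtain e3 where e3: "e3 > 0"
    and der: "eventually (\<lambda>t. \<forall>y\<in>ball x0 e3. (\<alpha> (q t) has_real_derivative deriv (\<alpha> (q t)) y) (at y)) at0"
    using has_deriv_near[OF \<alpha>] by blast
  define e where "e = min e1 (min e2 e3)"
  have e: "e > 0" using e1 e2 e3 by (simp add: e_def)
  define B where "B = B1 \<union> B2"
  have B: "finite B" "B \<subseteq> {0..1}" using A A' by (auto simp: expansion_on_def B_def)
  have A: "expansion_on (ball x0 e) B A (\<lambda>t y. \<alpha> (q t) y)"
    by (rule expansion_on_subset[OF expansion_on_superset[OF A _ B]]) (auto simp: B_def e_def)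
  have A': "expansion_on (ball x0 e) B A' (\<lambda>t y. deriv (\<alpha> (q t)) y)"
    by (rule expansion_on_subset[OF expansion_on_superset[OF A' _ B]]) (auto simp: B_def e_def)
  have sA: "smooth (ball x0 e) (A b)" "smooth (ball x0 e) (A' b)" for b
    using A A' by (auto simp: expansion_on_def)
  \<comment> \<open>Prescribing the value \<open>A b x0\<close> at the centre fixes the constant of
    integration, so that \<open>F b\<close> will equal \<open>A b\<close> and not merely differ from
    it by a constant.\<close>
  have "\<exists>F. F x0 = A b x0 \<and> (\<forall>y\<in>ball x0 e. (F has_real_derivative A' b y) (at y))" for b
    by (rule antiderivative_on_ball[OF sA(2) e])
  then obtain F where F0: "\<And>b. F b x0 = A b x0"
    and F: "\<And>b y. y \<in> ball x0 e \<Longrightarrow> (F b has_real_derivative A' b y) (at y)" by metis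
  \<comment> \<open>The termwise antiderivatives expand \<open>\<alpha> (q t)\<close> as well: the
    difference has a uniformly small derivative, so its increment from \<open>x0\<close> is
    \<open>o(t)\<close>, and at \<open>x0\<close> the two expansions agree. Uniqueness of
    coefficients then applies at each \<open>y\<close>.\<close>
  have eq: "A b y = F b y" if y: "y \<in> ball x0 e" and b: "b \<in> B" for b y
  proof -
    let ?D = "\<lambda>t y. \<alpha> (q t) y - (\<Sum>b\<in>B. F b y * pw t b)"
    let ?D' = "\<lambda>t y. deriv (\<alpha> (q t)) y - (\<Sum>b\<in>B. A' b y * pw t b)"
    have "is_o (\<lambda>t. ?D t y - ?D t x0)"
      unfolding is_o_iff
    proof (intro allI impI)
      fix c :: real assume "c > 0"
      then have "c / e > 0" using e by simp
      then have "eventually (\<lambda>t. \<forall>y\<in>ball x0 e. \<bar>?D' t y\<bar> \<le> (c / e) * t) at0"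
        using A' unfolding expansion_on_def unif_o_def by blast
      with der show "eventually (\<lambda>t. \<bar>?D t y - ?D t x0\<bar> \<le> c * t) at0"
        using eventually_at0_nonneg
      proof eventually_elim
        case (elim t)
        have "\<bar>?D t y - ?D t x0\<bar> \<le> (c / e) * t * \<bar>y - x0\<bar>"
          unfolding real_norm_def[symmetric]
        proof (rule field_differentiable_bound[where S = "ball x0 e" and f' = "?D' t"])
          fix z assume z: "z \<in> ball x0 e"
          then have "(\<alpha> (q t) has_real_derivative deriv (\<alpha> (q t)) z) (at z)"
            using elim(1) by (auto simp: e_def)
          then have "((\<lambda>y. ?D t y) has_real_derivative ?D' t z) (at z)"
            by (intro DERIV_diff DERIV_sum DERIV_cmult_right F z) auto
          then show "((\<lambda>y. ?D t y) has_real_derivative ?D' t z) (at z within ball x0 e)"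
            by (rule has_field_derivative_at_within)
          show "norm (?D' t z) \<le> (c / e) * t" using elim(2) z by simp
        qed (use y e in auto)
        also have "\<dots> \<le> (c / e) * t * e"
          using y elim(3) \<open>c > 0\<close> e by (intro mult_left_mono) (auto simp: dist_real_def abs_minus_commute)
        also have "\<dots> = c * t" using e by simp
        finally show ?case .
      qed
    qed
    moreover have "is_o (\<lambda>t. ?D t x0)"
      using expansion_on_at[OF A, of x0] e by (simp add: F0)
    ultimately have "is_o (\<lambda>t. ?D t y - ?D t x0 + ?D t x0)" by (rule is_o_add)
    then have "is_o (\<lambda>t. ?D t y)" by simp
    from is_o_diff[OF this expansion_on_at[OF A y]]
    have "is_o (\<lambda>t. \<Sum>b\<in>B. (A b y - F b y) * pw t b)"
      by (simp add: algebra_simps sum_subtractf)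
    from psum_is_o_imp_0[OF B this b] show ?thesis by simp
  qed
  have "deriv (A b) y = A' b y" if y: "y \<in> ball x0 e" for b y
  proof (cases "b \<in> B")
    case True
    have "(A b has_real_derivative A' b y) (at y)"
      by (rule has_field_derivative_transform_within_open[OF F[OF y] _ y]) (use eq True in auto)
    then show ?thesis by (rule DERIV_imp_deriv)
  next
    case False
    then have "A b = (\<lambda>_. 0)" "A' b = (\<lambda>_. 0)" using A A' by (auto simp: expansion_on_def)
    then show ?thesis by simp
  qed
  moreover have "deriv (A b) = (\<lambda>_. 0)" if "b \<notin> B" for b
    using A that by (auto simp: expansion_on_def)
  ultimately have "expansion_on (ball x0 e) B (\<lambda>b. deriv (A b)) (\<lambda>t y. deriv (\<alpha> (q t)) y)"
    using A' sA by (auto simp: expansion_on_def unif_o_def smooth_deriv cong: sum.cong)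
  with A e show ?thesis by blast
qed

end

subsection \<open>Normal forms of smooth functions\<close>

definition nform :: "real set \<Rightarrow> (real \<Rightarrow> real \<Rightarrow> real) \<Rightarrow> fermat \<Rightarrow> fermat" where
  "nform B A y = frac (\<lambda>t. \<Sum>b\<in>B. A b (rep y t) * pw t b)"

text \<open>\<open>B\<close> contains every exponent that occurs near \<open>x\<close>, and possibly
  more. Only local finiteness is asked, since infinitely many exponents may occur over an unbounded
  interval.\<close>

definition exponents_near :: "(real \<Rightarrow> real \<Rightarrow> real) \<Rightarrow> real set \<Rightarrow> real \<Rightarrow> bool" where
  "exponents_near A B x \<longleftrightarrow> finite B \<and> B \<subseteq> {0..1} \<and> (\<exists>e>0. \<forall>b. b \<notin> B \<longrightarrow> (\<forall>z\<in>ball x e. A b z = 0))"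

text \<open>Only \<open>std y\<close> is required to lie in the ball, so all points of
  \<open>J\<close> infinitely close to \<open>c\<close> are covered; the coefficients are smooth on
  the full ball even where it leaves the standard parts of \<open>J\<close>.\<close>

definition local_nf :: "fermat set \<Rightarrow> (fermat \<Rightarrow> fermat) \<Rightarrow> real \<Rightarrow> real \<Rightarrow> real set \<Rightarrow> (real \<Rightarrow> real \<Rightarrow> real) \<Rightarrow> bool" where
  "local_nf J f c e B A \<longleftrightarrow> e > 0 \<and> finite B \<and> B \<subseteq> {0..1} \<and> (\<forall>b. smooth (ball c e) (A b)) \<and>
     (\<forall>b. b \<notin> B \<longrightarrow> (\<forall>z\<in>ball c e. A b z = 0)) \<and>
     (\<forall>y\<in>J. std y \<in> ball c e \<longrightarrow> f y = nform B A y)"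

definition const_fermat :: "real \<Rightarrow> fermat" where
  "const_fermat x = frac (\<lambda>_. x)"

lemma std_const_fermat [simp]: "std (const_fermat x) = x"
  by (simp add: const_fermat_def std_frac)

text \<open>The derivative is bounded near the common standard part, so by the mean value theorem
  equivalent germs have equivalent images.\<close>

lemma smooth_sim:
  assumes "open S" "smooth S f" "x \<in> Ro" "y \<in> Ro" "sim x y" "y 0 \<in> S"
  shows "is_o (\<lambda>t. f (x t) - f (y t))"
proof -
  obtain e where e: "e > 0" "ball (y 0) e \<subseteq> S" using assms(1,6) open_contains_ball by blast
  have sm: "smooth (ball (y 0) e) f" using assms(2) e(2) by (rule smooth_subset)
  obtain C where C: "\<forall>z\<in>ball (y 0) (e/2). \<bar>deriv f z\<bar> \<le> C"
    using smooth_bounded[OF smooth_deriv[OF sm] e(1)] by blast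
  have e2: "e / 2 > 0" using e by simp
  have "eventually (\<lambda>t. dist (x t) (y 0) < e/2) at0"
    using tendstoD[OF Ro_tendsto[OF assms(3)] e2] sim_0[OF assms(5)] by simp
  moreover have "eventually (\<lambda>t. dist (y t) (y 0) < e/2) at0"
    by (rule tendstoD[OF Ro_tendsto[OF assms(4)] e2])
  ultimately have "eventually (\<lambda>t. \<bar>f (x t) - f (y t)\<bar> \<le> C * \<bar>x t - y t\<bar>) at0"
  proof eventually_elim
    case (elim t)
    show ?case
      unfolding real_norm_def[symmetric]
    proof (rule field_differentiable_bound[where S = "ball (y 0) (e/2)" and f' = "deriv f"])
      fix z assume z: "z \<in> ball (y 0) (e/2)"
      then show "(f has_real_derivative deriv f z) (at z within ball (y 0) (e/2))"
        by (intro has_field_derivative_at_within[OF smooth_has_deriv[OF sm]]) (use e(1) in auto)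
      show "norm (deriv f z) \<le> C" using C z by simp
    qed (use elim in \<open>auto simp: dist_commute\<close>)
  qed
  from is_o_mono[OF assms(5)[unfolded sim_def] this] show ?thesis .
qed

lemma is_o_mult_pw: "is_o h \<Longrightarrow> 0 \<le> b \<Longrightarrow> is_o (\<lambda>t. h t * pw t b)"
  using is_o_mult_Ro[of h "\<lambda>t. 1 * pw t b"] Ro_pw[of b 1] by (simp add: mult.commute)

lemma Ro_nform:
  assumes "B \<subseteq> {0..1}" "\<And>b. b \<in> B \<Longrightarrow> (\<lambda>t. A b (y t)) \<in> Ro"
  shows "(\<lambda>t. \<Sum>b\<in>B. A b (y t) * pw t b) \<in> Ro"
  using assms Ro_pw[of _ 1] by (intro Ro_sum Ro_mult) auto

lemma nform_frac:
  assumes "B \<subseteq> {0..1}" "\<And>b. b \<in> B \<Longrightarrow> smooth S (A b)" "open S" "y \<in> Ro" "y 0 \<in> S"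
  shows "nform B A (frac y) = frac (\<lambda>t. \<Sum>b\<in>B. A b (y t) * pw t b)"
  unfolding nform_def
proof (rule frac_cong)
  have "is_o (\<lambda>t. \<Sum>b\<in>B. (A b (rep (frac y) t) - A b (y t)) * pw t b)"
    using assms by (intro is_o_sum is_o_mult_pw smooth_sim[of S] rep_frac) auto
  then show "sim (\<lambda>t. \<Sum>b\<in>B. A b (rep (frac y) t) * pw t b) (\<lambda>t. \<Sum>b\<in>B. A b (y t) * pw t b)"
    by (simp add: sim_def left_diff_distrib sum_subtractf)
qed

lemma nform_const_fermat:
  assumes "B \<subseteq> {0..1}" "\<And>b. b \<in> B \<Longrightarrow> smooth S (A b)" "open S" "x \<in> S"
  shows "nform B A (const_fermat x) = frac (\<lambda>t. \<Sum>b\<in>B. A b x * pw t b)"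
  unfolding const_fermat_def by (rule nform_frac[OF assms(1-3)]) (use assms(4) in auto)

lemma frac_psum_unique:
  assumes "finite B" "B \<subseteq> {0..1}" "finite B'" "B' \<subseteq> {0..1}"
    and "frac (\<lambda>t. \<Sum>b\<in>B. c b * pw t b) = frac (\<lambda>t. \<Sum>b\<in>B'. c' b * pw t b)"
    and z: "\<And>b. b \<notin> B \<Longrightarrow> c b = 0" "\<And>b. b \<notin> B' \<Longrightarrow> c' b = 0"
  shows "c b = c' b"
proof (cases "b \<in> B \<union> B'")
  case True
  have R: "(\<lambda>t. \<Sum>b\<in>B. c b * pw t b) \<in> Ro" "(\<lambda>t. \<Sum>b\<in>B'. c' b * pw t b) \<in> Ro"
    using assms by (auto intro!: Ro_sum Ro_pw)
  have "is_o (\<lambda>t. (\<Sum>b\<in>B. c b * pw t b) - (\<Sum>b\<in>B'. c' b * pw t b))"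
    using frac_eqD[OF R assms(5)] by (simp add: sim_def)
  moreover have "(\<Sum>b\<in>B. c b * pw t b) = (\<Sum>b\<in>B \<union> B'. c b * pw t b)" for t
    using assms by (intro sum.mono_neutral_left) auto
  moreover have "(\<Sum>b\<in>B'. c' b * pw t b) = (\<Sum>b\<in>B \<union> B'. c' b * pw t b)" for t
    using assms by (intro sum.mono_neutral_left) auto
  ultimately have "is_o (\<lambda>t. \<Sum>b\<in>B \<union> B'. (c b - c' b) * pw t b)"
    by (simp add: left_diff_distrib sum_subtractf)
  from psum_is_o_imp_0[OF _ _ this True] assms show ?thesis by simp
next
  case False
  then show ?thesis using z by simp
qed

text \<open>The coefficients need to agree along \<open>rep y\<close> modulo \<open>o(t)\<close>
  only; this leaves room for flat differences at an end of the interval.\<close>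

lemma nform_eqI:
  assumes "finite B" "B \<subseteq> {0..1}" "finite B'" "B' \<subseteq> {0..1}"
    and o: "\<And>b. b \<in> B \<union> B' \<Longrightarrow> is_o (\<lambda>t. A b (rep y t) - A' b (rep y t))"
    and e: "e > 0"
    and z: "\<And>b z. b \<notin> B \<Longrightarrow> z \<in> ball (std y) e \<Longrightarrow> A b z = 0"
      "\<And>b z. b \<notin> B' \<Longrightarrow> z \<in> ball (std y) e \<Longrightarrow> A' b z = 0"
  shows "nform B A y = nform B' A' y"
  unfolding nform_def
proof (rule frac_cong)
  have "is_o (\<lambda>t. \<Sum>b\<in>B \<union> B'. (A b (rep y t) - A' b (rep y t)) * pw t b)"
    using assms by (intro is_o_sum is_o_mult_pw o) auto
  moreover have "eventually (\<lambda>t. dist (rep y t) (std y) < e) at0"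
    unfolding std_def by (rule tendstoD[OF Ro_tendsto[OF rep_Ro] e])
  then have "eventually (\<lambda>t. (\<Sum>b\<in>B. A b (rep y t) * pw t b) - (\<Sum>b\<in>B'. A' b (rep y t) * pw t b) =
      (\<Sum>b\<in>B \<union> B'. (A b (rep y t) - A' b (rep y t)) * pw t b)) at0"
  proof eventually_elim
    case (elim t)
    then have t: "rep y t \<in> ball (std y) e" by (simp add: dist_commute)
    have "(\<Sum>b\<in>B. A b (rep y t) * pw t b) = (\<Sum>b\<in>B \<union> B'. A b (rep y t) * pw t b)"
      "(\<Sum>b\<in>B'. A' b (rep y t) * pw t b) = (\<Sum>b\<in>B \<union> B'. A' b (rep y t) * pw t b)"
      using assms(1,3) z(1)[OF _ t] z(2)[OF _ t] by (auto intro!: sum.mono_neutral_left)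
    then show ?case by (simp add: left_diff_distrib sum_subtractf)
  qed
  ultimately show "sim (\<lambda>t. \<Sum>b\<in>B. A b (rep y t) * pw t b) (\<lambda>t. \<Sum>b\<in>B'. A' b (rep y t) * pw t b)"
    unfolding sim_def by (simp add: is_o_cong)
qed

lemma local_nf_recenter:
  assumes "local_nf J f c e B A" "d > 0" "ball c' d \<subseteq> ball c e"
  shows "local_nf J f c' d B A"
  using assms unfolding local_nf_def by (auto intro: smooth_subset)

text \<open>One family \<open>A\<close> serves for the function and, differentiated termwise, for
  its derivative. Independence of the derivative from the representation thus becomes a question
  about real coefficients.\<close>

lemma local_rep_local_nf:
  assumes "local_rep J f x V N P p \<alpha>"
  shows "\<exists>e B A. local_nf J f (std x) e B A \<and> ext (\<lambda>q s. deriv (\<alpha> q) s) N p x = nform B (\<lambda>b. deriv (A b)) x"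
proof -
  have LV: "open V" "std x \<in> V" "openN N P" "stdv N p \<in> P" "CinfN (Suc N) (prodU N P V) (uncur \<alpha>)"
    and f: "\<And>y. y \<in> J \<Longrightarrow> std y \<in> V \<Longrightarrow> f y = ext \<alpha> N p y"
    using assms by (auto simp: local_rep_def)
  define q where "q = (\<lambda>t i. if i < N then rep (p i) t else 0)"
  have "q 0 = stdv N p" by (auto simp: q_def stdv_def std_def)
  then interpret param_path N P V "\<lambda>i. rep (p i)" "std x" q
    by unfold_locales (use LV in \<open>auto simp: q_def\<close>)
  obtain d B A where d: "d > 0" and A: "expansion_on (ball (std x) d) B A (\<lambda>t y. \<alpha> (q t) y)"
    and A': "expansion_on (ball (std x) d) B (\<lambda>b. deriv (A b)) (\<lambda>t y. deriv (\<alpha> (q t)) y)"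
    using expansion_on_deriv[OF LV(5)] by blast
  obtain d' where d': "d' > 0" "ball (std x) d' \<subseteq> V" using LV open_contains_ball by blast
  define e where "e = min d d'"
  have e: "e > 0" "ball (std x) e \<subseteq> V" "ball (std x) e \<subseteq> ball (std x) d"
    using d d' by (auto simp: e_def)
  note A = expansion_on_subset[OF A e(3)] and A' = expansion_on_subset[OF A' e(3)]
  have ext: "ext \<beta> N p y = nform B C y"
    if "expansion_on (ball (std x) e) B C (\<lambda>t y. \<beta> (q t) y)" "std y \<in> ball (std x) e" for \<beta> C y
    unfolding ext_def nform_def
    using expansion_on_subst[OF that(1), of "rep y"] that(2)
    by (intro frac_cong) (simp add: sim_def q_def std_def)
  have "local_nf J f (std x) e B A"
    unfolding local_nf_def using e A f ext[OF A] by (auto simp: expansion_on_def)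
  moreover have "ext (\<lambda>q s. deriv (\<alpha> q) s) N p x = nform B (\<lambda>b. deriv (A b)) x"
    using ext[OF A'] e by simp
  ultimately show ?thesis by blast
qed

section \<open>Intervals of Fermat reals and their standard parts\<close>

lemma convex_einterval: "convex (einterval a b)"
proof -
  have "a < ereal z \<and> ereal z < b" if "a < ereal x" "ereal y < b" "x \<le> z" "z \<le> y" for x y z
    using less_le_trans[OF that(1), of "ereal z"] le_less_trans[of "ereal z", OF _ that(2)] that(3,4) by simp
  then show ?thesis
    unfolding is_interval_convex_1[symmetric] is_interval_1 Ball_def einterval_iff by blast
qed

text \<open>Summarises the four kinds of intervals by the standard parts \<open>l < r\<close> of
  their ends. Strictly between them every Fermat real belongs to \<open>J\<close>; with standard
  part exactly \<open>l\<close> or \<open>r\<close> only some may, and convexity is all that is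
  recorded about those.\<close>

locale finterval =
  fixes J :: "fermat set" and l r :: ereal
  assumes lr: "l < r"
    and inner: "\<And>y. l < ereal (std y) \<Longrightarrow> ereal (std y) < r \<Longrightarrow> y \<in> J"
    and outer: "\<And>y. y \<in> J \<Longrightarrow> l \<le> ereal (std y) \<and> ereal (std y) \<le> r"
    and convex: "\<And>x y z. x \<in> J \<Longrightarrow> z \<in> J \<Longrightarrow> fle x y \<Longrightarrow> fle y z \<Longrightarrow> y \<in> J"

lemma ele_std: "ele a b \<Longrightarrow> estd a \<le> estd b"
  by (induction a b rule: ele.induct) (auto intro: fle_std)

text \<open>Different standard parts already decide the strict order, so open and closed ends give
  the same interior.\<close>

lemma std_ele: "estd a < estd b \<Longrightarrow> elt a b"
proof -
  assume less: "estd a < estd b"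
  then have "ele a b"
    by (induction a b rule: ele.induct) (auto intro: std_less_imp_fle)
  with less show ?thesis by (auto simp: elt_def)
qed

lemma ele_trans: "ele a (Fin x) \<Longrightarrow> fle x y \<Longrightarrow> ele a (Fin y)"
  by (cases a) (auto intro: fle_trans)

lemma ele_trans': "ele (Fin y) b \<Longrightarrow> fle x y \<Longrightarrow> ele (Fin x) b"
  by (cases b) (auto intro: fle_trans)

lemma elt_trans: "elt a (Fin x) \<Longrightarrow> fle x y \<Longrightarrow> elt a (Fin y)"
  by (cases a) (auto simp: elt_def intro: fle_trans fle_antisym)

lemma elt_trans': "elt (Fin y) b \<Longrightarrow> fle x y \<Longrightarrow> elt (Fin x) b"
  by (cases b) (auto simp: elt_def intro: fle_trans fle_antisym)

lemma noninf_interval_finterval: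
  assumes "noninf_interval J"
  shows "\<exists>l r. finterval J l r"
proof -
  obtain a b where ab: "estd a < estd b"
    and J: "J = {x. ele a (Fin x) \<and> ele (Fin x) b} \<or>
      J = {x. elt a (Fin x) \<and> elt (Fin x) b} \<or>
      J = {x. ele a (Fin x) \<and> elt (Fin x) b} \<or>
      J = {x. elt a (Fin x) \<and> ele (Fin x) b}"
    using assms unfolding noninf_interval_def by blast
  have "finterval J (estd a) (estd b)"
  proof
    fix y assume "estd a < ereal (std y)" "ereal (std y) < estd b"
    then have "elt a (Fin y)" "elt (Fin y) b" by (auto intro!: std_ele)
    then show "y \<in> J" using J by (auto simp: elt_def)
  next
    fix y assume "y \<in> J"
    then have "ele a (Fin y)" "ele (Fin y) b" using J by (auto simp: elt_def)
    then show "estd a \<le> ereal (std y) \<and> ereal (std y) \<le> estd b" using ele_std by fastforce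
  next
    fix x y z assume "x \<in> J" "z \<in> J" "fle x y" "fle y z"
    then show "y \<in> J"
      using J ele_trans[of a x y] ele_trans'[of z b y] elt_trans[of a x y] elt_trans'[of z b y] by auto
  qed (rule ab)
  then show ?thesis by blast
qed

context finterval begin

text \<open>For these real points the entire monad lies in \<open>J\<close>; in particular they can
  be inserted into \<open>f\<close> as constants.\<close>

definition core :: "real set" where
  "core = {x. l < ereal x \<and> ereal x < r}"

lemma open_core: "open core"
proof -
  have "core = einterval l r" by (auto simp: core_def einterval_def)
  then show ?thesis by simp
qed

lemma convex_core: "convex core"
  using convex_einterval[of l r] by (simp add: core_def einterval_def)

lemma const_fermat_in_J: "x \<in> core \<Longrightarrow> const_fermat x \<in> J"
  by (rule inner) (auto simp: core_def)

text \<open>Rests on \<open>l < r\<close>: a standard part at an end of the interval is still a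
  limit of interior real points. Together with \<open>vanish_is_o\<close> this transports identities
  from the interior to the ends.\<close>

lemma std_closure_core:
  assumes "y \<in> J" "open S" "std y \<in> S"
  shows "std y \<in> closure (core \<inter> S)"
proof -
  obtain e where e: "e > 0" "ball (std y) e \<subseteq> S" using assms(2,3) open_contains_ball by blast
  show ?thesis
    unfolding closure_approachable
  proof (intro allI impI)
    fix d :: real assume d: "d > 0"
    define \<delta> where "\<delta> = min d e"
    have \<delta>: "\<delta> > 0" using d e by (simp add: \<delta>_def)
    have "max l (ereal (std y - \<delta>)) < min r (ereal (std y + \<delta>))"
      using lr outer[OF assms(1)] \<delta>
      by (auto intro: le_less_trans[of l "ereal (std y)"] less_le_trans[of _ "ereal (std y)" r])
    then obtain z where z: "max l (ereal (std y - \<delta>)) < ereal z" "ereal z < min r (ereal (std y + \<delta>))"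
      using ereal_dense2 by blast
    then have "z \<in> core" "dist z (std y) < \<delta>" by (auto simp: core_def dist_real_def)
    then show "\<exists>z\<in>core \<inter> S. dist z (std y) < d"
      using e by (intro bexI[of _ z]) (auto simp: \<delta>_def dist_commute)
  qed
qed

text \<open>Evaluation at the constant Fermat real \<open>x\<close> turns a normal form into a sum
  of powers with real coefficients, and these are unique.\<close>

lemma local_nf_coeff_unique:
  assumes "local_nf J f c e B A" "local_nf J f c' e' B' A'" "x \<in> ball c e" "x \<in> ball c' e'" "x \<in> core"
  shows "A b x = A' b x"
proof (rule frac_psum_unique[where c = "\<lambda>b. A b x" and c' = "\<lambda>b. A' b x"])
  have "f (const_fermat x) = nform B A (const_fermat x)" "f (const_fermat x) = nform B' A' (const_fermat x)"
    using assms(1-4) const_fermat_in_J[OF assms(5)] unfolding local_nf_def by (metis std_const_fermat)+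
  moreover have "nform B A (const_fermat x) = frac (\<lambda>t. \<Sum>b\<in>B. A b x * pw t b)"
    by (rule nform_const_fermat[of _ "ball c e"]) (use assms in \<open>auto simp: local_nf_def\<close>)
  moreover have "nform B' A' (const_fermat x) = frac (\<lambda>t. \<Sum>b\<in>B'. A' b x * pw t b)"
    by (rule nform_const_fermat[of _ "ball c' e'"]) (use assms in \<open>auto simp: local_nf_def\<close>)
  ultimately show "frac (\<lambda>t. \<Sum>b\<in>B. A b x * pw t b) = frac (\<lambda>t. \<Sum>b\<in>B'. A' b x * pw t b)" by simp
qed (use assms in \<open>auto simp: local_nf_def\<close>)

text \<open>On the interior the coefficients agree, hence so do their derivatives. If
  \<open>std x\<close> is an end, the two families may differ beyond it, but the difference is flat
  at \<open>std x\<close> and thus \<open>o(t)\<close> along \<open>rep x\<close>.\<close>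

lemma local_nf_deriv_unique:
  assumes "local_nf J f (std x) e B A" "local_nf J f (std x) e' B' A'" "x \<in> J"
  shows "nform B (\<lambda>b. deriv (A b)) x = nform B' (\<lambda>b. deriv (A' b)) x"
proof -
  define d where "d = min e e'"
  let ?S = "ball (std x) d"
  have d: "d > 0" using assms by (simp add: d_def local_nf_def)
  have A: "local_nf J f (std x) d B A" "local_nf J f (std x) d B' A'"
    using assms(1,2) d by (auto elim!: local_nf_recenter simp: d_def)
  have sm: "smooth ?S (A b)" "smooth ?S (A' b)" for b using A by (auto simp: local_nf_def)
  have dz: "deriv (C b) z = 0" if "b \<notin> B''" "z \<in> ?S" "local_nf J f (std x) d B'' C" for b z B'' C
    using vanish_derivs[of ?S "C b" z 1] that by (auto simp: local_nf_def)
  show ?thesis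
  proof (rule nform_eqI[where e = d])
    fix b
    have "is_o (\<lambda>t. (\<lambda>z. deriv (A b) z - deriv (A' b) z) (rep x t))"
    proof (rule vanish_is_o[where S = ?S and T = "core \<inter> ?S" and y = "rep x"
          and f = "\<lambda>z. deriv (A b) z - deriv (A' b) z"])
      show "smooth ?S (\<lambda>z. deriv (A b) z - deriv (A' b) z)"
        by (intro smooth_diff smooth_deriv sm) auto
      show "rep x 0 \<in> closure (core \<inter> ?S \<inter> ?S)"
        using std_closure_core[OF assms(3), of ?S] d by (simp add: std_def Int_assoc)
      fix z assume z: "z \<in> core \<inter> ?S"
      have "(A b has_real_derivative deriv (A' b) z) (at z)"
        by (rule has_field_derivative_transform_within_open[where S = "core \<inter> ?S" and f = "A' b"])
          (use z open_core local_nf_coeff_unique[OF A(2,1)] in \<open>auto intro!: smooth_has_deriv sm(2)\<close>)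
      then show "deriv (A b) z - deriv (A' b) z = 0" by (simp add: DERIV_imp_deriv)
    qed (use d open_core in \<open>auto simp: std_def\<close>)
    then show "is_o (\<lambda>t. deriv (A b) (rep x t) - deriv (A' b) (rep x t))" .
  qed (use A dz[OF _ _ A(1)] dz[OF _ _ A(2)] in \<open>auto simp: local_nf_def\<close>)
qed

lemma smoothF_local_nf: "smoothF J f \<Longrightarrow> x \<in> J \<Longrightarrow> \<exists>e B A. local_nf J f (std x) e B A"
  unfolding smoothF_def using local_rep_local_nf by blast

lemma derivF_local_nf:
  assumes "smoothF J f" "x \<in> J" "local_nf J f (std x) e B A"
  shows "derivF J f x = nform B (\<lambda>b. deriv (A b)) x"
proof -
  have "\<exists>d V N P p \<alpha>. local_rep J f x V N P p \<alpha> \<and> d = ext (\<lambda>q s. deriv (\<alpha> q) s) N p x"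
    using assms(1,2) unfolding smoothF_def by blast
  then have "\<exists>V N P p \<alpha>. local_rep J f x V N P p \<alpha> \<and> derivF J f x = ext (\<lambda>q s. deriv (\<alpha> q) s) N p x"
    unfolding derivF_def by (rule someI_ex)
  then show ?thesis
    using local_rep_local_nf local_nf_deriv_unique[OF _ assms(3,2)] by metis
qed

lemma derivF_local_rep:
  assumes "smoothF J f" "x \<in> J" "local_rep J f x V N P p \<alpha>"
  shows "derivF J f x = ext (\<lambda>q s. deriv (\<alpha> q) s) N p x"
  using local_rep_local_nf[OF assms(3)] derivF_local_nf[OF assms(1,2)] by metis

text \<open>The open interval from \<open>u\<close> to \<open>v\<close> contains a neighbourhood of
  every standard part of \<open>J\<close>, including an attained end, so representatives stay in the
  domain of the coefficients for small \<open>t\<close>.\<close>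

definition global_nf :: "(fermat \<Rightarrow> fermat) \<Rightarrow> ereal \<Rightarrow> ereal \<Rightarrow> (real \<Rightarrow> real \<Rightarrow> real) \<Rightarrow> bool" where
  "global_nf f u v A \<longleftrightarrow> u < v \<and> core \<subseteq> einterval u v \<and> std ` J \<subseteq> einterval u v \<and>
     (\<forall>b. smooth (einterval u v) (A b)) \<and>
     (\<forall>x\<in>einterval u v. \<exists>B. exponents_near A B x) \<and>
     (\<forall>y\<in>J. \<forall>B. exponents_near A B (std y) \<longrightarrow> f y = nform B A y)"

text \<open>Uniqueness on the interior makes the local coefficients compatible there, so they glue.
  Beyond an end that is attained as a standard part, the local form centred at that end continues
  the family.\<close>

lemma global_nf_ex:
  assumes "smoothF J f"
  shows "\<exists>u v A. global_nf f u v A"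
proof -
  have "\<exists>e B A. local_nf J f c e B A" if "c \<in> std ` J" for c
    using that smoothF_local_nf[OF assms] by blast
  then obtain E BB AA where L: "\<And>c. c \<in> std ` J \<Longrightarrow> local_nf J f c (E c) (BB c) (AA c)" by metis
  have E: "c \<in> std ` J \<Longrightarrow> E c > 0" for c using L by (auto simp: local_nf_def)
  have coreJ: "x \<in> core \<Longrightarrow> x \<in> std ` J" for x using const_fermat_in_J[of x] std_const_fermat[of x] by (metis imageI)
  \<comment> \<open>An end is pushed outwards by the radius of its local form exactly when it is the
    standard part of a point of \<open>J\<close>; otherwise, in particular if it is infinite, it is
    kept.\<close>
  define lw where "lw = (if l \<in> ereal ` std ` J then ereal (real_of_ereal l - E (real_of_ereal l)) else l)"
  define rw where "rw = (if r \<in> ereal ` std ` J then ereal (real_of_ereal r + E (real_of_ereal r)) else r)"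
  \<comment> \<open>Inside, the coefficient at \<open>x\<close> is read off the local form centred
    at \<open>x\<close> itself. Smoothness is not visible from this; it follows from
    \<open>mid\<close>, which replaces the moving centre by a fixed one.\<close>
  define A where "A b x = (if ereal x \<le> l then AA (real_of_ereal l) b x
    else if r \<le> ereal x then AA (real_of_ereal r) b x else AA x b x)" for b x
  have lw: "lw \<le> l" "l \<in> ereal ` std ` J \<Longrightarrow> lw < l" using E by (force simp: lw_def)+
  have rw: "r \<le> rw" "r \<in> ereal ` std ` J \<Longrightarrow> r < rw" using E by (force simp: rw_def)+
  have core_sub: "core \<subseteq> einterval lw rw"
    using lw(1) rw(1) by (auto simp: core_def einterval_def intro: le_less_trans less_le_trans)
  have std_sub: "std ` J \<subseteq> einterval lw rw"
  proof
    fix x assume x: "x \<in> std ` J"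
    then have "l \<le> ereal x" "ereal x \<le> r" using outer by auto
    moreover have "lw < ereal x" if "l = ereal x" using lw(2) x that by auto
    moreover have "ereal x < rw" if "r = ereal x" using rw(2) x that by auto
    ultimately show "x \<in> einterval lw rw"
      using lw(1) rw(1) by (auto simp: einterval_def le_less intro: less_trans)
  qed
  have mid: "A b z = AA c b z" if "c \<in> std ` J" "z \<in> core" "z \<in> ball c (E c)" for b z c
  proof -
    have "A b z = AA z b z" using that(2) by (auto simp: A_def core_def)
    also have "\<dots> = AA c b z"
      using local_nf_coeff_unique[OF L[OF coreJ[OF that(2)]] L[OF that(1)] _ that(3,2)] E coreJ that(2) by simp
    finally show ?thesis .
  qed
  have loc: "\<exists>c\<in>std ` J. \<exists>T. open T \<and> x \<in> T \<and> T \<subseteq> ball c (E c) \<and> (\<forall>z\<in>T. \<forall>b. A b z = AA c b z)"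
    if x: "x \<in> einterval lw rw" for x
  proof -
    consider "x \<in> core" | "ereal x \<le> l" | "r \<le> ereal x" by (force simp: core_def)
    then show ?thesis
    proof cases
      case 1
      then show ?thesis
        using E[OF coreJ[OF 1]] coreJ[OF 1] open_core mid[OF coreJ[OF 1]]
        by (intro bexI[of _ x] exI[of _ "core \<inter> ball x (E x)"]) auto
    next
      case 2
      have "l \<in> ereal ` std ` J"
        using 2 x by (auto simp: lw_def einterval_def split: if_splits)
      then obtain c where c: "c \<in> std ` J" "l = ereal c" by blast
      have lwc: "lw = ereal (c - E c)" using c by (auto simp: lw_def)
      \<comment> \<open>The cut at \<open>r\<close> keeps out points where \<open>A\<close> follows
        the local form of the other end.\<close>
      let ?T = "ball c (E c) \<inter> einterval (-\<infinity>) r"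
      have "x \<in> ?T"
        using 2 x c lwc E[OF c(1)] le_less_trans[OF 2 lr] by (auto simp: einterval_def dist_real_def)
      moreover have "A b z = AA c b z" if "z \<in> ?T" for b z
      proof (cases "ereal z \<le> l")
        case True
        then show ?thesis using c by (simp add: A_def)
      next
        case False
        then have "z \<in> core" using that by (auto simp: core_def einterval_def)
        then show ?thesis using mid[OF c(1)] that by auto
      qed
      ultimately show ?thesis using c(1) by (intro bexI[of _ c] exI[of _ ?T]) auto
    next
      case 3
      have "r \<in> ereal ` std ` J"
        using 3 x by (auto simp: rw_def einterval_def split: if_splits)
      then obtain c where c: "c \<in> std ` J" "r = ereal c" by blast
      have rwc: "rw = ereal (c + E c)" using c by (auto simp: rw_def)
      let ?T = "ball c (E c) \<inter> einterval l \<infinity>"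
      have "x \<in> ?T"
        using 3 x c rwc E[OF c(1)] less_le_trans[OF lr 3] by (auto simp: einterval_def dist_real_def)
      moreover have "A b z = AA c b z" if "z \<in> ?T" for b z
      proof (cases "r \<le> ereal z")
        case True
        then show ?thesis using c that by (auto simp: A_def einterval_def)
      next
        case False
        then have "z \<in> core" using that by (auto simp: core_def einterval_def)
        then show ?thesis using mid[OF c(1)] that by auto
      qed
      ultimately show ?thesis using c(1) by (intro bexI[of _ c] exI[of _ ?T]) auto
    qed
  qed
  have "global_nf f lw rw A"
    unfolding global_nf_def
  proof (intro conjI allI ballI impI core_sub std_sub)
    show "lw < rw" using lw(1) rw(1) lr by (meson le_less_trans less_le_trans)
  next
    fix b
    show "smooth (einterval lw rw) (A b)"
    proof (rule smooth_local)
      fix x assume "x \<in> einterval lw rw"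
      from loc[OF this] obtain c T where c: "c \<in> std ` J" "open T" "x \<in> T" "T \<subseteq> ball c (E c)"
        "\<And>z b. z \<in> T \<Longrightarrow> A b z = AA c b z" by blast
      have "smooth T (A b)"
        by (rule smooth_cong[OF c(2) smooth_subset[OF _ c(4), of "AA c b"]])
          (use L[OF c(1)] c(5) in \<open>auto simp: local_nf_def\<close>)
      with c(3) show "\<exists>T. x \<in> T \<and> smooth T (A b)" by blast
    qed
  next
    fix x assume "x \<in> einterval lw rw"
    from loc[OF this] obtain c T where c: "c \<in> std ` J" "open T" "x \<in> T" "T \<subseteq> ball c (E c)"
      "\<And>z b. z \<in> T \<Longrightarrow> A b z = AA c b z" by blast
    obtain e where e: "e > 0" "ball x e \<subseteq> T" using c(2,3) open_contains_ball by blast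
    have "A b z = 0" if "b \<notin> BB c" "z \<in> ball x e" for b z
    proof -
      have z: "z \<in> T" using that(2) e(2) by blast
      then have "AA c b z = 0" using L[OF c(1)] that(1) c(4) unfolding local_nf_def by blast
      then show ?thesis using c(5)[OF z] by simp
    qed
    then have "exponents_near A (BB c) x"
      using L[OF c(1)] e(1) unfolding exponents_near_def local_nf_def by blast
    then show "\<exists>B. exponents_near A B x" by blast
  next
    fix y B assume y: "y \<in> J" and B: "exponents_near A B (std y)"
    have "std y \<in> einterval lw rw" using y std_sub by blast
    from loc[OF this] obtain c T where c: "c \<in> std ` J" "open T" "std y \<in> T" "T \<subseteq> ball c (E c)"
      "\<And>z b. z \<in> T \<Longrightarrow> A b z = AA c b z" by blast
    obtain e where e: "e > 0" "ball (std y) e \<subseteq> T" using c(2,3) open_contains_ball by blast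
    obtain e' where e': "e' > 0" "\<And>b z. b \<notin> B \<Longrightarrow> z \<in> ball (std y) e' \<Longrightarrow> A b z = 0"
      using B unfolding exponents_near_def by blast
    have "f y = nform (BB c) (AA c) y" using L[OF c(1)] y c(3,4) unfolding local_nf_def by blast
    also have "\<dots> = nform B A y"
    proof (rule nform_eqI[where e = "min e e'"])
      fix b
      have "eventually (\<lambda>t. dist (rep y t) (std y) < e) at0"
        unfolding std_def by (rule tendstoD[OF Ro_tendsto[OF rep_Ro] e(1)])
      then have "eventually (\<lambda>t. AA c b (rep y t) - A b (rep y t) = 0) at0"
      proof eventually_elim
        case (elim t)
        then have "rep y t \<in> T" using e(2) by (auto simp: dist_commute)
        then show ?case using c(5) by simp
      qed
      then show "is_o (\<lambda>t. AA c b (rep y t) - A b (rep y t))"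
        using is_o_cong[of _ "\<lambda>_. 0"] by simp
    next
      fix b z assume "b \<notin> BB c" "z \<in> ball (std y) (min e e')"
      moreover from this have "z \<in> ball (std y) e" by simp
      then have "z \<in> ball c (E c)" using c(4) e(2) by blast
      ultimately show "AA c b z = 0" using L[OF c(1)] unfolding local_nf_def by blast
    qed (use e(1) e' B L[OF c(1)] in \<open>auto simp: exponents_near_def local_nf_def\<close>)
    finally show "f y = nform B A y" .
  qed
  then show ?thesis by blast
qed

end

subsection \<open>Existence and uniqueness of the integral\<close>

text \<open>Turns the metric formulation of \<open>contN\<close> into a filter limit, so that the
  limit rules for sums and products apply.\<close>

definition nhdsN :: "nat \<Rightarrow> (nat \<Rightarrow> real) set \<Rightarrow> (nat \<Rightarrow> real) \<Rightarrow> (nat \<Rightarrow> real) filter" where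
  "nhdsN N U x = (INF e\<in>{0<..}. principal {y\<in>U. distN N x y < e})"

lemma eventually_nhdsN: "eventually P (nhdsN N U x) \<longleftrightarrow> (\<exists>e>0. \<forall>y\<in>U. distN N x y < e \<longrightarrow> P y)"
proof -
  have "eventually P (nhdsN N U x) \<longleftrightarrow> (\<exists>e\<in>{0<..}. eventually P (principal {y\<in>U. distN N x y < e}))"
    unfolding nhdsN_def
  proof (rule eventually_INF_base)
    fix a b :: real assume "a \<in> {0<..}" "b \<in> {0<..}"
    then show "\<exists>c\<in>{0<..}. principal {y \<in> U. distN N x y < c}
        \<le> inf (principal {y \<in> U. distN N x y < a}) (principal {y \<in> U. distN N x y < b})"
      by (intro bexI[of _ "min a b"]) auto
  qed auto
  then show ?thesis by (auto simp: eventually_principal Bex_def)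
qed

lemma contN_iff: "contN N U g \<longleftrightarrow> (\<forall>x\<in>U. (g \<longlongrightarrow> g x) (nhdsN N U x))"
  by (simp add: contN_def tendsto_iff eventually_nhdsN dist_real_def)

lemma nhdsN_coord: "i < N \<Longrightarrow> ((\<lambda>z. z i) \<longlongrightarrow> x i) (nhdsN N U x)"
  unfolding tendsto_iff
proof (intro allI impI)
  fix e :: real assume i: "i < N" and e: "e > 0"
  have "\<bar>y i - x i\<bar> \<le> distN N x y" for y
  proof -
    have "\<bar>x i - y i\<bar> \<le> L2_set (\<lambda>i. \<bar>x i - y i\<bar>) {..<N}"
      using i by (intro member_le_L2_set[of _ _ "\<lambda>i. \<bar>x i - y i\<bar>"]) auto
    then show ?thesis by (simp add: distN_def L2_set_def abs_minus_commute)
  qed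
  then show "eventually (\<lambda>z. dist (z i) (x i) < e) (nhdsN N U x)"
    unfolding eventually_nhdsN using e by (intro exI[of _ e]) (auto simp: dist_real_def intro: le_less_trans)
qed

text \<open>Coinduction over functions that are affine in the parameters with coefficients smooth in
  the real variable: a derivative in a parameter leaves a single coefficient, one in the real
  variable differentiates all of them, and both keep the shape. The integral will be represented by
  such a function.\<close>

lemma CinfN_affine:
  assumes V: "open V" and "\<And>j. j < N \<Longrightarrow> smooth V (G j)" "smooth V C"
    and "\<And>z. z \<in> prodU N (RN N) V \<Longrightarrow> g z = (\<Sum>j<N. G j (z 0) * z (Suc j)) + C (z 0)"
  shows "CinfN (Suc N) (prodU N (RN N) V) g"
proof -
  let ?U = "prodU N (RN N) V"
  define X where "X g \<longleftrightarrow> (\<exists>G C. (\<forall>j<N. smooth V (G j)) \<and> smooth V C \<and>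
    (\<forall>z\<in>?U. g z = (\<Sum>j<N. G j (z 0) * z (Suc j)) + C (z 0)))" for g :: "(nat \<Rightarrow> real) \<Rightarrow> real"
  have "X g" unfolding X_def using assms by blast
  then show ?thesis
  proof (coinduction arbitrary: g rule: CinfN.coinduct)
    case (CinfN g)
    then obtain G C where G: "\<And>j. j < N \<Longrightarrow> smooth V (G j)" and C: "smooth V C"
      and g: "\<And>z. z \<in> ?U \<Longrightarrow> g z = (\<Sum>j<N. G j (z 0) * z (Suc j)) + C (z 0)"
      unfolding X_def by blast
    have U0: "z \<in> ?U \<Longrightarrow> z 0 \<in> V" for z by (simp add: prodU_def)
    have upd0: "z \<in> ?U \<Longrightarrow> s \<in> V \<Longrightarrow> z(0 := s) \<in> ?U" for z s
      by (auto simp: prodU_def RN_def)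
    have updS: "z \<in> ?U \<Longrightarrow> j < N \<Longrightarrow> z(Suc j := s) \<in> ?U" for z s j
      by (auto simp: prodU_def RN_def)
    have "contN (Suc N) ?U g"
      unfolding contN_iff
    proof
      fix z assume z: "z \<in> ?U"
      have c: "((\<lambda>w. H (w 0)) \<longlongrightarrow> H (z 0)) (nhdsN (Suc N) ?U z)" if "smooth V H" for H
        using isCont_tendsto_compose[OF smooth_isCont[OF that U0[OF z]] nhdsN_coord[of 0 "Suc N" z ?U]] by simp
      have "((\<lambda>w. (\<Sum>j<N. G j (w 0) * w (Suc j)) + C (w 0)) \<longlongrightarrow> (\<Sum>j<N. G j (z 0) * z (Suc j)) + C (z 0)) (nhdsN (Suc N) ?U z)"
        by (intro tendsto_add tendsto_sum tendsto_mult c G C nhdsN_coord) auto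
      then have "((\<lambda>w. (\<Sum>j<N. G j (w 0) * w (Suc j)) + C (w 0)) \<longlongrightarrow> g z) (nhdsN (Suc N) ?U z)"
        by (simp add: g z)
      then show "(g \<longlongrightarrow> g z) (nhdsN (Suc N) ?U z)"
        by (rule Lim_transform_eventually) (auto simp: eventually_nhdsN g intro!: exI[of _ 1])
    qed
    moreover have D0: "((\<lambda>s. g (z(0 := s))) has_real_derivative
        (\<Sum>j<N. deriv (G j) (z 0) * z (Suc j)) + deriv C (z 0)) (at (z 0))" if z: "z \<in> ?U" for z
    proof (rule has_field_derivative_transform_within_open[OF _ V U0[OF z]])
      show "((\<lambda>s. (\<Sum>j<N. G j s * z (Suc j)) + C s) has_real_derivative
        (\<Sum>j<N. deriv (G j) (z 0) * z (Suc j)) + deriv C (z 0)) (at (z 0))"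
        by (intro DERIV_add DERIV_sum DERIV_cmult_right smooth_has_deriv[OF _ U0[OF z]] G C) auto
      show "(\<Sum>j<N. G j s * z (Suc j)) + C s = g (z(0 := s))" if "s \<in> V" for s
        using g[OF upd0[OF z that]] by simp
    qed
    moreover have DS: "((\<lambda>s. g (z(Suc m := s))) has_real_derivative G m (z 0)) (at (z (Suc m)))"
      if z: "z \<in> ?U" and m: "m < N" for z m
    proof -
      have "g (z(Suc m := s)) = G m (z 0) * s + ((\<Sum>j\<in>{..<N} - {m}. G j (z 0) * z (Suc j)) + C (z 0))" for s
      proof -
        have "g (z(Suc m := s)) = (\<Sum>j<N. G j (z 0) * (z(Suc m := s)) (Suc j)) + C (z 0)"
          using g[OF updS[OF z m]] by simp
        also have "(\<Sum>j<N. G j (z 0) * (z(Suc m := s)) (Suc j)) =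
          G m (z 0) * s + (\<Sum>j\<in>{..<N} - {m}. G j (z 0) * (z(Suc m := s)) (Suc j))"
          using m by (subst sum.remove[of _ m]) auto
        also have "(\<Sum>j\<in>{..<N} - {m}. G j (z 0) * (z(Suc m := s)) (Suc j)) = (\<Sum>j\<in>{..<N} - {m}. G j (z 0) * z (Suc j))"
          by (intro sum.cong) auto
        finally show ?thesis by (simp only: add.assoc)
      qed
      then show ?thesis by (auto intro!: derivative_eq_intros)
    qed
    moreover have "X (fpartial i g)" if i: "i < Suc N" for i
    proof (cases i)
      case 0
      have "\<forall>z\<in>?U. fpartial i g z = (\<Sum>j<N. deriv (G j) (z 0) * z (Suc j)) + deriv C (z 0)"
        using D0 by (auto simp: fpartial_def 0 intro: DERIV_imp_deriv)
      then show ?thesis unfolding X_def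
        using G C by (intro exI[of _ "\<lambda>j. deriv (G j)"] exI[of _ "deriv C"]) (auto intro: smooth_deriv)
    next
      case (Suc m)
      then have m: "m < N" using i by simp
      have "\<forall>z\<in>?U. fpartial i g z = (\<Sum>j<N. (\<lambda>_ _. 0) j (z 0) * z (Suc j)) + G m (z 0)"
        using DS[OF _ m] by (auto simp: fpartial_def Suc intro: DERIV_imp_deriv)
      then show ?thesis unfolding X_def
        using G[OF m] by (intro exI[of _ "\<lambda>_ _. 0"] exI[of _ "G m"]) auto
    qed
    moreover have "(\<lambda>s. g (z(i := s))) differentiable (at (z i))" if "i < Suc N" "z \<in> ?U" for i z
      using D0[OF that(2)] DS[OF that(2)] that(1)
      by (cases i) (auto simp: real_differentiable_def)
    ultimately show ?case by blast
  qed
qed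

section \<open>Local finiteness of exponents and primitives\<close>

lemma exponents_near_near:
  assumes "finite B" "B \<subseteq> {0..1}" "\<And>b z. b \<notin> B \<Longrightarrow> z \<in> ball x e \<Longrightarrow> A b z = 0" "y \<in> ball x e"
  shows "exponents_near A B y"
proof -
  obtain d where "d > 0" "ball y d \<subseteq> ball x e" using assms(4) open_ball open_contains_ball by blast
  then show ?thesis using assms unfolding exponents_near_def by blast
qed

lemma exponents_near_mono: "exponents_near A B x \<Longrightarrow> B \<subseteq> B' \<Longrightarrow> finite B' \<Longrightarrow> B' \<subseteq> {0..1} \<Longrightarrow> exponents_near A B' x"
  unfolding exponents_near_def by blast

lemma exponents_near_Un:
  assumes "exponents_near A B x" "exponents_near A' B' x'"
  shows "exponents_near A (B \<union> B') x" "exponents_near A' (B \<union> B') x'"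
  using assms by (auto intro!: exponents_near_mono[OF assms(1)] exponents_near_mono[OF assms(2)] simp: exponents_near_def)

lemma sim_eventually:
  assumes "eventually (\<lambda>t. x t = y t) at0"
  shows "sim x y"
proof -
  have "eventually (\<lambda>t. x t - y t = 0) at0" using assms by eventually_elim simp
  from is_o_cong[OF this] show ?thesis by (simp add: sim_def)
qed

lemma exponents_near_eventually:
  assumes "exponents_near A B (std y)"
  shows "eventually (\<lambda>t. \<forall>b. b \<notin> B \<longrightarrow> A b (rep y t) = 0) at0"
proof -
  obtain e where e: "e > 0" "\<forall>b. b \<notin> B \<longrightarrow> (\<forall>z\<in>ball (std y) e. A b z = 0)"
    using assms unfolding exponents_near_def by blast
  have "eventually (\<lambda>t. dist (rep y t) (std y) < e) at0"
    unfolding std_def by (rule tendstoD[OF Ro_tendsto[OF rep_Ro] e(1)])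
  then show ?thesis
  proof eventually_elim
    case (elim t)
    then have "rep y t \<in> ball (std y) e" by (simp add: dist_commute)
    then show ?case using e(2) by blast
  qed
qed

lemma segment_in_einterval:
  assumes "x \<in> einterval a b" "y \<in> einterval a b"
  shows "closed_segment x y \<subseteq> einterval a b"
  using convex_einterval assms by (simp add: closed_segment_subset)

lemma const_on_convex:
  fixes F :: "real \<Rightarrow> real"
  assumes "convex S" "\<And>z. z \<in> S \<Longrightarrow> (F has_real_derivative 0) (at z)" "x \<in> S" "y \<in> S"
  shows "F x = F y"
proof -
  obtain c where "\<forall>z\<in>S. F z = c"
    using has_field_derivative_zero_constant[OF assms(1), of F] assms(2) has_field_derivative_at_within by blast
  then show ?thesis using assms(3,4) by simp
qed

context finterval begin

lemma global_nf_smooth: "global_nf f lw rw A \<Longrightarrow> smooth (einterval lw rw) (A b)"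
  by (simp add: global_nf_def)

lemma global_nf_exponents_near: "global_nf f lw rw A \<Longrightarrow> x \<in> einterval lw rw \<Longrightarrow> \<exists>B. exponents_near A B x"
  by (simp add: global_nf_def)

lemma global_nf_std: "global_nf f lw rw A \<Longrightarrow> y \<in> J \<Longrightarrow> std y \<in> einterval lw rw"
  by (auto simp: global_nf_def)

lemma global_nf_nform: "global_nf f lw rw A \<Longrightarrow> y \<in> J \<Longrightarrow> exponents_near A B (std y) \<Longrightarrow> f y = nform B A y"
  by (simp add: global_nf_def)

lemma global_nf_core: "global_nf f lw rw A \<Longrightarrow> core \<subseteq> einterval lw rw"
  by (simp add: global_nf_def)

lemma global_nf_local_nf:
  assumes "global_nf f lw rw A" "y \<in> J" "exponents_near A B (std y)"
  shows "\<exists>e. local_nf J f (std y) e B A"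
proof -
  obtain e where e: "e > 0" "\<And>b z. b \<notin> B \<Longrightarrow> z \<in> ball (std y) e \<Longrightarrow> A b z = 0"
    using assms(3) unfolding exponents_near_def by blast
  have "std y \<in> einterval lw rw" by (rule global_nf_std[OF assms(1,2)])
  then obtain d where d: "d > 0" "ball (std y) d \<subseteq> einterval lw rw"
    using open_einterval open_contains_ball by blast
  have B: "finite B" "B \<subseteq> {0..1}" using assms(3) by (auto simp: exponents_near_def)
  have "local_nf J f (std y) (min d e) B A"
    unfolding local_nf_def
  proof (intro conjI allI ballI impI B)
    show "min d e > 0" using d e by simp
    show "smooth (ball (std y) (min d e)) (A b)" for b
      by (rule smooth_subset[OF global_nf_smooth[OF assms(1)]]) (use d in auto)
    show "A b z = 0" if "b \<notin> B" "z \<in> ball (std y) (min d e)" for b z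
      using that by (intro e(2)) auto
    fix x assume x: "x \<in> J" "std x \<in> ball (std y) (min d e)"
    have "exponents_near A B (std x)"
      by (rule exponents_near_near[OF B e(2)]) (use x in auto)
    then show "f x = nform B A x" by (rule global_nf_nform[OF assms(1) x(1)])
  qed
  then show ?thesis by blast
qed

text \<open>The segment is compact, and the union of the exponent sets of a finite subcover works at
  each of its points.\<close>

lemma global_nf_exponents_near_segment:
  assumes g: "global_nf f lw rw A" and x: "x \<in> einterval lw rw" "y \<in> einterval lw rw"
  shows "\<exists>B. \<forall>z\<in>closed_segment x y. exponents_near A B z"
proof -
  let ?W = "einterval lw rw" and ?K = "closed_segment x y"
  have K: "?K \<subseteq> ?W" using segment_in_einterval[OF x] .
  have "\<forall>z\<in>?W. \<exists>B e. finite B \<and> B \<subseteq> {0..1} \<and> e > 0 \<and> (\<forall>b. b \<notin> B \<longrightarrow> (\<forall>w\<in>ball z e. A b w = 0))"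
  proof
    fix z assume "z \<in> ?W"
    then obtain B where "exponents_near A B z" using global_nf_exponents_near[OF g] by blast
    then show "\<exists>B e. finite B \<and> B \<subseteq> {0..1} \<and> e > 0 \<and> (\<forall>b. b \<notin> B \<longrightarrow> (\<forall>w\<in>ball z e. A b w = 0))"
      unfolding exponents_near_def by blast
  qed
  then obtain BB E where E: "\<And>z. z \<in> ?W \<Longrightarrow> finite (BB z) \<and> BB z \<subseteq> {0..1} \<and> E z > 0 \<and>
      (\<forall>b. b \<notin> BB z \<longrightarrow> (\<forall>w\<in>ball z (E z). A b w = 0))"
    by metis
  have "?K \<subseteq> (\<Union>z\<in>?K. ball z (E z))"
  proof
    fix z assume z: "z \<in> ?K"
    then have "z \<in> ball z (E z)" using E[of z] K by auto
    with z show "z \<in> (\<Union>z\<in>?K. ball z (E z))" by blast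
  qed
  from compactE_image[OF compact_segment open_ball this]
  obtain C where C: "C \<subseteq> ?K" "finite C" "?K \<subseteq> (\<Union>z\<in>C. ball z (E z))" by metis
  define B where "B = (\<Union>z\<in>C. BB z)"
  have BC: "finite (BB z) \<and> BB z \<subseteq> {0..1}" if "z \<in> C" for z using E[of z] C(1) K that by blast
  have B: "finite B" unfolding B_def using BC C(2) by blast
  have B': "B \<subseteq> {0..1}" unfolding B_def using BC by blast
  have "exponents_near A B w" if w: "w \<in> ?K" for w
  proof -
    obtain z where z: "z \<in> C" "w \<in> ball z (E z)" using C(3) w by blast
    have "z \<in> ?W" using z(1) C(1) K by blast
    then have "A b v = 0" if "b \<notin> B" "v \<in> ball z (E z)" for b v
      using E[of z] that z(1) unfolding B_def by blast
    then show ?thesis using exponents_near_near[OF B B' _ z(2), of A] by blast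
  qed
  then show ?thesis by blast
qed

text \<open>Normalising all primitives to 0 at one common point preserves local finiteness: an
  exponent absent along the whole segment from \<open>u0\<close> to \<open>x\<close> has a primitive
  that vanishes at \<open>x\<close> and near it. With arbitrary constants of integration infinitely
  many exponents could survive.\<close>

lemma primitive_ex:
  assumes g: "global_nf f lw rw A" and u0: "u0 \<in> einterval lw rw"
  shows "\<exists>F. (\<forall>b. \<forall>x\<in>einterval lw rw. (F b has_real_derivative A b x) (at x)) \<and>
     (\<forall>x\<in>einterval lw rw. \<exists>B. exponents_near F B x)"
proof -
  let ?W = "einterval lw rw"
  have "\<exists>F. F u0 = 0 \<and> (\<forall>x. lw < ereal x \<longrightarrow> ereal x < rw \<longrightarrow> (F has_real_derivative A b x) (at x))" for b
    by (rule antiderivative_exists)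
      (use g in \<open>auto simp: global_nf_def einterval_iff intro!: smooth_isCont[OF global_nf_smooth[OF g]]\<close>)
  then obtain F where F0: "\<And>b. F b u0 = 0" and F: "\<And>b x. x \<in> ?W \<Longrightarrow> (F b has_real_derivative A b x) (at x)"
    unfolding einterval_iff by metis
  have "\<exists>B. exponents_near F B x" if x: "x \<in> ?W" for x
  proof -
    let ?K = "closed_segment u0 x"
    have K: "?K \<subseteq> ?W" using segment_in_einterval[OF u0 x] .
    obtain B where B: "\<And>z. z \<in> ?K \<Longrightarrow> exponents_near A B z" using global_nf_exponents_near_segment[OF g u0 x] by blast
    have Az: "A b z = 0" if b: "b \<notin> B" and z: "z \<in> ?K" for b z
    proof -
      obtain e where "e > 0" "\<forall>w\<in>ball z e. A b w = 0" using B[OF z] b unfolding exponents_near_def by blast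
      then show ?thesis by simp
    qed
    obtain e where e: "e > 0" "\<And>b z. b \<notin> B \<Longrightarrow> z \<in> ball x e \<Longrightarrow> A b z = 0"
      using B[of x] unfolding exponents_near_def by auto
    obtain e' where e': "e' > 0" "ball x e' \<subseteq> ?W" using x open_einterval open_contains_ball by blast
    define d where "d = min e e'"
    have d: "d > 0" using e e' by (simp add: d_def)
    have "F b w = 0" if b: "b \<notin> B" and w: "w \<in> ball x d" for b w
    proof -
      have "F b w = F b x"
      proof (rule const_on_convex[where F = "F b", OF convex_ball])
        fix y assume "y \<in> ball x d"
        then have "y \<in> ?W" "A b y = 0" using e'(2) e(2)[OF b, of y] by (auto simp: d_def)
        then show "(F b has_real_derivative 0) (at y)" using F[of y b] by simp
      qed (use w d in auto)
      also have "\<dots> = F b u0"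
      proof (rule const_on_convex[where F = "F b", OF convex_closed_segment[of u0 x]])
        fix y assume "y \<in> ?K"
        then have "y \<in> ?W" "A b y = 0" using K Az[OF b, of y] by blast+
        then show "(F b has_real_derivative 0) (at y)" using F[of y b] by simp
      qed auto
      finally show ?thesis using F0 by simp
    qed
    then have "exponents_near F B x" unfolding exponents_near_def using B[of x] d by (auto simp: exponents_near_def)
    then show ?thesis by blast
  qed
  then show ?thesis using F by blast
qed

end

section \<open>Construction and uniqueness of the integral\<close>

locale primitive = finterval +
  fixes f :: "fermat \<Rightarrow> fermat" and lw rw :: ereal and A F :: "real \<Rightarrow> real \<Rightarrow> real" and u :: fermat
  assumes g: "global_nf f lw rw A" and u: "u \<in> J"
    and F: "\<And>b x. x \<in> einterval lw rw \<Longrightarrow> (F b has_real_derivative A b x) (at x)"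
    and suppF: "\<And>x. x \<in> einterval lw rw \<Longrightarrow> \<exists>B. exponents_near F B x"
begin

abbreviation "W \<equiv> einterval lw rw"

lemma std_W: "y \<in> J \<Longrightarrow> std y \<in> W"
  by (rule global_nf_std[OF g])

lemma smooth_F: "smooth W (F b)"
  by (rule smooth_antideriv[OF open_einterval global_nf_smooth[OF g] F])

lemma F_Ro: "y \<in> J \<Longrightarrow> (\<lambda>t. F b (rep y t)) \<in> Ro"
  using smooth_comp_Ro[OF open_einterval smooth_F rep_Ro] std_W by (simp add: std_def)

lemma exponents_near_F_A: "exponents_near F B x \<Longrightarrow> x \<in> W \<Longrightarrow> exponents_near A B x"
proof -
  assume B: "exponents_near F B x" and x: "x \<in> W"
  obtain e where e: "e > 0" "\<And>b z. b \<notin> B \<Longrightarrow> z \<in> ball x e \<Longrightarrow> F b z = 0"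
    using B unfolding exponents_near_def by blast
  obtain d where d: "d > 0" "ball x d \<subseteq> W" using x open_einterval open_contains_ball by blast
  have "A b z = 0" if "b \<notin> B" "z \<in> ball x (min d e)" for b z
  proof -
    have "(F b has_real_derivative A b z) (at z)" using that d by (intro F) auto
    moreover have "deriv (F b) z = 0"
      using vanish_derivs[of "ball x (min d e)" "F b" z 1] that e by simp
    ultimately show ?thesis by (simp add: DERIV_imp_deriv)
  qed
  then show ?thesis using B d e unfolding exponents_near_def by (intro conjI exI[of _ "min d e"]) auto
qed

definition increment :: "real set \<Rightarrow> fermat \<Rightarrow> real \<Rightarrow> real" where
  "increment B v t = (\<Sum>b\<in>B. (F b (rep v t) - F b (rep u t)) * pw t b)"

lemma increment_indep:
  assumes "exponents_near F B (std u)" "exponents_near F B (std v)" "exponents_near F B' (std u)" "exponents_near F B' (std v)"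
  shows "frac (increment B v) = frac (increment B' v)"
proof (rule frac_cong)
  have "eventually (\<lambda>t. increment B v t = increment B' v t) at0"
    using assms[THEN exponents_near_eventually]
  proof eventually_elim
    case (elim t)
    have "increment B v t = increment (B \<union> B') v t" "increment B' v t = increment (B \<union> B') v t"
      unfolding increment_def using elim assms by (auto intro!: sum.mono_neutral_left simp: exponents_near_def)
    then show ?case by simp
  qed
  then show "sim (increment B v) (increment B' v)" by (rule sim_eventually)
qed

lemma good_ex: "v \<in> J \<Longrightarrow> \<exists>B. exponents_near F B (std u) \<and> exponents_near F B (std v)"
  using suppF[OF std_W[OF u]] suppF[OF std_W[of v]] exponents_near_Un by metis

text \<open>The exponent set is chosen anew for each \<open>v\<close>, and
  \<open>increment_indep\<close> removes the choice. The value outside \<open>J\<close> follows the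
  normalisation in \<open>fint\<close>.\<close>

definition integ :: "fermat \<Rightarrow> fermat" where
  "integ v = (if v \<in> J then frac (increment (SOME B. exponents_near F B (std u) \<and> exponents_near F B (std v)) v) else fzero)"

lemma integ_eq: "v \<in> J \<Longrightarrow> exponents_near F B (std u) \<Longrightarrow> exponents_near F B (std v) \<Longrightarrow> integ v = frac (increment B v)"
proof -
  assume v: "v \<in> J" and B: "exponents_near F B (std u)" "exponents_near F B (std v)"
  have "exponents_near F (SOME B. exponents_near F B (std u) \<and> exponents_near F B (std v)) (std u) \<and>
        exponents_near F (SOME B. exponents_near F B (std u) \<and> exponents_near F B (std v)) (std v)"
    by (rule someI_ex[OF good_ex[OF v]])
  then have "frac (increment (SOME B. exponents_near F B (std u) \<and> exponents_near F B (std v)) v) = frac (increment B v)"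
    using B by (intro increment_indep) auto
  then show ?thesis unfolding integ_def using v by simp
qed

lemma integ_u: "integ u = fzero"
proof -
  obtain B where "exponents_near F B (std u)" using good_ex[OF u] by blast
  then show ?thesis using integ_eq[OF u] by (simp add: increment_def[abs_def] fzero_def)
qed

text \<open>Near \<open>x\<close> one exponent set suffices, and the integral is affine in finitely
  many Fermat parameters: the powers of \<open>t\<close> and the constant contribution of
  \<open>u\<close>. Differentiation in the real variable removes the latter and returns the
  coefficients of \<open>f\<close>.\<close>

lemma integ_local_rep:
  assumes x: "x \<in> J"
  shows "\<exists>V N P p \<alpha>. local_rep J integ x V N P p \<alpha> \<and> ext (\<lambda>q s. deriv (\<alpha> q) s) N p x = f x"
proof -
  obtain B where B: "exponents_near F B (std u)" "exponents_near F B (std x)" using good_ex[OF x] by blast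
  obtain e' where e': "e' > 0" "\<And>b z. b \<notin> B \<Longrightarrow> z \<in> ball (std x) e' \<Longrightarrow> F b z = 0"
    using B(2) unfolding exponents_near_def by blast
  obtain d where d: "d > 0" "ball (std x) d \<subseteq> W" using std_W[OF x] open_einterval open_contains_ball by blast
  define V where "V = ball (std x) (min d e')"
  have V: "open V" "std x \<in> V" "V \<subseteq> W" using d e' by (auto simp: V_def)
  have fB: "finite B" "B \<subseteq> {0..1}" using B by (auto simp: exponents_near_def)
  then obtain h where h: "bij_betw h {0..<card B} B" using ex_bij_betw_nat_finite by blast
  define n where "n = card B"
  have h: "bij_betw h {..<n} B" using h by (simp add: n_def atLeast0LessThan)
  have hB: "j < n \<Longrightarrow> h j \<in> B" for j using bij_betwE[OF h] by simp
  have sum_h: "(\<Sum>j<n. \<phi> (h j)) = (\<Sum>b\<in>B. \<phi> b)" for \<phi> :: "real \<Rightarrow> real"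
    by (rule sum.reindex_bij_betw[OF h])
  \<comment> \<open>Indices \<open>j < n\<close> carry the powers; the extra index \<open>n\<close>
    carries minus the value of the primitive at \<open>u\<close>, and its coefficient function in
    \<open>G\<close> is the constant 1.\<close>
  define \<pi> where "\<pi> j = (if j < n then (\<lambda>t. 1 * pw t (h j)) else (\<lambda>t. - (\<Sum>b\<in>B. F b (rep u t) * pw t b)))" for j
  define p where "p j = frac (\<pi> j)" for j
  define G where "G j = (if j < n then F (h j) else (\<lambda>_. 1))" for j
  define \<alpha> where "\<alpha> q s = (\<Sum>j<Suc n. G j s * q j)" for q :: "nat \<Rightarrow> real" and s :: real
  have \<pi>_Ro: "\<pi> j \<in> Ro" for j
  proof (cases "j < n")
    case True
    then have "0 \<le> h j" using hB[of j] fB by auto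
    then show ?thesis using Ro_pw[of "h j" 1] True by (simp add: \<pi>_def)
  next
    case False
    then show ?thesis
      using Ro_uminus[OF Ro_nform[of B "F" "rep u"]] fB F_Ro[OF u] by (simp add: \<pi>_def)
  qed
  have smG: "smooth V (G j)" for j
    using smooth_subset[OF smooth_F V(3)] by (simp add: G_def)
  have ext: "ext (\<lambda>q s. \<Sum>j<Suc n. H j s * q j) (Suc n) p y = frac (\<lambda>t. \<Sum>j<Suc n. H j (rep y t) * \<pi> j t)"
    if H: "\<And>j. smooth V (H j)" and y: "std y \<in> V" for H :: "nat \<Rightarrow> real \<Rightarrow> real" and y
    unfolding ext_def
  proof (rule frac_cong)
    have "is_o (\<lambda>t. \<Sum>j<Suc n. H j (rep y t) * (rep (p j) t - \<pi> j t))"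
    proof (rule is_o_sum, rule is_o_mult_Ro)
      fix j
      show "is_o (\<lambda>t. rep (p j) t - \<pi> j t)" using rep_frac[OF \<pi>_Ro, of j] by (simp add: sim_def p_def)
      show "(\<lambda>t. H j (rep y t)) \<in> Ro" using smooth_comp_Ro[OF V(1) H rep_Ro] y by (simp add: std_def)
    qed
    moreover have "(\<Sum>j<Suc n. H j (rep y t) * (rep (p j) t - \<pi> j t)) =
      (\<Sum>j<Suc n. H j (rep y t) * (if j < Suc n then rep (p j) t else 0)) - (\<Sum>j<Suc n. H j (rep y t) * \<pi> j t)" for t
      unfolding sum_subtractf[symmetric] by (intro sum.cong) (auto simp: algebra_simps)
    ultimately show "sim (\<lambda>t. \<Sum>j<Suc n. H j (rep y t) * (if j < Suc n then rep (p j) t else 0))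
      (\<lambda>t. \<Sum>j<Suc n. H j (rep y t) * \<pi> j t)"
      unfolding sim_def by (simp only:)
  qed
  have "local_rep J integ x V (Suc n) (RN (Suc n)) p \<alpha>"
    unfolding local_rep_def
  proof (intro conjI ballI impI V(1,2))
    show "openN (Suc n) (RN (Suc n))" unfolding openN_def by (auto intro: exI[of _ 1])
    show "stdv (Suc n) p \<in> RN (Suc n)" by (simp add: stdv_def RN_def)
    show "CinfN (Suc (Suc n)) (prodU (Suc n) (RN (Suc n)) V) (uncur \<alpha>)"
      by (rule CinfN_affine[where G = G and C = "\<lambda>_. 0"]) (use V smG in \<open>auto simp: uncur_def \<alpha>_def\<close>)
    fix y assume y: "y \<in> J" "std y \<in> V"
    have "exponents_near F B (std y)"
      by (rule exponents_near_near[OF fB e'(2)]) (use y in \<open>auto simp: V_def\<close>)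
    then have "integ y = frac (increment B y)" using integ_eq[OF y(1) B(1)] by simp
    also have "increment B y = (\<lambda>t. \<Sum>j<Suc n. G j (rep y t) * \<pi> j t)"
    proof
      fix t
      show "increment B y t = (\<Sum>j<Suc n. G j (rep y t) * \<pi> j t)"
        using sum_h[of "\<lambda>b. F b (rep y t) * pw t b"]
        by (simp add: increment_def G_def \<pi>_def left_diff_distrib sum_subtractf)
    qed
    also have "frac \<dots> = ext \<alpha> (Suc n) p y"
      unfolding \<alpha>_def[abs_def] by (rule ext[OF smG y(2), symmetric])
    finally show "integ y = ext \<alpha> (Suc n) p y" .
  qed
  moreover have "ext (\<lambda>q s. deriv (\<alpha> q) s) (Suc n) p x = f x"
  proof -
    have "deriv (\<alpha> q) s = (\<Sum>j<Suc n. deriv (G j) s * q j)" if "s \<in> V" for q s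
      unfolding \<alpha>_def[abs_def]
      by (intro DERIV_imp_deriv DERIV_sum DERIV_cmult_right smooth_has_deriv[OF smG that])
    moreover have "eventually (\<lambda>t. rep x t \<in> V) at0"
      using Ro_tendsto[OF rep_Ro, of x] V(1,2) unfolding std_def by (rule topological_tendstoD)
    ultimately have ev: "eventually (\<lambda>t. deriv (\<alpha> (\<lambda>i. if i < Suc n then rep (p i) t else 0)) (rep x t) -
       (\<Sum>j<Suc n. deriv (G j) (rep x t) * (if j < Suc n then rep (p j) t else 0)) = 0) at0"
      by (auto elim!: eventually_mono)
    have "ext (\<lambda>q s. deriv (\<alpha> q) s) (Suc n) p x = ext (\<lambda>q s. \<Sum>j<Suc n. deriv (G j) s * q j) (Suc n) p x"
      unfolding ext_def by (rule frac_cong) (use is_o_cong[OF ev] in \<open>simp only: sim_def is_o_0\<close>)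
    also have "\<dots> = frac (\<lambda>t. \<Sum>j<Suc n. deriv (G j) (rep x t) * \<pi> j t)"
      by (intro ext smooth_deriv smG V)
    also have "(\<lambda>t. \<Sum>j<Suc n. deriv (G j) (rep x t) * \<pi> j t) = (\<lambda>t. \<Sum>b\<in>B. deriv (F b) (rep x t) * pw t b)"
    proof
      fix t
      show "(\<Sum>j<Suc n. deriv (G j) (rep x t) * \<pi> j t) = (\<Sum>b\<in>B. deriv (F b) (rep x t) * pw t b)"
        using sum_h[of "\<lambda>b. deriv (F b) (rep x t) * pw t b"] by (simp add: G_def \<pi>_def)
    qed
    also have "frac \<dots> = nform B (\<lambda>b. deriv (F b)) x" by (simp add: nform_def)
    also have "\<dots> = nform B A x"
    proof (rule nform_eqI[OF fB fB, where e = "min d e'"])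
      have dF: "deriv (F b) z = A b z" if "z \<in> V" for b z
        using F[of z b] that V(3) by (auto intro: DERIV_imp_deriv)
      fix b
      have "eventually (\<lambda>t. deriv (F b) (rep x t) - A b (rep x t) = 0) at0"
        using \<open>eventually (\<lambda>t. rep x t \<in> V) at0\<close> by eventually_elim (simp add: dF)
      from is_o_cong[OF this] show "is_o (\<lambda>t. deriv (F b) (rep x t) - A b (rep x t))" by simp
    next
      fix b z assume b: "b \<notin> B" "z \<in> ball (std x) (min d e')"
      then show z: "deriv (F b) z = 0"
        using vanish_derivs[of "ball (std x) (min d e')" "F b" z 1] e'(2) by simp
      have "(F b has_real_derivative A b z) (at z)" using b d(2) by (intro F) auto
      then show "A b z = 0" using z by (simp add: DERIV_imp_deriv)
    qed (use d e' in auto)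
    also have "\<dots> = f x" using global_nf_nform[OF g x exponents_near_F_A[OF B(2) std_W[OF x]]] by simp
    finally show ?thesis .
  qed
  ultimately show ?thesis by blast
qed

lemma smoothF_integ: "smoothF J integ"
  unfolding smoothF_def using integ_local_rep by blast

lemma derivF_integ: "x \<in> J \<Longrightarrow> derivF J integ x = f x"
  using integ_local_rep derivF_local_rep[OF smoothF_integ] by metis

text \<open>At interior real points the differentiated normal form of \<open>I\<close> has the
  coefficients of \<open>f\<close>, so the coefficients of \<open>I\<close> are those of the
  primitive plus constants \<open>k b\<close>. Flatness extends this to all of \<open>J\<close>, and
  the condition at \<open>u\<close> disposes of the constants.\<close>

lemma integral_unique:
  assumes I: "smoothF J I" "I u = fzero" "\<And>x. x \<in> J \<Longrightarrow> derivF J I x = f x" and v: "v \<in> J"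
  shows "I v = integ v"
proof -
  obtain lw' rw' A' where g': "global_nf I lw' rw' A'" using global_nf_ex[OF I(1)] by blast
  have smA': "smooth (einterval lw' rw') (A' b)" for b using g' by (simp add: global_nf_def)
  have smA: "smooth W (A b)" for b using g by (simp add: global_nf_def)
  have core: "core \<subseteq> W" "core \<subseteq> einterval lw' rw'" using global_nf_core g g' by blast+
  have dA: "deriv (A' b) x = A b x" if x: "x \<in> core" for b x
  proof -
    have y: "const_fermat x \<in> J" by (rule const_fermat_in_J[OF x])
    obtain B B' where B: "exponents_near A B x" "exponents_near A' B' x"
      using global_nf_exponents_near[OF g, of x] global_nf_exponents_near[OF g', of x] x core by blast
    obtain e where L: "local_nf J I x e B' A'" using global_nf_local_nf[OF g' y] B(2) by auto
    have "f (const_fermat x) = nform B' (\<lambda>b. deriv (A' b)) (const_fermat x)"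
      using I(3)[OF y] derivF_local_nf[OF I(1) y] L by simp
    also have "\<dots> = frac (\<lambda>t. \<Sum>b\<in>B'. deriv (A' b) x * pw t b)"
      by (rule nform_const_fermat[of _ "einterval lw' rw'"])
        (use B(2) core x in \<open>auto simp: exponents_near_def intro: smooth_deriv smA'\<close>)
    finally have 1: "f (const_fermat x) = frac (\<lambda>t. \<Sum>b\<in>B'. deriv (A' b) x * pw t b)" .
    have "f (const_fermat x) = nform B A (const_fermat x)" using global_nf_nform[OF g y, of B] B(1) by simp
    also have "\<dots> = frac (\<lambda>t. \<Sum>b\<in>B. A b x * pw t b)"
      by (rule nform_const_fermat[of _ W]) (use B(1) core x smA in \<open>auto simp: exponents_near_def\<close>)
    finally have 2: "f (const_fermat x) = frac (\<lambda>t. \<Sum>b\<in>B. A b x * pw t b)" .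
    show ?thesis
    proof (rule frac_psum_unique[where c = "\<lambda>b. deriv (A' b) x" and c' = "\<lambda>b. A b x" and B = B' and B' = B])
      show "frac (\<lambda>t. \<Sum>b\<in>B'. deriv (A' b) x * pw t b) = frac (\<lambda>t. \<Sum>b\<in>B. A b x * pw t b)" using 1 2 by simp
      show "deriv (A' b) x = 0" if "b \<notin> B'" for b
        using vanish_derivs[of "ball x e" "A' b" x 1] L that by (simp add: local_nf_def)
      show "A b x = 0" if b: "b \<notin> B" for b
      proof -
        obtain e where "e > 0" "\<forall>z\<in>ball x e. A b z = 0" using B(1) b unfolding exponents_near_def by blast
        then show ?thesis by simp
      qed
    qed (use B in \<open>auto simp: exponents_near_def\<close>)
  qed
  have "\<exists>k. \<forall>x\<in>core. A' b x - F b x = k" for b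
  proof (rule has_field_derivative_zero_constant[OF convex_core])
    fix x assume x: "x \<in> core"
    have "((\<lambda>x. A' b x - F b x) has_real_derivative deriv (A' b) x - A b x) (at x)"
      using x core by (intro DERIV_diff smooth_has_deriv[OF smA'] F) auto
    then show "((\<lambda>x. A' b x - F b x) has_real_derivative 0) (at x within core)"
      using dA[OF x] by (simp add: has_field_derivative_at_within)
  qed
  then obtain k where k: "\<And>b x. x \<in> core \<Longrightarrow> A' b x - F b x = k b" by metis
  \<comment> \<open>On the interior the difference is identically zero; at an end it is only flat,
    which still gives \<open>o(t)\<close> along \<open>rep y\<close>.\<close>
  have flat: "is_o (\<lambda>t. A' b (rep y t) - (F b (rep y t) + k b))" if y: "y \<in> J" for b y
  proof -
    let ?S = "einterval lw' rw' \<inter> W"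
    have S: "std y \<in> ?S" using y g' std_W[OF y] by (auto simp: global_nf_def)
    have "is_o (\<lambda>t. (\<lambda>z. A' b z - (F b z + k b)) (rep y t))"
    proof (rule vanish_is_o[where S = ?S and T = core and y = "rep y" and f = "\<lambda>z. A' b z - (F b z + k b)"])
      show "smooth ?S (\<lambda>z. A' b z - (F b z + k b))"
        by (intro smooth_diff smooth_add smooth_const smooth_subset[OF smA'] smooth_subset[OF smooth_F]) auto
      show "rep y 0 \<in> closure (core \<inter> ?S)" "rep y 0 \<in> ?S"
        using std_closure_core[OF y open_Int[OF open_einterval open_einterval] S] S by (auto simp: std_def)
      show "A' b z - (F b z + k b) = 0" if "z \<in> core" for z using k[OF that, of b] by simp
    qed (auto simp: open_core)
    then show ?thesis .
  qed
  have ex: "\<exists>B. exponents_near A' B (std y)" if "y \<in> J" for y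
    using global_nf_exponents_near[OF g' global_nf_std[OF g' that]] .
  obtain B1 B2 B3 where Bs: "exponents_near F B1 (std u) \<and> exponents_near F B1 (std v)" "exponents_near A' B2 (std u)" "exponents_near A' B3 (std v)"
    using good_ex[OF v] ex[OF u] ex[OF v] by metis
  define B where "B = B1 \<union> (B2 \<union> B3)"
  have fB: "finite B" "B \<subseteq> {0..1}" using Bs by (auto simp: B_def exponents_near_def)
  have B: "exponents_near F B (std u)" "exponents_near F B (std v)" "exponents_near A' B (std u)" "exponents_near A' B (std v)"
    using Bs exponents_near_mono[OF _ _ fB] unfolding B_def by blast+
  have I_eq: "I y = frac (\<lambda>t. \<Sum>b\<in>B. (F b (rep y t) + k b) * pw t b)" if y: "y \<in> J" "exponents_near A' B (std y)" for y
  proof -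
    have "I y = nform B A' y" by (rule global_nf_nform[OF g' y])
    also have "\<dots> = frac (\<lambda>t. \<Sum>b\<in>B. (F b (rep y t) + k b) * pw t b)"
      unfolding nform_def
    proof (rule frac_cong)
      have "is_o (\<lambda>t. \<Sum>b\<in>B. (A' b (rep y t) - (F b (rep y t) + k b)) * pw t b)"
        using fB by (intro is_o_sum is_o_mult_pw flat y) auto
      then show "sim (\<lambda>t. \<Sum>b\<in>B. A' b (rep y t) * pw t b) (\<lambda>t. \<Sum>b\<in>B. (F b (rep y t) + k b) * pw t b)"
        by (simp add: sim_def left_diff_distrib sum_subtractf)
    qed
    finally show ?thesis .
  qed
  let ?S = "\<lambda>y t. \<Sum>b\<in>B. (F b (rep y t) + k b) * pw t b"
  have Ro: "?S y \<in> Ro" if "y \<in> J" for y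
    using Ro_nform[of B "\<lambda>b z. F b z + k b" "rep y"] fB Ro_add[OF F_Ro[OF that] Ro_const] by simp
  have "sim (?S u) (\<lambda>_. 0)"
    using I_eq[OF u B(3)] I(2) by (intro frac_eqD Ro u) (auto simp: fzero_def)
  then have "is_o (\<lambda>t. ?S u t)" by (simp add: sim_def)
  \<comment> \<open>What remains is the expansion of \<open>I u\<close>, which is
    \<open>o(t)\<close>; the constants \<open>k b\<close> need not be determined
    individually.\<close>
  moreover have "?S v t - increment B v t = ?S u t" for t
    unfolding increment_def by (simp add: sum_subtractf[symmetric] left_diff_distrib distrib_right add.commute)
  ultimately have "sim (?S v) (increment B v)" by (simp add: sim_def)
  then show ?thesis
    using I_eq[OF v B(4)] integ_eq[OF v B(1,2)] frac_cong by simp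
qed

lemma fint_eq_integ:
  assumes "v \<in> J"
  shows "fint J f u v = integ v"
proof -
  have "(THE I. smoothF J I \<and> I u = fzero \<and> (\<forall>x\<in>J. derivF J I x = f x) \<and> (\<forall>x. x \<notin> J \<longrightarrow> I x = fzero)) = integ"
  proof (rule the_equality)
    show "smoothF J integ \<and> integ u = fzero \<and> (\<forall>x\<in>J. derivF J integ x = f x) \<and> (\<forall>x. x \<notin> J \<longrightarrow> integ x = fzero)"
      using smoothF_integ integ_u derivF_integ by (simp add: integ_def)
    fix I assume I: "smoothF J I \<and> I u = fzero \<and> (\<forall>x\<in>J. derivF J I x = f x) \<and> (\<forall>x. x \<notin> J \<longrightarrow> I x = fzero)"
    show "I = integ"
    proof
      fix x show "I x = integ x"
        using integral_unique[of I x] I by (cases "x \<in> J") (auto simp: integ_def)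
    qed
  qed
  then show ?thesis by (simp add: fint_def)
qed

end

subsection \<open>Monotonicity\<close>

lemma is_o_abs: "is_o h \<Longrightarrow> is_o (\<lambda>t. \<bar>h t\<bar>)"
  by (simp add: is_o_iff)

lemma pderiv_sum: "pderiv (\<Sum>i\<in>I. p i) = (\<Sum>i\<in>I. pderiv (p i))"
  by (induction I rule: infinite_finite_induct) (auto simp: pderiv_add)

lemma smult_sum_right: "smult c (\<Sum>i\<in>I. p i) = (\<Sum>i\<in>I. smult c (p i))"
  by (induction I rule: infinite_finite_induct) (auto simp: smult_add_right)

text \<open>If the product is negative, exactly one factor is, and its negative part times the other
  factor, which is bounded, accounts for it.\<close>

lemma nonneg_o_mult:
  assumes "nonneg_o x" "nonneg_o y" "x \<in> Ro" "y \<in> Ro"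
  shows "nonneg_o (\<lambda>t. x t * y t)"
proof -
  have "is_o (\<lambda>t. y t * max 0 (- x t))" "is_o (\<lambda>t. x t * max 0 (- y t))"
    using assms by (auto simp: nonneg_o_def intro: is_o_mult_Ro)
  then have "is_o (\<lambda>t. \<bar>y t * max 0 (- x t)\<bar> + \<bar>x t * max 0 (- y t)\<bar>)"
    by (intro is_o_add is_o_abs)
  then show ?thesis
    unfolding nonneg_o_def
  proof (rule is_o_mono[where C = 1])
    have "\<bar>max 0 (- (x t * y t))\<bar> \<le> 1 * \<bar>\<bar>y t * max 0 (- x t)\<bar> + \<bar>x t * max 0 (- y t)\<bar>\<bar>" for t
      by (cases "x t \<ge> 0"; cases "y t \<ge> 0")
        (auto simp: max_def abs_mult mult_nonneg_nonneg mult_nonpos_nonpos mult_le_0_iff)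
    then show "eventually (\<lambda>t. \<bar>max 0 (- (x t * y t))\<bar> \<le> 1 * \<bar>\<bar>y t * max 0 (- x t)\<bar> + \<bar>x t * max 0 (- y t)\<bar>\<bar>) at0"
      by (rule always_eventually[OF allI])
  qed
qed

lemma nonneg_o_cmult: "nonneg_o x \<Longrightarrow> x \<in> Ro \<Longrightarrow> 0 \<le> c \<Longrightarrow> nonneg_o (\<lambda>t. c * x t)"
  by (rule nonneg_o_mult) (auto intro: fnnI_eventually)

text \<open>Converse of \<open>nonneg_o_psum_imp_lex_nonneg\<close> for coefficients that vary with
  \<open>t\<close>. A positive leading limit dominates everything after it. Before it a zero limit
  is not enough, because \<open>u b\<close> may tend to 0 slowly, hence the assumption that those
  coefficients are \<open>o(t)\<close>.\<close>

lemma lex_nonneg_imp_nonneg_o: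
  assumes B: "finite B" "B \<subseteq> {0..1}"
    and u: "\<And>b. b \<in> B \<Longrightarrow> (u b \<longlongrightarrow> c b) at0" "\<And>b. b \<in> B \<Longrightarrow> u b 0 = c b"
    and l: "lex_nonneg B c"
    and o: "\<And>b. b \<in> B \<Longrightarrow> \<forall>b'\<in>B. b' \<le> b \<longrightarrow> c b' = 0 \<Longrightarrow> is_o (u b)"
  shows "nonneg_o (\<lambda>t. \<Sum>b\<in>B. u b t * pw t b)"
proof (cases "\<forall>b\<in>B. c b = 0")
  case True
  then show ?thesis
    using B o by (intro is_o_imp_nonneg_o is_o_sum is_o_mult_pw) auto
next
  case False
  define b0 where "b0 = Min {b\<in>B. c b \<noteq> 0}"
  have fin: "finite {b\<in>B. c b \<noteq> 0}" using B by simp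
  have b0: "b0 \<in> B" "c b0 \<noteq> 0"
    using Min_in[OF fin] False unfolding b0_def by auto
  have before: "c b = 0" if "b \<in> B" "b < b0" for b
    using that Min_le[OF fin, of b] unfolding b0_def by force
  have pos: "c b0 > 0" using l b0 before unfolding lex_nonneg_def by force
  let ?B = "{b\<in>B. b0 \<le> b}"
  have fB: "finite ?B" using B by simp
  have "((\<lambda>t. (\<Sum>b\<in>?B. u b t * pw t b) / pw t b0) \<longlongrightarrow> c b0) (at_right 0)"
    by (rule pw_sum_lead[OF fB]) (use b0 u B in auto)
  then have "eventually (\<lambda>t. 0 < (\<Sum>b\<in>?B. u b t * pw t b) / pw t b0) (at_right 0)"
    using pos by (rule order_tendstoD(1))
  moreover have "eventually (\<lambda>t::real. t > 0) (at_right 0)"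
    by (simp add: eventually_at_right_less)
  ultimately have "eventually (\<lambda>t. 0 \<le> (\<Sum>b\<in>?B. u b t * pw t b)) (at_right 0)"
  proof eventually_elim
    case (elim t)
    then show ?case using pw_pos[of t b0] by (simp add: zero_less_divide_iff)
  qed
  \<comment> \<open>The filter \<open>at0\<close> contains the point 0, where only the exponent 0
    contributes; if present, it is the leading one.\<close>
  moreover have "0 \<le> (\<Sum>b\<in>?B. u b 0 * pw 0 b)"
  proof (rule sum_nonneg)
    fix b assume b: "b \<in> ?B"
    show "0 \<le> u b 0 * pw 0 b"
    proof (cases "b = 0")
      case True
      then have "b0 = 0" using b b0 B by force
      then show ?thesis using True pos u(2) b by simp
    next
      case False
      then show ?thesis by (simp add: pw_def)
    qed
  qed
  ultimately have "nonneg_o (\<lambda>t. \<Sum>b\<in>?B. u b t * pw t b)"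
    by (intro fnnI_eventually) (simp add: eventually_at0_at_right)
  moreover have "nonneg_o (\<lambda>t. \<Sum>b\<in>{b\<in>B. b < b0}. u b t * pw t b)"
    using B before by (intro is_o_imp_nonneg_o is_o_sum is_o_mult_pw o) auto
  ultimately have "nonneg_o (\<lambda>t. (\<Sum>b\<in>?B. u b t * pw t b) + (\<Sum>b\<in>{b\<in>B. b < b0}. u b t * pw t b))"
    by (rule nonneg_o_add)
  moreover have "(\<Sum>b\<in>?B. u b t * pw t b) + (\<Sum>b\<in>{b\<in>B. b < b0}. u b t * pw t b) = (\<Sum>b\<in>B. u b t * pw t b)" for t
  proof -
    have "B = ?B \<union> {b\<in>B. b < b0}" by auto
    then show ?thesis using sum.union_disjoint[of ?B "{b\<in>B. b < b0}" "\<lambda>b. u b t * pw t b"] B by force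
  qed
  ultimately show ?thesis by simp
qed

text \<open>If all earlier increments vanish, the earlier \<open>E b'\<close> vanish on the open
  interval, so \<open>E b\<close> is nonnegative there and \<open>H b\<close> increases. A zero
  increment then makes \<open>H b\<close> constant and \<open>E b\<close> zero, which keeps the
  induction going. The second conclusion later provides flatness at the ends.\<close>

lemma lex_nonneg_integral:
  fixes E H :: "real \<Rightarrow> real \<Rightarrow> real"
  assumes B: "finite B" and pq: "p < q"
    and D: "\<And>b s. p \<le> s \<Longrightarrow> s \<le> q \<Longrightarrow> (H b has_real_derivative E b s) (at s)"
    and l: "\<And>s. p < s \<Longrightarrow> s < q \<Longrightarrow> lex_nonneg B (\<lambda>b. E b s)"
  shows "lex_nonneg B (\<lambda>b. H b q - H b p)"
    and "b \<in> B \<Longrightarrow> \<forall>b'\<in>B. b' \<le> b \<longrightarrow> H b' q - H b' p = 0 \<Longrightarrow> p < s \<Longrightarrow> s < q \<Longrightarrow> E b s = 0"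
proof -
  have main: "0 \<le> H b q - H b p \<and> (H b q = H b p \<longrightarrow> (\<forall>s. p < s \<and> s < q \<longrightarrow> E b s = 0))"
    if "b \<in> B" "\<forall>b'\<in>B. b' < b \<longrightarrow> H b' q = H b' p" for b
    using that
  proof (induction "card {b'\<in>B. b' < b}" arbitrary: b rule: less_induct)
    case less
    have "E b' s = 0" if b': "b' \<in> B" "b' < b" and s: "p < s" "s < q" for b' s
    proof -
      have "card {b''\<in>B. b'' < b'} < card {b''\<in>B. b'' < b}"
        by (rule psubset_card_mono) (use B b' in auto)
      then show ?thesis using less.hyps[of b'] less.prems b' s by auto
    qed
    then have nn: "0 \<le> E b s" if "p < s" "s < q" for s
      using l[OF that] less.prems(1) that unfolding lex_nonneg_def by blast
    have mono: "H b x \<le> H b y" if "p \<le> x" "x \<le> y" "y \<le> q" for x y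
    proof (rule DERIV_nonneg_imp_increasing_open[OF that(2)])
      show "\<exists>d. (H b has_real_derivative d) (at s) \<and> 0 \<le> d" if "x < s" "s < y" for s
        using D[of s b] nn[of s] that \<open>p \<le> x\<close> \<open>y \<le> q\<close> by (intro exI[of _ "E b s"]) auto
      show "continuous_on {x..y} (H b)"
        using that by (intro continuous_at_imp_continuous_on ballI DERIV_isCont[OF D]) auto
    qed
    have "E b s = 0" if "H b q = H b p" "p < s" "s < q" for s
    proof -
      have const: "H b z = H b p" if "z \<in> {p<..<q}" for z
        using mono[of p z] mono[of z q] that \<open>H b q = H b p\<close> by auto
      have "(H b has_real_derivative 0) (at s)"
        by (rule has_field_derivative_transform_within_open[where f = "\<lambda>_. H b p" and S = "{p<..<q}"])
          (use const that in auto)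
      then show ?thesis using D[of s b] that DERIV_unique[of "H b" "E b s" s 0] by simp
    qed
    then show ?case using mono[of p q] pq by auto
  qed
  show "lex_nonneg B (\<lambda>b. H b q - H b p)" using main unfolding lex_nonneg_def by simp
  show "b \<in> B \<Longrightarrow> \<forall>b'\<in>B. b' \<le> b \<longrightarrow> H b' q - H b' p = 0 \<Longrightarrow> p < s \<Longrightarrow> s < q \<Longrightarrow> E b s = 0"
    using main[of b] by auto
qed

text \<open>Real constants strictly between the two standard parts also lie between the germs
  \<open>\<alpha>\<close> and \<open>\<beta>\<close>, so the hypothesis gives lexicographic signs at
  all of them, and these integrate.\<close>

lemma increment_nonneg_noninf:
  assumes S: "open S" "convex S" and sm: "\<And>b. smooth S (H b)"
    and B: "finite B" "B \<subseteq> {0..1}"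
    and ab: "\<alpha> \<in> Ro" "\<beta> \<in> Ro" "\<alpha> 0 \<in> S" "\<beta> 0 \<in> S" "\<alpha> 0 < \<beta> 0"
    and hyp: "\<And>y. y \<in> Ro \<Longrightarrow> nonneg_o (\<lambda>t. y t - \<alpha> t) \<Longrightarrow> nonneg_o (\<lambda>t. \<beta> t - y t) \<Longrightarrow>
      nonneg_o (\<lambda>t. \<Sum>b\<in>B. deriv (H b) (y t) * pw t b)"
  shows "nonneg_o (\<lambda>t. \<Sum>b\<in>B. (H b (\<beta> t) - H b (\<alpha> t)) * pw t b)"
proof -
  have sub: "{\<alpha> 0..\<beta> 0} \<subseteq> S"
    using S(2) ab closed_segment_subset[of "\<alpha> 0" S "\<beta> 0"] by (simp add: closed_segment_eq_real_ivl)
  have D: "(H b has_real_derivative deriv (H b) s) (at s)" if "\<alpha> 0 \<le> s" "s \<le> \<beta> 0" for b s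
    using sub that by (intro smooth_has_deriv[OF sm]) auto
  have l: "lex_nonneg B (\<lambda>b. deriv (H b) s)" if s: "\<alpha> 0 < s" "s < \<beta> 0" for s
  proof (rule nonneg_o_psum_imp_lex_nonneg[OF B])
    have "eventually (\<lambda>t. \<alpha> t < s) at0" "eventually (\<lambda>t. s < \<beta> t) at0"
      using order_tendstoD[OF Ro_tendsto[OF ab(1)]] order_tendstoD[OF Ro_tendsto[OF ab(2)]] s by auto
    then show "nonneg_o (\<lambda>t. \<Sum>b\<in>B. deriv (H b) s * pw t b)"
      by (intro hyp[of "\<lambda>_. s"] fnnI_eventually Ro_const) (erule eventually_mono, simp)+
  qed
  have li: "lex_nonneg B (\<lambda>b. H b (\<beta> 0) - H b (\<alpha> 0))"
    by (rule lex_nonneg_integral(1)[OF B(1) ab(5) D l])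
  have li2: "deriv (H b) s = 0"
    if "b \<in> B" "\<forall>b'\<in>B. b' \<le> b \<longrightarrow> H b' (\<beta> 0) - H b' (\<alpha> 0) = 0" "\<alpha> 0 < s" "s < \<beta> 0" for b s
    by (rule lex_nonneg_integral(2)[OF B(1) ab(5) D l that])
  show ?thesis
  proof (rule lex_nonneg_imp_nonneg_o[where u = "\<lambda>b t. H b (\<beta> t) - H b (\<alpha> t)", OF B _ refl li])
    fix b assume b: "b \<in> B"
    have comp: "(\<lambda>t. H b (y t)) \<in> Ro" if "y \<in> Ro" "y 0 \<in> S" for y
      by (rule smooth_comp_Ro[OF S(1) sm that])
    show "((\<lambda>t. H b (\<beta> t) - H b (\<alpha> t)) \<longlongrightarrow> H b (\<beta> 0) - H b (\<alpha> 0)) at0"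
      by (intro tendsto_diff Ro_tendsto[OF comp] ab)
    assume "\<forall>b'\<in>B. b' \<le> b \<longrightarrow> H b' (\<beta> 0) - H b' (\<alpha> 0) = 0"
    note z = li2[OF b this]
    \<comment> \<open>The midpoint only names the constant value of \<open>H b\<close> on the open
      interval. Both ends are compared with it by flatness, since \<open>\<alpha> t\<close> and
      \<open>\<beta> t\<close> may lie outside.\<close>
    define m where "m = (\<alpha> 0 + \<beta> 0) / 2"
    have const: "H b s = H b m" if "s \<in> {\<alpha> 0<..<\<beta> 0}" for s
    proof (rule const_on_convex[of "{\<alpha> 0<..<\<beta> 0}" "H b"])
      show "(H b has_real_derivative 0) (at s)" if "s \<in> {\<alpha> 0<..<\<beta> 0}" for s
        using D[of s b] z[of s] that by simp
    qed (use that ab(5) in \<open>auto simp: m_def\<close>)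
    have "is_o (\<lambda>t. H b (y t) - H b m)" if "y \<in> Ro" "y 0 \<in> {\<alpha> 0..\<beta> 0}" for y
    proof -
      have "y 0 \<in> closure {\<alpha> 0<..<\<beta> 0}" using that(2) closure_greaterThanLessThan[OF ab(5)] by simp
      moreover have "{\<alpha> 0<..<\<beta> 0} \<inter> S = {\<alpha> 0<..<\<beta> 0}" using sub by auto
      ultimately have cl: "y 0 \<in> closure ({\<alpha> 0<..<\<beta> 0} \<inter> S)" by simp
      show ?thesis
        by (rule vanish_is_o[where f = "\<lambda>z. H b z - H b m" and y = y and T = "{\<alpha> 0<..<\<beta> 0}", OF S(1) _ that(1) _ _ _ cl])
          (use const sub that(2) in \<open>auto intro: smooth_diff S(1) sm\<close>)
    qed
    from is_o_diff[OF this[OF ab(2)] this[OF ab(1)]] ab(5)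
    show "is_o (\<lambda>t. H b (\<beta> t) - H b (\<alpha> t))" by simp
  qed
qed

section \<open>Increments between infinitely close points\<close>

lemma coeff_pcompose_Ro:
  assumes "x \<in> Ro" "y \<in> Ro"
  shows "(\<lambda>t. coeff (pcompose p [:x t, y t:]) k) \<in> Ro"
proof (induction p arbitrary: k)
  case (pCons a p)
  \<comment> \<open>Horner's scheme: the coefficients of the composition arise from sums and
    products of germs.\<close>
  have "coeff (pcompose (pCons a p) [:x t, y t:]) k =
    coeff [:a:] k + (x t * coeff (pcompose p [:x t, y t:]) k +
      (case k of 0 \<Rightarrow> 0 | Suc k \<Rightarrow> y t * coeff (pcompose p [:x t, y t:]) k))" for t
    by (simp add: pcompose_pCons coeff_pCons split: nat.split)
  moreover have "(\<lambda>t. case k of 0 \<Rightarrow> 0 | Suc k \<Rightarrow> y t * coeff (pcompose p [:x t, y t:]) k) \<in> Ro"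
    by (cases k) (auto intro: Ro_mult assms pCons.IH)
  ultimately show ?case
    by (simp only:) (intro Ro_add Ro_mult Ro_const assms pCons.IH)
qed simp

lemma DERIV_power_Suc_divide: "((\<lambda>s. s ^ Suc k / real (Suc k)) has_real_derivative s ^ k) (at s)"
proof -
  have "((\<lambda>s. s ^ Suc k / real (Suc k)) has_real_derivative (real (Suc k) * s ^ k) / real (Suc k)) (at s)"
    by (intro DERIV_cdivide) (use DERIV_pow[of "Suc k" s] in simp)
  then show ?thesis by simp
qed

text \<open>Expanding the finitely many coefficients rearranges the polynomial into powers of
  \<open>t\<close> whose coefficients are real polynomials in \<open>s\<close>; lexicographic signs
  then integrate over the unit interval. The sum in the conclusion is that integral.\<close>

lemma nonneg_o_poly_integral:
  fixes r :: "nat \<Rightarrow> real \<Rightarrow> real"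
  assumes r: "\<And>k. r k \<in> Ro" and nn: "\<And>s. 0 < s \<Longrightarrow> s < 1 \<Longrightarrow> nonneg_o (\<lambda>t. \<Sum>k\<le>n. r k t * s ^ k)"
  shows "nonneg_o (\<lambda>t. \<Sum>k\<le>n. r k t / real (Suc k))"
proof -
  have "\<exists>B c. expan B c (r k)" for k using r Ro_iff by blast
  then obtain BB cc where E: "\<And>k. expan (BB k) (cc k) (r k)" by metis
  define B where "B = (\<Union>k\<le>n. BB k)"
  define c where "c k b = (if b \<in> BB k then cc k b else 0)" for k b
  have B: "finite B" "B \<subseteq> {0..1}" using E by (auto simp: B_def expan_def)
  have o: "is_o (\<lambda>t. r k t - (\<Sum>b\<in>B. c k b * pw t b))" if "k \<le> n" for k
    using expan_superset[OF E _ B] that by (auto simp: c_def B_def expan_def)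
  \<comment> \<open>The exchange of sums is done for arbitrary weights; it is used with
    \<open>w k = s ^ k\<close> and with the integrals \<open>1 / real (Suc k)\<close>.\<close>
  have lin: "is_o (\<lambda>t. (\<Sum>k\<le>n. r k t * w k) - (\<Sum>b\<in>B. (\<Sum>k\<le>n. c k b * w k) * pw t b))" for w
  proof -
    have "is_o (\<lambda>t. \<Sum>k\<le>n. w k * (r k t - (\<Sum>b\<in>B. c k b * pw t b)))"
      by (intro is_o_sum is_o_cmult o) simp
    moreover have "(\<Sum>k\<le>n. w k * (r k t - (\<Sum>b\<in>B. c k b * pw t b))) =
       (\<Sum>k\<le>n. r k t * w k) - (\<Sum>b\<in>B. (\<Sum>k\<le>n. c k b * w k) * pw t b)" for t
    proof -
      have "(\<Sum>b\<in>B. (\<Sum>k\<le>n. c k b * w k) * pw t b) = (\<Sum>k\<le>n. w k * (\<Sum>b\<in>B. c k b * pw t b))"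
        unfolding sum_distrib_left sum_distrib_right by (subst sum.swap) (simp add: mult_ac)
      then show ?thesis by (simp add: right_diff_distrib sum_subtractf mult.commute)
    qed
    ultimately show ?thesis by simp
  qed
  define H where "H b s = (\<Sum>k\<le>n. c k b * (s ^ Suc k / real (Suc k)))" for b s
  have D: "(H b has_real_derivative (\<Sum>k\<le>n. c k b * s ^ k)) (at s)" for b s
    unfolding H_def[abs_def]
  by (intro DERIV_sum DERIV_cmult DERIV_power_Suc_divide)
  have l: "lex_nonneg B (\<lambda>b. \<Sum>k\<le>n. c k b * s ^ k)" if "0 < s" "s < 1" for s
    by (rule nonneg_o_psum_imp_lex_nonneg[OF B nonneg_o_cong_o[OF lin nn[OF that]]])
  have "lex_nonneg B (\<lambda>b. H b 1 - H b 0)"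
    by (rule lex_nonneg_integral(1)[OF B(1) zero_less_one D l])
  then have "lex_nonneg B (\<lambda>b. \<Sum>k\<le>n. c k b * (1 / real (Suc k)))"
    by (simp add: H_def)
  then have "nonneg_o (\<lambda>t. \<Sum>b\<in>B. (\<Sum>k\<le>n. c k b * (1 / real (Suc k))) * pw t b)"
    by (intro lex_nonneg_imp_nonneg_o[OF B, where u = "\<lambda>b t. \<Sum>k\<le>n. c k b * (1 / real (Suc k))"]) auto
  moreover have "is_o (\<lambda>t. (\<Sum>b\<in>B. (\<Sum>k\<le>n. c k b * (1 / real (Suc k))) * pw t b) - (\<Sum>k\<le>n. r k t * (1 / real (Suc k))))"
    using is_o_uminus[OF lin[of "\<lambda>k. 1 / real (Suc k)"]] by simp
  ultimately have "nonneg_o (\<lambda>t. \<Sum>k\<le>n. r k t * (1 / real (Suc k)))" by (rule nonneg_o_cong_o[rotated])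
  then show ?thesis by simp
qed

text \<open>The sum on the right is the integral of \<open>R\<close> over the unit interval, term by
  term.\<close>

lemma poly_increment:
  fixes Q R :: "real poly"
  assumes "pderiv Q = smult w R" "degree R \<le> n"
  shows "poly Q 1 - poly Q 0 = w * (\<Sum>k\<le>n. coeff R k / real (Suc k))"
proof -
  have R: "poly R s = (\<Sum>k\<le>n. coeff R k * s ^ k)" for s
    by (subst poly_as_sum_of_monoms'[OF assms(2), symmetric]) (simp add: poly_sum poly_monom)
  let ?D = "\<lambda>s. poly Q s - w * (\<Sum>k\<le>n. coeff R k * (s ^ Suc k / real (Suc k)))"
  have "(?D has_real_derivative 0) (at s)" for s
  proof -
    have "(?D has_real_derivative poly (pderiv Q) s - w * (\<Sum>k\<le>n. coeff R k * s ^ k)) (at s)"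
      by (intro DERIV_diff poly_DERIV DERIV_cmult DERIV_sum DERIV_power_Suc_divide)
    then show ?thesis by (simp add: assms(1) R)
  qed
  then have "?D 1 = ?D 0" using DERIV_isconst_all by blast
  then show ?thesis by simp
qed

lemma poly_taylor: "poly (\<Sum>m<n. monom (a m) m) x = (\<Sum>m<n. a m * x ^ m :: real)"
  by (simp add: poly_sum poly_monom)

text \<open>No real number lies strictly between the standard parts, so the position
  \<open>s\<close> along the segment is the real variable to integrate over. Taylor polynomials at
  the common standard part make everything polynomial in \<open>s\<close>, and the chain rule splits
  off \<open>\<beta> t - \<alpha> t\<close> as a nonnegative factor.\<close>

lemma increment_nonneg_inf:
  assumes S: "open S" and sm: "\<And>b. smooth S (H b)"
    and B: "finite B" "B \<subseteq> {0..1}"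
    and ab: "\<alpha> \<in> Ro" "\<beta> \<in> Ro" "\<alpha> 0 \<in> S" "\<beta> 0 = \<alpha> 0" and le: "nonneg_o (\<lambda>t. \<beta> t - \<alpha> t)"
    and hyp: "\<And>y. y \<in> Ro \<Longrightarrow> nonneg_o (\<lambda>t. y t - \<alpha> t) \<Longrightarrow> nonneg_o (\<lambda>t. \<beta> t - y t) \<Longrightarrow>
      nonneg_o (\<lambda>t. \<Sum>b\<in>B. deriv (H b) (y t) * pw t b)"
  shows "nonneg_o (\<lambda>t. \<Sum>b\<in>B. (H b (\<beta> t) - H b (\<alpha> t)) * pw t b)"
proof -
  define c where "c = \<alpha> 0"
  have Ro_ab: "(\<lambda>t. \<alpha> t - c) \<in> Ro" "(\<lambda>t. \<beta> t - c) \<in> Ro" "(\<lambda>t. \<beta> t - \<alpha> t) \<in> Ro"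
    using ab by (auto intro: Ro_diff)
  obtain N1 N2 where N: "N1 > 0" "\<And>n. n \<ge> N1 \<Longrightarrow> is_o (\<lambda>t. (\<alpha> t - c) ^ n)"
      "\<And>n. n \<ge> N2 \<Longrightarrow> is_o (\<lambda>t. (\<beta> t - c) ^ n)"
    using Ro_power_is_o[OF Ro_ab(1)] Ro_power_is_o[OF Ro_ab(2)] ab by (auto simp: c_def)
  define n where "n = max N1 N2"
  have n: "n > 0" and po: "\<And>m. m \<ge> n \<Longrightarrow> is_o (\<lambda>t. (\<alpha> t - c) ^ m)" "\<And>m. m \<ge> n \<Longrightarrow> is_o (\<lambda>t. (\<beta> t - c) ^ m)"
    using N by (auto simp: n_def)
  \<comment> \<open>\<open>P\<close> is taken one degree higher than \<open>T\<close> so that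
    \<open>pderiv (P b) = T b\<close> holds exactly.\<close>
  define T where "T b = (\<Sum>m<n. monom ((deriv ^^ m) (deriv (H b)) c / fact m) m)" for b
  define P where "P b = (\<Sum>m<Suc n. monom ((deriv ^^ m) (H b) c / fact m) m)" for b
  have PT: "pderiv (P b) = T b" for b
  proof -
    have "pderiv (P b) = (\<Sum>m<n. pderiv (monom ((deriv ^^ Suc m) (H b) c / fact (Suc m)) (Suc m)))"
      unfolding P_def by (subst sum.lessThan_Suc_shift) (simp add: pderiv_add pderiv_sum pderiv_monom del: funpow.simps)
    also have "\<dots> = T b"
      unfolding T_def
    proof (rule sum.cong[OF refl])
      fix m
      have "(deriv ^^ Suc m) (H b) = (deriv ^^ m) (deriv (H b))" by (simp only: funpow_Suc_right comp_apply)
      then show "pderiv (monom ((deriv ^^ Suc m) (H b) c / fact (Suc m)) (Suc m)) =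
          monom ((deriv ^^ m) (deriv (H b)) c / fact m) m"
        by (simp add: pderiv_monom fact_Suc del: funpow.simps of_nat_Suc)
    qed
    finally show ?thesis .
  qed
  have degT: "degree (T b) \<le> n" for b
    unfolding T_def by (rule degree_sum_le) (auto intro: order_trans[OF degree_monom_le])
  \<comment> \<open>A polynomial in \<open>s\<close> tracing the segment from
    \<open>\<alpha> t - c\<close> to \<open>\<beta> t - c\<close>. Being linear it does not raise
    degrees, so the bound \<open>n\<close> is uniform in \<open>t\<close> and one finite sum over
    coefficients serves all \<open>t\<close>.\<close>
  define L where "L t = [:\<alpha> t - c, \<beta> t - \<alpha> t:]" for t
  define Q where "Q t = (\<Sum>b\<in>B. smult (pw t b) (pcompose (P b) (L t)))" for t
  define R where "R t = (\<Sum>b\<in>B. smult (pw t b) (pcompose (T b) (L t)))" for t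
  have QR: "pderiv (Q t) = smult (\<beta> t - \<alpha> t) (R t)" for t
    by (simp add: Q_def R_def pderiv_sum pderiv_smult pderiv_pcompose PT smult_sum_right L_def pderiv_pCons mult.commute)
  have degR: "degree (R t) \<le> n" for t
    unfolding R_def
  proof (rule degree_sum_le[OF B(1)])
    fix b
    have "degree (pcompose (T b) (L t)) \<le> degree (T b) * degree (L t)" by (rule degree_pcompose_le)
    also have "\<dots> \<le> n * 1" using degT by (intro mult_mono) (auto simp: L_def)
    finally show "degree (smult (pw t b) (pcompose (T b) (L t))) \<le> n"
      using degree_smult_le order_trans by fastforce
  qed
  have Rs: "poly (R t) s = (\<Sum>k\<le>n. coeff (R t) k * s ^ k)" for s t
    by (subst poly_as_sum_of_monoms'[OF degR, symmetric]) (simp add: poly_sum poly_monom)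
  have RRo: "(\<lambda>t. coeff (R t) k) \<in> Ro" for k
    unfolding R_def L_def coeff_sum coeff_smult
    using B Ro_pw[of _ 1] by (intro Ro_sum Ro_mult coeff_pcompose_Ro Ro_ab) auto
  have "nonneg_o (\<lambda>t. \<Sum>k\<le>n. coeff (R t) k / real (Suc k))"
  proof (rule nonneg_o_poly_integral[OF RRo])
    fix s :: real assume s: "0 < s" "s < 1"
    define y where "y t = \<alpha> t + s * (\<beta> t - \<alpha> t)" for t
    have y: "y \<in> Ro" unfolding y_def[abs_def] by (intro Ro_add Ro_cmult Ro_diff ab)
    have y0: "y 0 = c" using ab by (simp add: y_def c_def)
    \<comment> \<open>A convex combination is bounded by the larger of the two infinitesimals, so
      the exponent \<open>n\<close> chosen for both ends works for every \<open>s\<close>.\<close>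
    have "is_o (\<lambda>t. (y t - y 0) ^ n)"
    proof (rule is_o_mono[where C = 1])
      show "is_o (\<lambda>t. \<bar>(\<alpha> t - c) ^ n\<bar> + \<bar>(\<beta> t - c) ^ n\<bar>)"
        by (intro is_o_add is_o_abs po order_refl)
      have "\<bar>(y t - y 0) ^ n\<bar> \<le> 1 * \<bar>\<bar>(\<alpha> t - c) ^ n\<bar> + \<bar>(\<beta> t - c) ^ n\<bar>\<bar>" for t
      proof -
        have "y t - y 0 = (1 - s) * (\<alpha> t - c) + s * (\<beta> t - c)" unfolding y0 by (simp add: y_def algebra_simps)
        also have "\<bar>\<dots>\<bar> \<le> (1 - s) * \<bar>\<alpha> t - c\<bar> + s * \<bar>\<beta> t - c\<bar>"
          using s by (intro order_trans[OF abs_triangle_ineq]) (simp add: abs_mult)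
        also have "\<dots> \<le> (1 - s) * max \<bar>\<alpha> t - c\<bar> \<bar>\<beta> t - c\<bar> + s * max \<bar>\<alpha> t - c\<bar> \<bar>\<beta> t - c\<bar>"
          using s by (intro add_mono mult_left_mono) auto
        also have "\<dots> = max \<bar>\<alpha> t - c\<bar> \<bar>\<beta> t - c\<bar>" by (simp add: algebra_simps)
        finally have "\<bar>y t - y 0\<bar> ^ n \<le> max \<bar>\<alpha> t - c\<bar> \<bar>\<beta> t - c\<bar> ^ n" by (rule power_mono) simp
        also have "\<dots> \<le> \<bar>\<alpha> t - c\<bar> ^ n + \<bar>\<beta> t - c\<bar> ^ n" by (auto simp: max_def)
        finally show ?thesis by (simp add: power_abs)
      qed
      then show "eventually (\<lambda>t. \<bar>(y t - y 0) ^ n\<bar> \<le> 1 * \<bar>\<bar>(\<alpha> t - c) ^ n\<bar> + \<bar>(\<beta> t - c) ^ n\<bar>\<bar>) at0"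
        by (rule always_eventually[OF allI])
    qed
    from taylor_Ro_power[OF S smooth_deriv[OF sm] y _ n this]
    have "is_o (\<lambda>t. deriv (H b) (y t) - poly (T b) (y t - c))" for b
      using ab(3) by (simp add: y0 T_def poly_taylor c_def)
    then have "is_o (\<lambda>t. \<Sum>b\<in>B. (deriv (H b) (y t) - poly (T b) (y t - c)) * pw t b)"
      using B by (intro is_o_sum is_o_mult_pw) auto
    moreover have "(\<Sum>b\<in>B. (deriv (H b) (y t) - poly (T b) (y t - c)) * pw t b) =
        (\<Sum>b\<in>B. deriv (H b) (y t) * pw t b) - (\<Sum>k\<le>n. coeff (R t) k * s ^ k)" for t
    proof -
      have "poly (L t) s = y t - c" by (simp add: L_def y_def)
      then have "poly (R t) s = (\<Sum>b\<in>B. pw t b * poly (T b) (y t - c))"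
        by (simp add: R_def poly_sum poly_pcompose)
      then show ?thesis by (simp add: Rs right_diff_distrib sum_subtractf mult.commute)
    qed
    ultimately have o: "is_o (\<lambda>t. (\<Sum>b\<in>B. deriv (H b) (y t) * pw t b) - (\<Sum>k\<le>n. coeff (R t) k * s ^ k))"
      by simp
    have "nonneg_o (\<lambda>t. s * (\<beta> t - \<alpha> t))" "nonneg_o (\<lambda>t. (1 - s) * (\<beta> t - \<alpha> t))"
      using s by (auto intro!: nonneg_o_cmult le Ro_ab)
    then have "nonneg_o (\<lambda>t. y t - \<alpha> t)" "nonneg_o (\<lambda>t. \<beta> t - y t)" by (simp_all add: y_def algebra_simps)
    from hyp[OF y this] show "nonneg_o (\<lambda>t. \<Sum>k\<le>n. coeff (R t) k * s ^ k)" by (rule nonneg_o_cong_o[OF o])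
  qed
  moreover have "(\<lambda>t. \<Sum>k\<le>n. coeff (R t) k / real (Suc k)) \<in> Ro"
    using Ro_cmult[OF RRo, of "1 / real (Suc _)"] by (intro Ro_sum) simp
  ultimately have "nonneg_o (\<lambda>t. (\<beta> t - \<alpha> t) * (\<Sum>k\<le>n. coeff (R t) k / real (Suc k)))"
    using le Ro_ab(3) by (intro nonneg_o_mult)
  then have Q: "nonneg_o (\<lambda>t. poly (Q t) 1 - poly (Q t) 0)"
    using poly_increment[OF QR degR] by simp
  have tay: "is_o (\<lambda>t. H b (y t) - poly (P b) (y t - c))"
    if "y \<in> Ro" "y 0 = c" "is_o (\<lambda>t. (y t - c) ^ Suc n)" for y b
    using taylor_Ro_power[OF S sm that(1) _ _ that(3)[folded that(2)], of b] that(2) ab(3)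
    unfolding P_def poly_taylor c_def by simp
  have "is_o (\<lambda>t. \<Sum>b\<in>B. ((H b (\<beta> t) - poly (P b) (\<beta> t - c)) - (H b (\<alpha> t) - poly (P b) (\<alpha> t - c))) * pw t b)"
    using B by (intro is_o_sum is_o_mult_pw is_o_diff tay po ab) (auto simp: c_def ab)
  moreover have "(\<Sum>b\<in>B. ((H b (\<beta> t) - poly (P b) (\<beta> t - c)) - (H b (\<alpha> t) - poly (P b) (\<alpha> t - c))) * pw t b) =
      (\<Sum>b\<in>B. (H b (\<beta> t) - H b (\<alpha> t)) * pw t b) - (poly (Q t) 1 - poly (Q t) 0)" for t
    by (simp add: Q_def L_def poly_sum poly_pcompose sum_subtractf[symmetric] algebra_simps)
  ultimately have "is_o (\<lambda>t. (\<Sum>b\<in>B. (H b (\<beta> t) - H b (\<alpha> t)) * pw t b) - (poly (Q t) 1 - poly (Q t) 0))"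
    by simp
  from is_o_uminus[OF this] show ?thesis by (intro nonneg_o_cong_o[OF _ Q]) simp
qed

lemma increment_nonneg:
  assumes "open S" "convex S" "\<And>b. smooth S (H b)" "finite B" "B \<subseteq> {0..1}"
    and "\<alpha> \<in> Ro" "\<beta> \<in> Ro" "\<alpha> 0 \<in> S" "\<beta> 0 \<in> S" and le: "nonneg_o (\<lambda>t. \<beta> t - \<alpha> t)"
    and "\<And>y. y \<in> Ro \<Longrightarrow> nonneg_o (\<lambda>t. y t - \<alpha> t) \<Longrightarrow> nonneg_o (\<lambda>t. \<beta> t - y t) \<Longrightarrow>
      nonneg_o (\<lambda>t. \<Sum>b\<in>B. deriv (H b) (y t) * pw t b)"
  shows "nonneg_o (\<lambda>t. \<Sum>b\<in>B. (H b (\<beta> t) - H b (\<alpha> t)) * pw t b)"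
proof (cases "\<alpha> 0 < \<beta> 0")
  case True
  then show ?thesis by (intro increment_nonneg_noninf[OF assms(1-9)] assms(11))
next
  case False
  then have "\<beta> 0 = \<alpha> 0" using nonneg_o_0[OF le] by simp
  then show ?thesis by (intro increment_nonneg_inf[OF assms(1,3-8) _ le] assms(11))
qed

theorem theorem29:
  fixes J :: "fermat set" and f g :: "fermat \<Rightarrow> fermat" and a b :: fermat
  assumes "noninf_interval J"
    and "smoothF J f" and "smoothF J g"
    and "a \<in> J" and "b \<in> J" and "flt a b"
    and "\<forall>x. fle a x \<and> fle x b \<longrightarrow> fle (g x) (f x)"
  shows "fle (fint J g a b) (fint J f a b)"
proof -
  obtain l r where "finterval J l r" using noninf_interval_finterval[OF assms(1)] by blast
  then interpret finterval J l r .
  have ab: "fle a b" using assms(6) by (simp add: flt_def)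
  obtain lw rw A where A: "global_nf f lw rw A" using global_nf_ex[OF assms(2)] by blast
  obtain lw' rw' A' where A': "global_nf g lw' rw' A'" using global_nf_ex[OF assms(3)] by blast
  obtain F where F: "\<And>b x. x \<in> einterval lw rw \<Longrightarrow> (F b has_real_derivative A b x) (at x)"
    "\<And>x. x \<in> einterval lw rw \<Longrightarrow> \<exists>B. exponents_near F B x"
    using primitive_ex[OF A global_nf_std[OF A assms(4)]] by blast
  obtain G where G: "\<And>b x. x \<in> einterval lw' rw' \<Longrightarrow> (G b has_real_derivative A' b x) (at x)"
    "\<And>x. x \<in> einterval lw' rw' \<Longrightarrow> \<exists>B. exponents_near G B x"
    using primitive_ex[OF A' global_nf_std[OF A' assms(4)]] by blast
  interpret f: primitive J l r f lw rw A F a by unfold_locales (use A assms(4) F in auto)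
  interpret g: primitive J l r g lw' rw' A' G a by unfold_locales (use A' assms(4) G in auto)
  obtain B1 B2 where B12: "exponents_near F B1 (std a)" "exponents_near F B1 (std b)" "exponents_near G B2 (std a)" "exponents_near G B2 (std b)"
    using f.good_ex[OF assms(5)] g.good_ex[OF assms(5)] by blast
  obtain B3 where B3: "\<And>z. z \<in> closed_segment (std a) (std b) \<Longrightarrow> exponents_near A B3 z"
    using global_nf_exponents_near_segment[OF A global_nf_std[OF A assms(4)] global_nf_std[OF A assms(5)]] by blast
  obtain B4 where B4: "\<And>z. z \<in> closed_segment (std a) (std b) \<Longrightarrow> exponents_near A' B4 z"
    using global_nf_exponents_near_segment[OF A' global_nf_std[OF A' assms(4)] global_nf_std[OF A' assms(5)]] by blast
  \<comment> \<open>The primitives are needed at the two ends only, but \<open>A\<close> and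
    \<open>A'\<close> at every standard part between them, since the hypothesis is used at all
    Fermat reals between \<open>a\<close> and \<open>b\<close>.\<close>
  define B where "B = B1 \<union> B2 \<union> B3 \<union> B4"
  have B: "finite B" "B \<subseteq> {0..1}"
    using B12 B3[of "std a"] B4[of "std a"] by (auto simp: B_def exponents_near_def)
  note sup = exponents_near_mono[OF _ _ B]
  have supF: "exponents_near F B (std a)" "exponents_near F B (std b)" "exponents_near G B (std a)" "exponents_near G B (std b)"
    using B12 sup unfolding B_def by blast+
  have supA: "exponents_near A B z" "exponents_near A' B z" if "z \<in> closed_segment (std a) (std b)" for z
    using B3[OF that] B4[OF that] sup unfolding B_def by blast+
  let ?S = "einterval lw rw \<inter> einterval lw' rw'"
  have S: "open ?S" "convex ?S" by (auto intro: convex_Int convex_einterval)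
  have stdS: "std y \<in> ?S" if "y \<in> J" for y using f.std_W[OF that] g.std_W[OF that] by blast
  \<comment> \<open>By linearity the comparison becomes the sign of a single increment, whose
    integrand represents \<open>f - g\<close>.\<close>
  define H where "H b z = F b z - G b z" for b z
  have smH: "smooth ?S (H b)" for b
    unfolding H_def[abs_def]
    by (intro smooth_diff S smooth_subset[OF f.smooth_F] smooth_subset[OF g.smooth_F]) auto
  have dH: "deriv (H b) z = A b z - A' b z" if "z \<in> ?S" for b z
    unfolding H_def[abs_def] by (intro DERIV_imp_deriv DERIV_diff F G) (use that in auto)
  have "nonneg_o (\<lambda>t. \<Sum>b'\<in>B. (H b' (rep b t) - H b' (rep a t)) * pw t b')"
  proof (rule increment_nonneg[OF S smH B rep_Ro rep_Ro])
    show "rep a 0 \<in> ?S" "rep b 0 \<in> ?S" using stdS assms(4,5) by (auto simp: std_def)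
    show "nonneg_o (\<lambda>t. rep b t - rep a t)" using ab by (simp add: fle_iff)
    fix y assume y: "y \<in> Ro" and le: "nonneg_o (\<lambda>t. y t - rep a t)" "nonneg_o (\<lambda>t. rep b t - y t)"
    have aY: "fle a (frac y)" and Yb: "fle (frac y) b"
      using fle_frac[OF rep_Ro y, of a] fle_frac[OF y rep_Ro, of b] le by simp_all
    have YJ: "frac y \<in> J" by (rule convex[OF assms(4,5) aY Yb])
    have stdY: "std (frac y) = y 0" by (rule std_frac[OF y])
    have y0: "y 0 \<in> ?S" using stdS[OF YJ] stdY by simp
    have "y 0 \<in> closed_segment (std a) (std b)"
      using fle_std[OF aY] fle_std[OF Yb] stdY by (simp add: closed_segment_eq_real_ivl)
    note sA = supA[OF this]
    have fY: "f (frac y) = frac (\<lambda>t. \<Sum>b\<in>B. A b (y t) * pw t b)"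
      using global_nf_nform[OF A YJ] sA(1) nform_frac[OF B(2) global_nf_smooth[OF A] open_einterval y] y0 stdY by simp
    have gY: "g (frac y) = frac (\<lambda>t. \<Sum>b\<in>B. A' b (y t) * pw t b)"
      using global_nf_nform[OF A' YJ] sA(2) nform_frac[OF B(2) global_nf_smooth[OF A'] open_einterval y] y0 stdY by simp
    have RoA: "(\<lambda>t. \<Sum>b\<in>B. A b (y t) * pw t b) \<in> Ro" "(\<lambda>t. \<Sum>b\<in>B. A' b (y t) * pw t b) \<in> Ro"
      using y0 by (auto intro!: Ro_nform B(2) smooth_comp_Ro[OF open_einterval global_nf_smooth[OF A] y]
          smooth_comp_Ro[OF open_einterval global_nf_smooth[OF A'] y])
    have "fle (g (frac y)) (f (frac y))" using assms(7) aY Yb by blast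
    then have nn: "nonneg_o (\<lambda>t. (\<Sum>b\<in>B. A b (y t) * pw t b) - (\<Sum>b\<in>B. A' b (y t) * pw t b))"
      using fle_frac[OF RoA(2,1)] fY gY by simp
    have "eventually (\<lambda>t. y t \<in> ?S) at0"
      using Ro_tendsto[OF y] S(1) y0 by (rule topological_tendstoD)
    then have "eventually (\<lambda>t. (\<Sum>b\<in>B. A b (y t) * pw t b) - (\<Sum>b\<in>B. A' b (y t) * pw t b)
        = (\<Sum>b\<in>B. deriv (H b) (y t) * pw t b)) at0"
      by eventually_elim (simp add: dH left_diff_distrib sum_subtractf)
    from sim_eventually[OF this] nn show "nonneg_o (\<lambda>t. \<Sum>b\<in>B. deriv (H b) (y t) * pw t b)"
      unfolding sim_def by (rule nonneg_o_cong_o)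
  qed
  moreover have "(\<Sum>b'\<in>B. (H b' (rep b t) - H b' (rep a t)) * pw t b') = f.increment B b t - g.increment B b t" for t
    by (simp add: f.increment_def g.increment_def H_def sum_subtractf[symmetric] algebra_simps)
  ultimately have "nonneg_o (\<lambda>t. f.increment B b t - g.increment B b t)" by simp
  moreover have "f.increment B b \<in> Ro" "g.increment B b \<in> Ro"
    unfolding f.increment_def[abs_def] g.increment_def[abs_def]
    by (intro Ro_sum Ro_mult Ro_diff f.F_Ro g.F_Ro assms(4,5); use Ro_pw[of _ 1] B in force)+
  ultimately have "fle (frac (g.increment B b)) (frac (f.increment B b))" by (simp add: fle_frac)
  then show ?thesis
    by (simp add: f.fint_eq_integ[OF assms(5)] g.fint_eq_integ[OF assms(5)]
        f.integ_eq[OF assms(5) supF(1,2)] g.integ_eq[OF assms(5) supF(3,4)])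
qed

end
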